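(* Let $\mathcal{O}$ be a binary quadratic operad (with finite-dimensional space of generators) over a field $\mathbb{K}$ which is the linearization of a set operad $\mathcal{P}$, i.e. $\mathcal{O}=\widetilde{\mathcal{P}}$. Then: (1) ${}^2\mathcal{O}=\widetilde{\mathcal{P}\times_H{}^2\mathcal{C}om}$, i.e. ${}^2\mathcal{O}$ is the linearization of the set operad $\mathcal{P}\times_H{}^2\mathcal{C}om$; (2) $\Pi_{{}^2\mathcal{O}}=\Pi_{\mathcal{P}}\times_{\Pi}\Pi_{{}^2\mathcal{C}om}$.
   Context: A set operad $\mathcal{P}=(\mathcal{P}_n)_{n\ge1}$ is a symmetric operad in sets with composition $\mu(p;p_1,\dots,p_k)$; its linearization $\widetilde{\mathcal{P}}$ is the $\mathbb{K}$-linear operad $\widetilde{\mathcal{P}}(n)=\mathbb{K}[\mathcal{P}_n]$. The Hadamard product of set operads is $(\mathcal{P}\times_H\mathcal{Q})_n=\mathcal{P}_n\times\mathcal{Q}_n$ with componentwise composition. ${}^2\mathcal{C}om$, as a set operad, is $({}^2\mathcal{C}om)_n=\{D^n_0,\dots,D^n_{n-1}\}$ with trivial $\mathbb{S}_n$-action and $\mu(D^n_i;D^{m_1}_{i_1},\dots,D^{m_n}_{i_n})=D^{m_1+\dots+m_n}_{i+i_1+\dots+i_n}$; its linearization is the $\mathbb{K}$-linear operad ${}^2\mathcal{C}om$ of two totally compatible commutative associative products. Total compatibility. Let $\mathcal{O}=\mathcal{F}(V)/(R)$ be binary quadratic ($\mathcal{F}(V)$ the free operad on $V=V(2)$, quotient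 by the operadic ideal generated by $R\subset\mathcal{F}(V)(3)$), $V$ with basis $e_1,\dots,e_s$. $\mathcal{F}(V)(3)$ has basis $T^1_{i,j}=e_j(e_i(1,2),3)$, $T^2_{i,j}=e_j(e_i(2,3),1)$, $T^3_{i,j}=e_j(e_i(3,1),2)$; let $R$ be spanned by $\sum_{l,i,j}\gamma^{k,l}_{i,j}T^l_{i,j}$, $1\le k\le t$. Let $V_\circ,V_\bullet$ be copies of $V$ with bases $e_i^\circ,e_i^\bullet$, $R_\circ,R_\bullet$ the corresponding copies of $R$, and $T^l_{i,j}(x,y)$, $x,y\in\{\circ,\bullet\}$, the tree $T^l_{i,j}$ with inner vertex decorated by $e_i^x$ and root vertex by $e_j^y$. Then ${}^2\mathcal{O}:=\mathcal{F}(V_\circ\oplus V_\bullet)/(R_\circ\cup R_\bullet\cup{}_{\circ\bullet}R)$, where ${}_{\circ\bullet}R$ consists of all $T^l_{i,j}(\circ,\bullet)-T^l_{i,j}(\bullet,\circ)$ and all $\sum_{l,i,j}\gamma^{k,l}_{i,j}T^l_{i,j}(\circ,\bullet)$. Operadic partition poset. $\Pi_{\mathcal{P}}(n)$ is the set of $\{(A_1,p_1),\dots,(A_r,p_r)\}$ with $\{A_1,\dots,A_r\}$ a partition of $[n]$ and $p_i\in\mathcal{P}_{|A_i|}$, where $p_i$ is viewed as an operation with inputs labelled by the elements of $A_i$ in increasing order. One sets $\{(A_i,p_i)\}\le\{(B_j,q_j)\}$ if $\{A_i\}$ refines $\{B_j\}$ and, whenever $B_j=A_{i_1}\cup\dots\cup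 A_{i_t}$, there is $p\in\mathcal{P}_t$ such that, as operations with inputs labelled by $B_j$, $q_j$ equals the composite $\mu(p;p_{i_1},\dots,p_{i_t})$. $\Pi_{\mathcal{P}}=\{\Pi_{\mathcal{P}}(n)\}_{n\ge1}$. If an algebraic operad is the linearization of a set operad $\mathcal{Q}$, its operadic partition poset means $\Pi_{\mathcal{Q}}$; thus $\Pi_{{}^2\mathcal{O}}$ means $\Pi_{\mathcal{P}\times_H{}^2\mathcal{C}om}$, via (1). Fiber product. $\Pi_n$ is the poset of partitions of $[n]$ ordered by refinement, $\Pi=\{\Pi_n\}$. $\Pi_{\mathcal{P}}\times_\Pi\Pi_{\mathcal{Q}}$ consists, for each $n$, of the pairs $(\alpha,\beta)\in\Pi_{\mathcal{P}}(n)\times\Pi_{\mathcal{Q}}(n)$ with the same underlying partition, with the order induced by the product order; a pair $(\{(A_i,p_i)\},\{(A_i,q_i)\})$ is identified with $\{(A_i,(p_i,q_i))\}$. *)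

theory Defs
  imports
    Complex_Main
    "HOL-Library.Poly_Mapping"
    "HOL-Library.Multiset"
    "HOL-Library.Disjoint_Sets"
    "HOL-Combinatorics.Permutations"
begin

text \<open>
  Operads are indexed by arities \<open>n \<ge> 1\<close>; the inputs of an operation of arity \<open>n\<close> are numbered
  \<open>0, \<dots>, n - 1\<close>.  Since the sets \<open>ops P n\<close> need not be disjoint, the arguments of a composition
  carry their arities: \<open>comp P p [(m\<^sub>1,p\<^sub>1), \<dots>, (m\<^sub>k,p\<^sub>k)]\<close> is \<open>\<mu>(p; p\<^sub>1, \<dots>, p\<^sub>k)\<close> with
  \<open>p \<in> ops P k\<close> and \<open>p\<^sub>i \<in> ops P m\<^sub>i\<close>.

  The symmetric groups act by relabelling of inputs: \<open>act P n \<sigma> p\<close> is \<open>p\<close> with input \<open>i\<close> renamed to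
  \<open>\<sigma> i\<close>, that is \<open>(\<sigma> p)(x\<^sub>0, \<dots>, x\<^bsub>n-1\<^esub>) = p(x\<^bsub>\<sigma> 0\<^esub>, \<dots>, x\<^bsub>\<sigma> (n-1)\<^esub>)\<close>.  This is a left action; the
  customary right action of \<open>\<sigma>\<close> is the left action of its inverse.
\<close>

record 'p operad =
  ops  :: "nat \<Rightarrow> 'p set"
  unit :: 'p
  comp :: "'p \<Rightarrow> (nat \<times> 'p) list \<Rightarrow> 'p"
  act  :: "nat \<Rightarrow> (nat \<Rightarrow> nat) \<Rightarrow> 'p \<Rightarrow> 'p"

definition operad_args :: "('p, 'z) operad_scheme \<Rightarrow> (nat \<times> 'p) list \<Rightarrow> bool" where
  "operad_args P xs \<longleftrightarrow> xs \<noteq> [] \<and> (\<forall>(m, q) \<in> set xs. 1 \<le> m \<and> q \<in> ops P m)"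

definition arity_sum :: "(nat \<times> 'p) list \<Rightarrow> nat" where
  "arity_sum xs = sum_list (map fst xs)"

definition offset :: "nat list \<Rightarrow> nat \<Rightarrow> nat" where
  "offset ms i = sum_list (take i ms)"

definition list_perm :: "nat list \<Rightarrow> nat \<Rightarrow> nat" where
  "list_perm ls i = (if i < length ls then ls ! i else i)"

text \<open>
  \<open>sum_perm ms \<sigma>s\<close> is the block sum \<open>\<sigma>s 0 \<oplus> \<dots> \<oplus> \<sigma>s (k - 1)\<close> for blocks of lengths
  \<open>ms = [m\<^sub>0, \<dots>, m\<^bsub>k-1\<^esub>]\<close>.  \<open>block_perm ms \<sigma>\<close> sends the consecutive blocks of lengths
  \<open>m\<^bsub>\<sigma> 0\<^esub>, m\<^bsub>\<sigma> 1\<^esub>, \<dots>\<close> to the blocks \<open>\<sigma> 0, \<sigma> 1, \<dots>\<close> of the decomposition with lengths \<open>ms\<close>.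
\<close>

definition sum_perm :: "nat list \<Rightarrow> (nat \<Rightarrow> nat \<Rightarrow> nat) \<Rightarrow> nat \<Rightarrow> nat" where
  "sum_perm ms \<sigma>s =
     list_perm (concat (map (\<lambda>k. map (\<lambda>r. offset ms k + \<sigma>s k r) [0..<ms ! k]) [0..<length ms]))"

definition block_perm :: "nat list \<Rightarrow> (nat \<Rightarrow> nat) \<Rightarrow> nat \<Rightarrow> nat" where
  "block_perm ms \<sigma> =
     list_perm (concat (map (\<lambda>k. [offset ms (\<sigma> k) ..< offset ms (\<sigma> k) + ms ! \<sigma> k])
                            [0..<length ms]))"

locale set_operad =
  fixes P :: "'p operad"
  assumes unit_closed: "unit P \<in> ops P 1"
    and comp_closed: "\<lbrakk>operad_args P xs; p \<in> ops P (length xs)\<rbrakk>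
          \<Longrightarrow> comp P p xs \<in> ops P (arity_sum xs)"
    and act_closed: "\<lbrakk>1 \<le> n; \<sigma> permutes {..<n}; p \<in> ops P n\<rbrakk> \<Longrightarrow> act P n \<sigma> p \<in> ops P n"
    and act_id: "\<lbrakk>1 \<le> n; p \<in> ops P n\<rbrakk> \<Longrightarrow> act P n id p = p"
    and act_comp: "\<lbrakk>1 \<le> n; \<sigma> permutes {..<n}; \<rho> permutes {..<n}; p \<in> ops P n\<rbrakk>
          \<Longrightarrow> act P n (\<sigma> \<circ> \<rho>) p = act P n \<sigma> (act P n \<rho> p)"
    and comp_unit_left: "\<lbrakk>1 \<le> n; p \<in> ops P n\<rbrakk> \<Longrightarrow> comp P (unit P) [(n, p)] = p"
    and comp_unit_right: "\<lbrakk>1 \<le> n; p \<in> ops P n\<rbrakk> \<Longrightarrow> comp P p (replicate n (1, unit P)) = p"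
    and comp_assoc: "\<lbrakk>operad_args P xs; p \<in> ops P (length xs); length yss = length xs;
            \<And>i. i < length xs \<Longrightarrow> operad_args P (yss ! i) \<and> length (yss ! i) = fst (xs ! i)\<rbrakk>
          \<Longrightarrow> comp P (comp P p xs) (concat yss) =
              comp P p (map2 (\<lambda>(m, q) ys. (arity_sum ys, comp P q ys)) xs yss)"
    and comp_act_inner: "\<lbrakk>operad_args P xs; p \<in> ops P (length xs);
            \<And>i. i < length xs \<Longrightarrow> \<sigma>s i permutes {..<fst (xs ! i)}\<rbrakk>
          \<Longrightarrow> comp P p (map (\<lambda>i. (fst (xs ! i), act P (fst (xs ! i)) (\<sigma>s i) (snd (xs ! i))))
                           [0..<length xs]) =
              act P (arity_sum xs) (sum_perm (map fst xs) \<sigma>s) (comp P p xs)"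
    and comp_act_outer: "\<lbrakk>operad_args P xs; p \<in> ops P (length xs); \<sigma> permutes {..<length xs}\<rbrakk>
          \<Longrightarrow> comp P (act P (length xs) \<sigma> p) xs =
              act P (arity_sum xs) (block_perm (map fst xs) \<sigma>)
                (comp P p (map (\<lambda>i. xs ! \<sigma> i) [0..<length xs]))"

definition hadamard :: "'p operad \<Rightarrow> 'q operad \<Rightarrow> ('p \<times> 'q) operad" where
  "hadamard P Q = \<lparr>
     ops = (\<lambda>n. ops P n \<times> ops Q n),
     unit = (unit P, unit Q),
     comp = (\<lambda>(p, q) xs. (comp P p (map (\<lambda>(m, x). (m, fst x)) xs),
                          comp Q q (map (\<lambda>(m, x). (m, snd x)) xs))),
     act = (\<lambda>n \<sigma> (p, q). (act P n \<sigma> p, act Q n \<sigma> q)) \<rparr>"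

text \<open>The set operad of two totally compatible commutative associative products; the operation
  \<open>D\<^sup>n\<^sub>i\<close> is represented by its lower index \<open>i\<close>.\<close>

definition two_Com :: "nat operad" where
  "two_Com = \<lparr>
     ops = (\<lambda>n. {..<n}),
     unit = 0,
     comp = (\<lambda>i xs. i + sum_list (map snd xs)),
     act = (\<lambda>n \<sigma> i. i) \<rparr>"

text \<open>The linear structure on arity \<open>n\<close> takes \<open>n\<close> as an argument because in a quotient operad the
  zero coset, for example, depends on it.\<close>

record ('k, 'a) lin_operad = "'a operad" +
  zero  :: "nat \<Rightarrow> 'a"
  add   :: "nat \<Rightarrow> 'a \<Rightarrow> 'a \<Rightarrow> 'a"
  smult :: "nat \<Rightarrow> 'k \<Rightarrow> 'a \<Rightarrow> 'a"

text \<open>The linearization \<open>K[P\<^sub>n]\<close>: finitely supported functions on \<open>P\<^sub>n\<close>, with the action extended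
  linearly and the composition extended multilinearly.\<close>

definition linearize :: "'p operad \<Rightarrow> ('k::field, 'p \<Rightarrow>\<^sub>0 'k) lin_operad" where
  "linearize P = \<lparr>
     ops = (\<lambda>n. {f. Poly_Mapping.keys f \<subseteq> ops P n}),
     unit = Poly_Mapping.single (unit P) 1,
     comp = (\<lambda>f gs. \<Sum>p\<in>Poly_Mapping.keys f.
               \<Sum>xs | list_all2 (\<lambda>(m, q) (m', g). m = m' \<and> q \<in> Poly_Mapping.keys g) xs gs.
                 Poly_Mapping.single (comp P p xs)
                   (Poly_Mapping.lookup f p *
                    prod_list (map2 (\<lambda>(m, q) (m', g). Poly_Mapping.lookup g q) xs gs))),
     act = (\<lambda>n \<sigma> f. \<Sum>p\<in>Poly_Mapping.keys f.
              Poly_Mapping.single (act P n \<sigma> p) (Poly_Mapping.lookup f p)),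
     zero = (\<lambda>n. 0),
     add = (\<lambda>n f g. f + g),
     smult = (\<lambda>n c f. Poly_Mapping.map ((*) c) f) \<rparr>"

definition lin_operad_iso :: "('k, 'a) lin_operad \<Rightarrow> ('k, 'b) lin_operad \<Rightarrow> bool" where
  "lin_operad_iso A B \<longleftrightarrow> (\<exists>\<phi>.
     (\<forall>n\<ge>1. bij_betw (\<phi> n) (ops A n) (ops B n)) \<and>
     (\<forall>n\<ge>1. \<forall>x\<in>ops A n. \<forall>y\<in>ops A n. \<phi> n (add A n x y) = add B n (\<phi> n x) (\<phi> n y)) \<and>
     (\<forall>n\<ge>1. \<forall>c. \<forall>x\<in>ops A n. \<phi> n (smult A n c x) = smult B n c (\<phi> n x)) \<and>
     (\<forall>n\<ge>1. \<forall>\<sigma> x. \<sigma> permutes {..<n} \<longrightarrow> x \<in> ops A n \<longrightarrow>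
        \<phi> n (act A n \<sigma> x) = act B n \<sigma> (\<phi> n x)) \<and>
     \<phi> 1 (unit A) = unit B \<and>
     (\<forall>x xs. operad_args A xs \<longrightarrow> x \<in> ops A (length xs) \<longrightarrow>
        \<phi> (arity_sum xs) (comp A x xs) =
        comp B (\<phi> (length xs) x) (map (\<lambda>(m, y). (m, \<phi> m y)) xs)))"

definition is_linearization :: "('k::field, 'a) lin_operad \<Rightarrow> 'p operad \<Rightarrow> bool" where
  "is_linearization A P \<longleftrightarrow> set_operad P \<and> lin_operad_iso A (linearize P)"

definition operadic_ideal :: "('k, 'a) lin_operad \<Rightarrow> (nat \<Rightarrow> 'a set) \<Rightarrow> bool" where
  "operadic_ideal A I \<longleftrightarrow>
     (\<forall>n. I n \<subseteq> ops A n \<and> zero A n \<in> I n \<and>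
        (\<forall>x\<in>I n. \<forall>y\<in>I n. add A n x y \<in> I n) \<and>
        (\<forall>c. \<forall>x\<in>I n. smult A n c x \<in> I n) \<and>
        (\<forall>\<sigma>. \<sigma> permutes {..<n} \<longrightarrow> (\<forall>x\<in>I n. act A n \<sigma> x \<in> I n))) \<and>
     (\<forall>x xs. operad_args A xs \<longrightarrow> x \<in> ops A (length xs) \<longrightarrow>
        (x \<in> I (length xs) \<or> (\<exists>(m, y) \<in> set xs. y \<in> I m)) \<longrightarrow>
        comp A x xs \<in> I (arity_sum xs))"

definition ideal_generated ::
    "('k, 'a) lin_operad \<Rightarrow> (nat \<Rightarrow> 'a set) \<Rightarrow> nat \<Rightarrow> 'a set" where
  "ideal_generated A G n = \<Inter> {I n | I. operadic_ideal A I \<and> (\<forall>m. G m \<subseteq> I m)}"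

definition coset :: "('k, 'a) lin_operad \<Rightarrow> (nat \<Rightarrow> 'a set) \<Rightarrow> nat \<Rightarrow> 'a \<Rightarrow> 'a set" where
  "coset A I n x = add A n x ` I n"

text \<open>The operations on cosets are the unions of the results over all representatives.\<close>

definition quotient_operad ::
    "('k, 'a) lin_operad \<Rightarrow> (nat \<Rightarrow> 'a set) \<Rightarrow> ('k, 'a set) lin_operad" where
  "quotient_operad A I = \<lparr>
     ops = (\<lambda>n. coset A I n ` ops A n),
     unit = coset A I 1 (unit A),
     comp = (\<lambda>X Xs. \<Union>x\<in>X. \<Union>xs\<in>{xs. list_all2 (\<lambda>(m, y) (m', Y). m = m' \<and> y \<in> Y) xs Xs}.
               coset A I (arity_sum xs) (comp A x xs)),
     act = (\<lambda>n \<sigma> X. \<Union>x\<in>X. coset A I n (act A n \<sigma> x)),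
     zero = (\<lambda>n. coset A I n (zero A n)),
     add = (\<lambda>n X Y. \<Union>x\<in>X. \<Union>y\<in>Y. coset A I n (add A n x y)),
     smult = (\<lambda>n c X. \<Union>x\<in>X. coset A I n (smult A n c x)) \<rparr>"

text \<open>
  \<open>V = V(2)\<close> is given by a finite basis \<open>(e\<^sub>i)\<^bsub>i \<in> E\<^esub>\<close> and the matrix \<open>\<tau>\<close> of the transposition:
  \<open>e\<^sub>i(2,1) = \<Sum>\<^sub>j \<tau> i j e\<^sub>j(1,2)\<close>.
\<close>

definition S2_module :: "'e set \<Rightarrow> ('e \<Rightarrow> 'e \<Rightarrow> 'k::field) \<Rightarrow> bool" where
  "S2_module E \<tau> \<longleftrightarrow> finite E \<and>
     (\<forall>i\<in>E. \<forall>j\<in>E. (\<Sum>k\<in>E. \<tau> i k * \<tau> k j) = (if i = j then 1 else 0))"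

datatype (vertices: 'e, 'l) btree = Leaf 'l | Node 'e "('e, 'l) btree" "('e, 'l) btree"

primrec leaves :: "('e, 'l) btree \<Rightarrow> 'l multiset" where
  "leaves (Leaf a) = {#a#}"
| "leaves (Node e s t) = leaves s + leaves t"

primrec graft :: "('e, 'l) btree \<Rightarrow> ('l \<Rightarrow> ('e, 'm) btree) \<Rightarrow> ('e, 'm) btree" where
  "graft (Leaf a) h = h a"
| "graft (Node e s t) h = Node e (graft s h) (graft t h)"

text \<open>Planar binary trees with vertices decorated by \<open>E\<close> and leaves labelled bijectively by
  \<open>0, \<dots>, n - 1\<close>: the free set operad on binary operations \<open>E\<close> without symmetry.\<close>

definition tree_operad :: "'e set \<Rightarrow> ('e, nat) btree operad" where
  "tree_operad E = \<lparr>
     ops = (\<lambda>n. {t. vertices t \<subseteq> E \<and> leaves t = mset [0..<n]}),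
     unit = Leaf 0,
     comp = (\<lambda>t xs. graft t (\<lambda>i. map_btree id (\<lambda>r. offset (map fst xs) i + r) (snd (xs ! i)))),
     act = (\<lambda>n \<sigma>. map_btree id \<sigma>) \<rparr>"

text \<open>
  \<open>\<F>(V)\<close> is obtained from the free operad on the free \<open>\<S>\<^sub>2\<close>-module over the \<open>e\<^sub>i\<close>, i.e. the
  linearization of the tree operad, by imposing the \<open>\<S>\<^sub>2\<close>-action of \<open>V\<close> on the generators.
\<close>

definition symmetry_relations ::
    "'e set \<Rightarrow> ('e \<Rightarrow> 'e \<Rightarrow> 'k::field) \<Rightarrow> nat \<Rightarrow> (('e, nat) btree \<Rightarrow>\<^sub>0 'k) set" where
  "symmetry_relations E \<tau> n = (if n = 2 then
     {Poly_Mapping.single (Node i (Leaf 1) (Leaf 0)) 1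
        - (\<Sum>j\<in>E. Poly_Mapping.single (Node j (Leaf 0) (Leaf 1)) (\<tau> i j)) | i. i \<in> E} else {})"

definition symmetry_ideal ::
    "'e set \<Rightarrow> ('e \<Rightarrow> 'e \<Rightarrow> 'k::field) \<Rightarrow> nat \<Rightarrow> (('e, nat) btree \<Rightarrow>\<^sub>0 'k) set" where
  "symmetry_ideal E \<tau> = ideal_generated (linearize (tree_operad E)) (symmetry_relations E \<tau>)"

definition free_operad ::
    "'e set \<Rightarrow> ('e \<Rightarrow> 'e \<Rightarrow> 'k::field) \<Rightarrow> ('k, (('e, nat) btree \<Rightarrow>\<^sub>0 'k) set) lin_operad" where
  "free_operad E \<tau> = quotient_operad (linearize (tree_operad E)) (symmetry_ideal E \<tau>)"

definition free_class ::
    "'e set \<Rightarrow> ('e \<Rightarrow> 'e \<Rightarrow> 'k::field) \<Rightarrow> nat \<Rightarrow> (('e, nat) btree \<Rightarrow>\<^sub>0 'k)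
       \<Rightarrow> (('e, nat) btree \<Rightarrow>\<^sub>0 'k) set" where
  "free_class E \<tau> = coset (linearize (tree_operad E)) (symmetry_ideal E \<tau>)"

text \<open>\<open>T\<^sup>1\<^bsub>i,j\<^esub> = e\<^sub>j(e\<^sub>i(1,2),3)\<close>, \<open>T\<^sup>2\<^bsub>i,j\<^esub> = e\<^sub>j(e\<^sub>i(2,3),1)\<close>, \<open>T\<^sup>3\<^bsub>i,j\<^esub> = e\<^sub>j(e\<^sub>i(3,1),2)\<close>, with inputs
  numbered from \<open>0\<close>.\<close>

definition T_tree :: "nat \<Rightarrow> 'e \<Rightarrow> 'e \<Rightarrow> ('e, nat) btree" where
  "T_tree l i j =
     (if l = 1 then Node j (Node i (Leaf 0) (Leaf 1)) (Leaf 2)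
      else if l = 2 then Node j (Node i (Leaf 1) (Leaf 2)) (Leaf 0)
      else Node j (Node i (Leaf 2) (Leaf 0)) (Leaf 1))"

text \<open>The space \<open>R\<close> is spanned by the classes of \<open>\<Sum> \<gamma> k l i j T\<^sup>l\<^bsub>i,j\<^esub>\<close>, \<open>1 \<le> k \<le> t\<close>.  It suffices to
  give these \<open>t\<close> elements, as only the operadic ideal generated by \<open>R\<close> is used.\<close>

definition quadratic_relations ::
    "'e set \<Rightarrow> ('e \<Rightarrow> 'e \<Rightarrow> 'k::field) \<Rightarrow> nat \<Rightarrow> (nat \<Rightarrow> nat \<Rightarrow> 'e \<Rightarrow> 'e \<Rightarrow> 'k)
       \<Rightarrow> nat \<Rightarrow> (('e, nat) btree \<Rightarrow>\<^sub>0 'k) set set" where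
  "quadratic_relations E \<tau> t \<gamma> n = (if n = 3 then
     {free_class E \<tau> 3
        (\<Sum>l\<in>{1..3}. \<Sum>i\<in>E. \<Sum>j\<in>E. Poly_Mapping.single (T_tree l i j) (\<gamma> k l i j))
      | k. k \<in> {1..t}} else {})"

definition quadratic_operad ::
    "'e set \<Rightarrow> ('e \<Rightarrow> 'e \<Rightarrow> 'k::field) \<Rightarrow> nat \<Rightarrow> (nat \<Rightarrow> nat \<Rightarrow> 'e \<Rightarrow> 'e \<Rightarrow> 'k)
       \<Rightarrow> ('k, (('e, nat) btree \<Rightarrow>\<^sub>0 'k) set set) lin_operad" where
  "quadratic_operad E \<tau> t \<gamma> = quotient_operad (free_operad E \<tau>)
     (ideal_generated (free_operad E \<tau>) (quadratic_relations E \<tau> t \<gamma>))"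

text \<open>\<open>V\<^sub>\<circ> \<oplus> V\<^sub>\<bullet>\<close> has the basis \<open>E \<times> {\<circ>, \<bullet>}\<close> and the block diagonal action.\<close>

datatype colour = White | Black

definition two_gens :: "'e set \<Rightarrow> ('e \<times> colour) set" where
  "two_gens E = E \<times> UNIV"

definition two_action ::
    "('e \<Rightarrow> 'e \<Rightarrow> 'k::field) \<Rightarrow> 'e \<times> colour \<Rightarrow> 'e \<times> colour \<Rightarrow> 'k" where
  "two_action \<tau> = (\<lambda>(i, x) (j, y). if x = y then \<tau> i j else 0)"

text \<open>\<open>coloured_relation E \<gamma> k x y = \<Sum> \<gamma> k l i j T\<^sup>l\<^bsub>i,j\<^esub>(x,y)\<close>, where the inner vertex has colour \<open>x\<close> and
  the root vertex has colour \<open>y\<close>.\<close>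

definition coloured_relation ::
    "'e set \<Rightarrow> (nat \<Rightarrow> nat \<Rightarrow> 'e \<Rightarrow> 'e \<Rightarrow> 'k::field) \<Rightarrow> nat \<Rightarrow> colour \<Rightarrow> colour
       \<Rightarrow> (('e \<times> colour, nat) btree \<Rightarrow>\<^sub>0 'k)" where
  "coloured_relation E \<gamma> k x y =
     (\<Sum>l\<in>{1..3}. \<Sum>i\<in>E. \<Sum>j\<in>E. Poly_Mapping.single (T_tree l (i, x) (j, y)) (\<gamma> k l i j))"

definition two_relations ::
    "'e set \<Rightarrow> ('e \<Rightarrow> 'e \<Rightarrow> 'k::field) \<Rightarrow> nat \<Rightarrow> (nat \<Rightarrow> nat \<Rightarrow> 'e \<Rightarrow> 'e \<Rightarrow> 'k)
       \<Rightarrow> nat \<Rightarrow> (('e \<times> colour, nat) btree \<Rightarrow>\<^sub>0 'k) set set" where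
  "two_relations E \<tau> t \<gamma> n = (if n = 3 then free_class (two_gens E) (two_action \<tau>) 3 `
     ({coloured_relation E \<gamma> k White White | k. k \<in> {1..t}} \<union>
      {coloured_relation E \<gamma> k Black Black | k. k \<in> {1..t}} \<union>
      {Poly_Mapping.single (T_tree l (i, White) (j, Black)) 1
         - Poly_Mapping.single (T_tree l (i, Black) (j, White)) 1
       | l i j. l \<in> {1..3} \<and> i \<in> E \<and> j \<in> E} \<union>
      {coloured_relation E \<gamma> k White Black | k. k \<in> {1..t}}) else {})"

definition two_operad ::
    "'e set \<Rightarrow> ('e \<Rightarrow> 'e \<Rightarrow> 'k::field) \<Rightarrow> nat \<Rightarrow> (nat \<Rightarrow> nat \<Rightarrow> 'e \<Rightarrow> 'e \<Rightarrow> 'k)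
       \<Rightarrow> ('k, (('e \<times> colour, nat) btree \<Rightarrow>\<^sub>0 'k) set set) lin_operad" where
  "two_operad E \<tau> t \<gamma> = quotient_operad (free_operad (two_gens E) (two_action \<tau>))
     (ideal_generated (free_operad (two_gens E) (two_action \<tau>)) (two_relations E \<tau> t \<gamma>))"

definition underlying :: "(nat set \<times> 'p) set \<Rightarrow> nat set set" where
  "underlying \<alpha> = fst ` \<alpha>"

definition operadic_partitions :: "'p operad \<Rightarrow> nat \<Rightarrow> (nat set \<times> 'p) set set" where
  "operadic_partitions P n = {\<alpha>. partition_on {1..n} (underlying \<alpha>) \<and> inj_on fst \<alpha> \<and>
     (\<forall>(A, p) \<in> \<alpha>. p \<in> ops P (card A))}"

text \<open>
  The composite \<open>\<mu>(p; p\<^sub>1, \<dots>, p\<^sub>t)\<close> of a list \<open>[(A\<^sub>1,p\<^sub>1), \<dots>, (A\<^sub>t,p\<^sub>t)]\<close> of blocks has its inputs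
  labelled, in this order, by the elements of \<open>A\<^sub>1\<close> increasingly, then those of \<open>A\<^sub>2\<close>, and so on.
  An element of \<open>P\<close> in arity \<open>card B\<close> has input \<open>r\<close> labelled by the element of \<open>B\<close> of rank \<open>r\<close>;
  so the composite becomes such an element after renaming each input to the rank of its label.
\<close>

definition block_labels :: "(nat set \<times> 'p) list \<Rightarrow> nat list" where
  "block_labels bs = concat (map (\<lambda>(A, p). sorted_list_of_set A) bs)"

definition rank_in :: "nat set \<Rightarrow> nat \<Rightarrow> nat" where
  "rank_in B x = card {b \<in> B. b < x}"

definition labelled_comp :: "'p operad \<Rightarrow> 'p \<Rightarrow> (nat set \<times> 'p) list \<Rightarrow> nat set \<Rightarrow> 'p" where
  "labelled_comp P p bs B =
     act P (card B) (list_perm (map (rank_in B) (block_labels bs)))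
       (comp P p (map (\<lambda>(A, a). (card A, a)) bs))"

definition operadic_le ::
    "'p operad \<Rightarrow> nat \<Rightarrow> (nat set \<times> 'p) set \<Rightarrow> (nat set \<times> 'p) set \<Rightarrow> bool" where
  "operadic_le P n \<alpha> \<beta> \<longleftrightarrow> refines {1..n} (underlying \<alpha>) (underlying \<beta>) \<and>
     (\<forall>(B, q) \<in> \<beta>. \<forall>bs. distinct bs \<and> set bs \<subseteq> \<alpha> \<and> B = (\<Union>(A, p) \<in> set bs. A) \<longrightarrow>
        (\<exists>p \<in> ops P (length bs). q = labelled_comp P p bs B))"

definition fiber_product ::
    "'p operad \<Rightarrow> 'q operad \<Rightarrow> nat \<Rightarrow> ((nat set \<times> 'p) set \<times> (nat set \<times> 'q) set) set" where
  "fiber_product P Q n = {(\<alpha>, \<beta>). \<alpha> \<in> operadic_partitions P n \<and> \<beta> \<in> operadic_partitions Q n \<and>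
     underlying \<alpha> = underlying \<beta>}"

definition fiber_le ::
    "'p operad \<Rightarrow> 'q operad \<Rightarrow> nat \<Rightarrow> (nat set \<times> 'p) set \<times> (nat set \<times> 'q) set
       \<Rightarrow> (nat set \<times> 'p) set \<times> (nat set \<times> 'q) set \<Rightarrow> bool" where
  "fiber_le P Q n = (\<lambda>(\<alpha>, \<beta>) (\<alpha>', \<beta>'). operadic_le P n \<alpha> \<alpha>' \<and> operadic_le Q n \<beta> \<beta>')"

text \<open>The identification of \<open>({(A\<^sub>i,p\<^sub>i)}, {(A\<^sub>i,q\<^sub>i)})\<close> with \<open>{(A\<^sub>i,(p\<^sub>i,q\<^sub>i))}\<close>.\<close>

definition merge_decorations ::
    "(nat set \<times> 'p) set \<times> (nat set \<times> 'q) set \<Rightarrow> (nat set \<times> ('p \<times> 'q)) set" where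
  "merge_decorations = (\<lambda>(\<alpha>, \<beta>). {(A, (p, q)) | A p q. (A, p) \<in> \<alpha> \<and> (A, q) \<in> \<beta>})"

definition poset_is_fiber_product ::
    "('p \<times> 'q) operad \<Rightarrow> 'p operad \<Rightarrow> 'q operad \<Rightarrow> bool" where
  "poset_is_fiber_product S P Q \<longleftrightarrow> (\<forall>n\<ge>1.
     bij_betw merge_decorations (fiber_product P Q n) (operadic_partitions S n) \<and>
     (\<forall>x \<in> fiber_product P Q n. \<forall>y \<in> fiber_product P Q n.
        fiber_le P Q n x y \<longleftrightarrow>
        operadic_le S n (merge_decorations x) (merge_decorations y)))"

end

theory Submission
  imports Defs
begin

text \<open>
  A coloured tree is sent to its uncoloured class in \<open>P\<close> paired with its number of black vertices, which
  defines a morphism from the free operad on \<open>V\<^sub>\<circ> \<oplus> V\<^sub>\<bullet>\<close> onto the linearization of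
  \<open>P \<times>\<^sub>H \<^sup>2Com\<close> that kills the relations of \<open>\<^sup>2O\<close>.  For injectivity, the swap relations (together
  with the symmetries of the generators) make any two colourings of a tree with equally many black vertices
  congruent.  Colouring a tree canonically with \<open>b\<close> black vertices is therefore compatible with
  composition modulo the relations of \<open>\<^sup>2O\<close>, so the elements that every such colouring sends to a relation of
  \<open>\<^sup>2O\<close> form an operadic ideal; it contains the relations of \<open>O\<close>, hence all of its ideal of relations.

  Linearizations are handled as free vector spaces: \<open>lbind\<close> is linear extension, and multilinear
  composition is \<open>lbind\<close> over the formal tensor product \<open>list_tensor\<close> of the arguments.
\<close>


section \<open>Free vector spaces and linearized operads\<close>

text \<open>The isomorphism of O with the linearization of \<open>P\<close> may send a tree to a
  combination of elements of \<open>P\<close>, and no normal form of trees modulo the relations of O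
  is available. The coloured morphism is therefore vector-valued: it tensors the image of the
  uncoloured tree with D^n_b, where b counts the black vertices. A tree with n leaves has n - 1
  vertices, which accounts for the n operations D^n_0, ..., D^n_(n-1). Its kernel is derived from
  the kernel for O: a combination of coloured trees splits by the number of black vertices, the
  image splits accordingly, and each uncoloured part is a relation of O that can be painted again. A
  presented operad is a quotient of a quotient of linearized trees. All ideals are pulled back to
  trees, where the relations form the least ideal containing the symmetries and the quadratic
  relations, so that inclusions are tested on generators. Painting in preorder blackens the root
  first; with one black vertex a quadratic relation thus becomes its copy with white inner and black
  root vertex, which is the mixed family imposed in the definition of the doubled operad.\<close>

abbreviation pure :: "'a \<Rightarrow> 'a \<Rightarrow>\<^sub>0 'k::comm_ring_1" where
  "pure a \<equiv> Poly_Mapping.single a 1"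

abbreviation scale :: "'k::comm_ring_1 \<Rightarrow> ('a \<Rightarrow>\<^sub>0 'k) \<Rightarrow> ('a \<Rightarrow>\<^sub>0 'k)" where
  "scale c \<equiv> Poly_Mapping.map ((*) c)"

definition lbind :: "('a \<Rightarrow>\<^sub>0 'k::comm_ring_1) \<Rightarrow> ('a \<Rightarrow> 'b \<Rightarrow>\<^sub>0 'k) \<Rightarrow> ('b \<Rightarrow>\<^sub>0 'k)" where
  "lbind f F = (\<Sum>a\<in>Poly_Mapping.keys f. scale (Poly_Mapping.lookup f a) (F a))"

lemma lookup_scale [simp]: "Poly_Mapping.lookup (scale c f) a = c * Poly_Mapping.lookup f a"
  by (simp add: Poly_Mapping.map.rep_eq when_def)

lemma lookup_lbind:
  "Poly_Mapping.lookup (lbind f F) b =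
     (\<Sum>a\<in>Poly_Mapping.keys f. Poly_Mapping.lookup f a * Poly_Mapping.lookup (F a) b)"
  by (simp add: lbind_def lookup_sum)

text \<open>Keys outside the support contribute zero, so sums over different supports can be moved
  to one common finite index set; additivity and associativity of \<open>lbind\<close> are then
  checked coefficientwise.\<close>

lemma lookup_lbind_superset:
  assumes "finite S" "Poly_Mapping.keys f \<subseteq> S"
  shows "Poly_Mapping.lookup (lbind f F) b =
     (\<Sum>a\<in>S. Poly_Mapping.lookup f a * Poly_Mapping.lookup (F a) b)"
  unfolding lookup_lbind
  by (rule sum.mono_neutral_left) (use assms in \<open>auto simp: in_keys_iff\<close>)

lemma scale_1 [simp]: "scale 1 f = f"
  and scale_0_left [simp]: "scale 0 f = 0"
  and scale_0_right [simp]: "scale c 0 = 0"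
  and scale_minus_1: "scale (-1) f = - f"
  and scale_single [simp]: "scale c (Poly_Mapping.single a d) = Poly_Mapping.single a (c * d)"
  by (auto intro!: poly_mapping_eqI simp: lookup_add algebra_simps lookup_single when_def)

lemma keys_scale: "Poly_Mapping.keys (scale c f) \<subseteq> Poly_Mapping.keys f"
  by (auto simp: in_keys_iff)

lemma keys_lbind:
  "Poly_Mapping.keys (lbind f F) \<subseteq> (\<Union>a\<in>Poly_Mapping.keys f. Poly_Mapping.keys (F a))"
proof
  fix b assume "b \<in> Poly_Mapping.keys (lbind f F)"
  then have "(\<Sum>a\<in>Poly_Mapping.keys f. Poly_Mapping.lookup f a * Poly_Mapping.lookup (F a) b) \<noteq> 0"
    by (simp add: in_keys_iff lookup_lbind)
  then obtain a where a: "a \<in> Poly_Mapping.keys f"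
      "Poly_Mapping.lookup f a * Poly_Mapping.lookup (F a) b \<noteq> 0"
    by (meson sum.neutral)
  then have "Poly_Mapping.lookup (F a) b \<noteq> 0"
    by auto
  with a show "b \<in> (\<Union>a\<in>Poly_Mapping.keys f. Poly_Mapping.keys (F a))"
    by (metis UN_I in_keys_iff)
qed

lemma lbind_cong:
  "\<lbrakk>f = g; \<And>a. a \<in> Poly_Mapping.keys g \<Longrightarrow> F a = G a\<rbrakk> \<Longrightarrow> lbind f F = lbind g G"
  by (simp add: lbind_def)

lemma lbind_zero_left [simp]: "lbind 0 F = 0"
  by (simp add: lbind_def)

lemma lbind_zero_right [simp]: "lbind f (\<lambda>a. 0) = 0"
  by (simp add: lbind_def)

lemma lbind_single [simp]: "lbind (Poly_Mapping.single a c) F = scale c (F a)"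
  by (cases "c = 0") (simp_all add: lbind_def)

lemma lbind_pure_right [simp]: "lbind f pure = f"
proof (rule poly_mapping_eqI)
  fix b
  show "Poly_Mapping.lookup (lbind f pure) b = Poly_Mapping.lookup f b"
    \<comment> \<open>Adjoining \<open>b\<close> to the index set lets the delta sum collapse to the
      coefficient at \<open>b\<close>, whether or not \<open>b\<close> is in the support.\<close>
    unfolding lookup_lbind_superset[of "insert b (Poly_Mapping.keys f)" f, simplified, OF subset_insertI]
    by (auto simp: lookup_single when_def if_distrib[of "(*) _"] cong: if_cong)
qed

lemma lbind_add_left: "lbind (f + g) F = lbind f F + lbind g F"
proof (rule poly_mapping_eqI)
  fix b
  let ?S = "Poly_Mapping.keys f \<union> Poly_Mapping.keys g"
  have "Poly_Mapping.keys (f + g) \<subseteq> ?S"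
    by (rule keys_add)
  then show "Poly_Mapping.lookup (lbind (f + g) F) b = Poly_Mapping.lookup (lbind f F + lbind g F) b"
    by (simp add: lookup_add lookup_lbind_superset[of ?S] algebra_simps sum.distrib)
qed

lemma lbind_scale_left: "lbind (scale c f) F = scale c (lbind f F)"
  by (rule poly_mapping_eqI, subst lookup_lbind_superset[OF finite_keys keys_scale])
    (simp add: lookup_lbind sum_distrib_left mult.assoc)

lemma lbind_minus_left: "lbind (- f) F = - lbind f F"
  using lbind_scale_left[of "-1" f F] by (simp add: scale_minus_1)

lemma lbind_diff_left: "lbind (f - g) F = lbind f F - lbind g F"
  using lbind_add_left[of f "- g" F] by (simp add: lbind_minus_left)

lemma lbind_sum_left: "lbind (\<Sum>i\<in>I. f i) F = (\<Sum>i\<in>I. lbind (f i) F)"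
  by (induction I rule: infinite_finite_induct) (simp_all add: lbind_add_left)

lemma lbind_add_right: "lbind f (\<lambda>a. F a + G a) = lbind f F + lbind f G"
  by (rule poly_mapping_eqI) (simp add: lookup_add lookup_lbind algebra_simps sum.distrib)

lemma lbind_scale_right: "lbind f (\<lambda>a. scale c (F a)) = scale c (lbind f F)"
  by (rule poly_mapping_eqI) (simp add: lookup_lbind sum_distrib_left mult.left_commute)

lemma lbind_minus_right: "lbind f (\<lambda>a. - F a) = - lbind f F"
  using lbind_scale_right[of f "-1" F] by (simp add: scale_minus_1)

lemma lbind_diff_right: "lbind f (\<lambda>a. F a - G a) = lbind f F - lbind f G"
  using lbind_add_right[of f F "\<lambda>a. - G a"] by (simp add: lbind_minus_right)

lemma lbind_assoc: "lbind (lbind f F) G = lbind f (\<lambda>a. lbind (F a) G)"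
proof (rule poly_mapping_eqI)
  fix c
  let ?S = "\<Union>a\<in>Poly_Mapping.keys f. Poly_Mapping.keys (F a)"
  have "Poly_Mapping.lookup (lbind (lbind f F) G) c =
      (\<Sum>b\<in>?S. \<Sum>a\<in>Poly_Mapping.keys f. Poly_Mapping.lookup f a *
         (Poly_Mapping.lookup (F a) b * Poly_Mapping.lookup (G b) c))"
    by (subst lookup_lbind_superset[OF _ keys_lbind])
      (auto simp: lookup_lbind sum_distrib_right mult.assoc)
  also have "\<dots> = (\<Sum>a\<in>Poly_Mapping.keys f. Poly_Mapping.lookup f a *
      (\<Sum>b\<in>?S. Poly_Mapping.lookup (F a) b * Poly_Mapping.lookup (G b) c))"
    by (subst sum.swap) (simp add: sum_distrib_left)
  also have "\<dots> = Poly_Mapping.lookup (lbind f (\<lambda>a. lbind (F a) G)) c"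
    unfolding lookup_lbind[of f]
    by (intro sum.cong refl, subst lookup_lbind_superset[of ?S]) auto
  finally show "Poly_Mapping.lookup (lbind (lbind f F) G) c =
      Poly_Mapping.lookup (lbind f (\<lambda>a. lbind (F a) G)) c" .
qed

lemma lbind_commute:
  "lbind f (\<lambda>a. lbind g (\<lambda>b. H a b)) = lbind g (\<lambda>b. lbind f (\<lambda>a. H a b))"
proof (rule poly_mapping_eqI)
  fix c
  show "Poly_Mapping.lookup (lbind f (\<lambda>a. lbind g (\<lambda>b. H a b))) c =
      Poly_Mapping.lookup (lbind g (\<lambda>b. lbind f (\<lambda>a. H a b))) c"
    unfolding lookup_lbind sum_distrib_left
    by (subst sum.swap) (simp add: mult.left_commute)
qed

lemma lbind_in_subspace:
  assumes "0 \<in> N" "\<And>x y. \<lbrakk>x \<in> N; y \<in> N\<rbrakk> \<Longrightarrow> x + y \<in> N" "\<And>c x. x \<in> N \<Longrightarrow> scale c x \<in> N"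
    and "\<And>a. a \<in> Poly_Mapping.keys f \<Longrightarrow> F a \<in> N"
  shows "lbind f F \<in> N"
proof -
  have "(\<Sum>a\<in>S. scale (Poly_Mapping.lookup f a) (F a)) \<in> N"
    if "finite S" "S \<subseteq> Poly_Mapping.keys f" for S
    using that by (induction S rule: finite_induct) (auto simp: assms)
  then show ?thesis
    by (simp add: lbind_def)
qed

section \<open>Tensor products of arguments and multilinear composition\<close>

fun list_tensor :: "(nat \<times> ('a \<Rightarrow>\<^sub>0 'k::comm_ring_1)) list \<Rightarrow> (nat \<times> 'a) list \<Rightarrow>\<^sub>0 'k" where
  "list_tensor [] = pure []"
| "list_tensor ((m, g) # gs) = lbind g (\<lambda>a. lbind (list_tensor gs) (\<lambda>xs. pure ((m, a) # xs)))"

text \<open>Coefficients multiply in a tensor product. This matches the recursion with the explicit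
  product in \<open>linearize\<close>; the arity labels travel along, so that a basis list can be
  passed to \<open>comp\<close> as it is.\<close>

lemma lookup_list_tensor:
  "Poly_Mapping.lookup (list_tensor gs) xs =
     (if list_all2 (\<lambda>(m, q) (m', g). m = m' \<and> q \<in> Poly_Mapping.keys g) xs gs
      then prod_list (map2 (\<lambda>(m, q) (m', g). Poly_Mapping.lookup g q) xs gs) else 0)"
proof (induction gs arbitrary: xs)
  case Nil
  then show ?case
    by (auto simp: lookup_single when_def)
next
  case (Cons mg gs)
  obtain m g where mg: "mg = (m, g)"
    by fastforce
  let ?l = "Poly_Mapping.lookup"
  show ?case
  proof (cases xs)
    case Nil
    then show ?thesis
      by (simp add: mg lookup_lbind lookup_single)
  next
    case (Cons mq ys)
    obtain m' q where mq: "mq = (m', q)"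
      by fastforce
    \<comment> \<open>Prefixing \<open>(m, a)\<close> is injective on lists, so only the tail
      \<open>ys\<close> can contribute to this coefficient.\<close>
    have 1: "?l (lbind (list_tensor gs) (\<lambda>xs. pure ((m, a) # xs))) ((m', q) # ys) =
        (if m = m' \<and> a = q then ?l (list_tensor gs) ys else 0)" for a
    proof -
      have "?l (lbind (list_tensor gs) (\<lambda>xs. pure ((m, a) # xs))) ((m', q) # ys) =
         (if m = m' \<and> a = q then ?l (lbind (list_tensor gs) pure) ys else 0)"
        unfolding lookup_lbind by (auto simp: lookup_single when_def intro!: sum.neutral)
      then show ?thesis by simp
    qed
    have "?l (list_tensor (mg # gs)) xs =
       (\<Sum>a\<in>Poly_Mapping.keys g. if a = q then (if m = m' then ?l g q * ?l (list_tensor gs) ys else 0) else 0)"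
      unfolding mg Cons mq list_tensor.simps lookup_lbind[of g] 1 by (intro sum.cong) auto
    then show ?thesis
      by (auto simp: Cons.IH mg Cons mq)
  qed
qed

lemma keys_list_tensor:
  "xs \<in> Poly_Mapping.keys (list_tensor gs) \<Longrightarrow>
     list_all2 (\<lambda>(m, q) (m', g). m = m' \<and> q \<in> Poly_Mapping.keys g) xs gs"
  by (auto simp: in_keys_iff lookup_list_tensor split: if_splits)

text \<open>The composition in \<open>linearize\<close> sums over this set, and a sum over an
  infinite set would be zero by convention.\<close>

lemma finite_list_all2_keys:
  "finite {xs. list_all2 (\<lambda>(m, q) (m', g). m = m' \<and> q \<in> Poly_Mapping.keys g) xs gs}" (is "finite (?S gs)")
proof (induction gs)
  case (Cons mg gs)
  obtain m g where mg: "mg = (m, g)"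
    by fastforce
  have "?S (mg # gs) \<subseteq> (\<lambda>(a, xs). (m, a) # xs) ` (Poly_Mapping.keys g \<times> ?S gs)"
    by (auto simp: mg list_all2_Cons2 image_iff)
  then show ?case
    by (rule finite_subset) (use Cons in simp)
qed simp

text \<open>Turns the multilinear formula into nested linear extensions. Later identities between
  composites then follow from \<open>lbind_assoc\<close> and \<open>lbind_commute\<close> instead of
  from manipulations of sums.\<close>

lemma linearize_comp:
  "comp (linearize P) f gs = lbind f (\<lambda>p. lbind (list_tensor gs) (\<lambda>xs. pure (comp P p xs)))"
proof -
  let ?S = "{xs. list_all2 (\<lambda>(m, q) (m', g). m = m' \<and> q \<in> Poly_Mapping.keys g) xs gs}"
  have "lbind (list_tensor gs) (\<lambda>xs. pure (comp P p xs)) =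
     (\<Sum>xs\<in>?S. Poly_Mapping.single (comp P p xs)
        (prod_list (map2 (\<lambda>(m, q) (m', g). Poly_Mapping.lookup g q) xs gs)))" for p
    by (rule poly_mapping_eqI, subst lookup_lbind_superset[of ?S])
      (auto simp: finite_list_all2_keys keys_list_tensor lookup_sum lookup_list_tensor lookup_single
         when_def intro!: sum.cong)
  then show ?thesis
    by (simp add: linearize_def lbind_def sum_distrib_left flip: sum_distrib_left)
      (auto intro!: sum.cong poly_mapping_eqI simp: lookup_sum sum_distrib_left lookup_single when_def)
qed

lemma linearize_act: "act (linearize P) n \<sigma> f = lbind f (\<lambda>p. pure (act P n \<sigma> p))"
  by (simp add: linearize_def lbind_def)

lemma linearize_simps [simp]:
  "ops (linearize P) n = {f. Poly_Mapping.keys f \<subseteq> ops P n}"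
  "unit (linearize P) = pure (unit P)"
  "zero (linearize P) n = 0"
  "add (linearize P) n f g = f + g"
  "smult (linearize P) n c f = scale c f"
  by (simp_all add: linearize_def)

text \<open>Every position carries its own linear map \<open>F\<close>; this is what allows the
  arguments of one composition to be painted with different numbers of black vertices.\<close>

lemma list_tensor_lbind:
  "length Fs = length gs \<Longrightarrow>
   list_tensor (map2 (\<lambda>F (m, g). (m, lbind g F)) Fs gs) =
   lbind (list_tensor gs) (\<lambda>xs. list_tensor (map2 (\<lambda>F (m, a). (m, F a)) Fs xs))"
proof (induction Fs gs rule: list_induct2)
  case (Cons F Fs mg gs)
  obtain m g where mg: "mg = (m, g)"
    by fastforce
  show ?case
    by (simp add: mg Cons.IH lbind_assoc) (subst lbind_commute, rule refl)
qed simp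

lemma list_tensor_pure: "list_tensor (map (\<lambda>(m, a). (m, pure a)) xs) = pure xs"
  by (induction xs) auto

lemma list_tensor_add:
  "list_tensor (zs @ (m, f + g) # gs) = list_tensor (zs @ (m, f) # gs) + list_tensor (zs @ (m, g) # gs)"
  by (induction zs) (auto simp: lbind_add_left lbind_add_right)

lemma linearize_comp_add_inner:
  "comp (linearize P) x (zs @ (m, f + g) # gs) =
     comp (linearize P) x (zs @ (m, f) # gs) + comp (linearize P) x (zs @ (m, g) # gs)"
  by (simp add: linearize_comp list_tensor_add lbind_add_left lbind_add_right)

section \<open>Ideals and quotients\<close>

text \<open>The closure properties behind ideals and quotients of a linearized tree operad. The
  action is closed in arity 0 as well, because operadic ideals are families over all natural
  numbers.\<close>

locale closed_operad =
  fixes T :: "'t operad"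
  assumes unit_closed: "unit T \<in> ops T 1"
    and comp_closed: "\<lbrakk>operad_args T xs; p \<in> ops T (length xs)\<rbrakk> \<Longrightarrow> comp T p xs \<in> ops T (arity_sum xs)"
    and act_closed: "\<lbrakk>\<sigma> permutes {..<n}; p \<in> ops T n\<rbrakk> \<Longrightarrow> act T n \<sigma> p \<in> ops T n"

lemma operad_args_tensor:
  assumes "operad_args (linearize T) gs" "xs \<in> Poly_Mapping.keys (list_tensor gs)"
  shows "operad_args T xs" "length xs = length gs" "map fst xs = map fst gs" "arity_sum xs = arity_sum gs"
proof -
  note all = keys_list_tensor[OF assms(2)]
  show len: "length xs = length gs"
    using all by (rule list_all2_lengthD)
  show "map fst xs = map fst gs"
    using all by (induction rule: list_all2_induct) auto
  then show "arity_sum xs = arity_sum gs"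
    by (simp add: arity_sum_def)
  have "\<forall>(m, q)\<in>set xs. 1 \<le> m \<and> q \<in> ops T m"
    if "\<forall>(m, g)\<in>set gs. 1 \<le> m \<and> Poly_Mapping.keys g \<subseteq> ops T m"
    using all that by (induction rule: list_all2_induct) auto
  then show "operad_args T xs"
    using assms(1) len by (auto simp: operad_args_def)
qed

lemma operadic_idealD:
  assumes "operadic_ideal A I"
  shows "x \<in> I n \<Longrightarrow> x \<in> ops A n" "zero A n \<in> I n"
    "\<lbrakk>x \<in> I n; y \<in> I n\<rbrakk> \<Longrightarrow> add A n x y \<in> I n"
    "x \<in> I n \<Longrightarrow> smult A n c x \<in> I n"
    "\<lbrakk>\<sigma> permutes {..<n}; x \<in> I n\<rbrakk> \<Longrightarrow> act A n \<sigma> x \<in> I n"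
  using assms unfolding operadic_ideal_def by blast+

lemma operadic_ideal_compD:
  "\<lbrakk>operadic_ideal A I; operad_args A xs; x \<in> ops A (length xs);
    x \<in> I (length xs) \<or> (\<exists>(m, y)\<in>set xs. y \<in> I m)\<rbrakk> \<Longrightarrow> comp A x xs \<in> I (arity_sum xs)"
  unfolding operadic_ideal_def by blast

lemma operadic_idealI:
  assumes "\<And>n x. x \<in> I n \<Longrightarrow> x \<in> ops A n" "\<And>n. zero A n \<in> I n"
    "\<And>n x y. \<lbrakk>x \<in> I n; y \<in> I n\<rbrakk> \<Longrightarrow> add A n x y \<in> I n"
    "\<And>n c x. x \<in> I n \<Longrightarrow> smult A n c x \<in> I n"
    "\<And>n \<sigma> x. \<lbrakk>\<sigma> permutes {..<n}; x \<in> I n\<rbrakk> \<Longrightarrow> act A n \<sigma> x \<in> I n"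
    "\<And>x xs. \<lbrakk>operad_args A xs; x \<in> ops A (length xs);
       x \<in> I (length xs) \<or> (\<exists>(m, y)\<in>set xs. y \<in> I m)\<rbrakk> \<Longrightarrow> comp A x xs \<in> I (arity_sum xs)"
  shows "operadic_ideal A I"
  unfolding operadic_ideal_def using assms by (intro conjI allI impI ballI subsetI) simp_all

lemma operadic_ideal_linearizeD:
  assumes "operadic_ideal (linearize T) N"
  shows "f \<in> N n \<Longrightarrow> Poly_Mapping.keys f \<subseteq> ops T n" "0 \<in> N n"
    "\<lbrakk>f \<in> N n; g \<in> N n\<rbrakk> \<Longrightarrow> f + g \<in> N n"
    "f \<in> N n \<Longrightarrow> scale c f \<in> N n"
    "\<lbrakk>\<sigma> permutes {..<n}; f \<in> N n\<rbrakk> \<Longrightarrow> act (linearize T) n \<sigma> f \<in> N n"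
  using operadic_idealD[OF assms] by simp_all

lemma operadic_ideal_linearize_uminus:
  "\<lbrakk>operadic_ideal (linearize T) N; f \<in> N n\<rbrakk> \<Longrightarrow> - f \<in> N n"
  using operadic_ideal_linearizeD(4)[of T N f n "- 1"] by (simp add: scale_minus_1)

lemma operadic_ideal_linearize_diff:
  "\<lbrakk>operadic_ideal (linearize T) N; f \<in> N n; g \<in> N n\<rbrakk> \<Longrightarrow> f - g \<in> N n"
  by (metis operadic_ideal_linearizeD(3) operadic_ideal_linearize_uminus add_uminus_conv_diff)

lemma operadic_ideal_lbind:
  assumes "operadic_ideal (linearize T) N" "\<And>a. a \<in> Poly_Mapping.keys f \<Longrightarrow> F a \<in> N n"
  shows "lbind f F \<in> N n"
  by (rule lbind_in_subspace) (auto intro: operadic_ideal_linearizeD[OF assms(1)] assms(2))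

lemma arity_sum_append [simp]: "arity_sum (xs @ ys) = arity_sum xs + arity_sum ys"
  and arity_sum_Cons [simp]: "arity_sum ((m, x) # xs) = m + arity_sum xs"
  and arity_sum_Nil [simp]: "arity_sum [] = 0"
  by (simp_all add: arity_sum_def)

lemma arity_sum_map [simp]: "arity_sum (map (\<lambda>(m, y). (m, f m y)) xs) = arity_sum xs"
  by (simp add: arity_sum_def o_def split_def)

lemma linearize_comp_diff_inner:
  "comp (linearize P) x (zs @ (m, f - g) # gs) =
     comp (linearize P) x (zs @ (m, f) # gs) - comp (linearize P) x (zs @ (m, g) # gs)"
  using linearize_comp_add_inner[of P x zs m "f - g" g gs] by simp

lemma linearize_comp_diff_outer:
  "comp (linearize P) (f - g) xs = comp (linearize P) f xs - comp (linearize P) g xs"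
  by (simp add: linearize_comp lbind_diff_left)

lemma linearize_act_diff:
  "act (linearize P) n \<sigma> (f - g) = act (linearize P) n \<sigma> f - act (linearize P) n \<sigma> g"
  by (simp add: linearize_act lbind_diff_left)

lemma keys_diff_subset:
  "\<lbrakk>Poly_Mapping.keys f \<subseteq> S; Poly_Mapping.keys g \<subseteq> S\<rbrakk> \<Longrightarrow> Poly_Mapping.keys (f - g) \<subseteq> S"
  using keys_diff[of f g] by blast

lemma keys_scale_subset: "Poly_Mapping.keys f \<subseteq> S \<Longrightarrow> Poly_Mapping.keys (scale c f) \<subseteq> S"
  using keys_scale[of c f] by blast

lemma keys_add_subset:
  "\<lbrakk>Poly_Mapping.keys f \<subseteq> S; Poly_Mapping.keys g \<subseteq> S\<rbrakk> \<Longrightarrow> Poly_Mapping.keys (f + g) \<subseteq> S"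
  using keys_add[of f g] by blast

context closed_operad
begin

lemma linearize_comp_closed:
  assumes "operad_args (linearize T) gs" "Poly_Mapping.keys f \<subseteq> ops T (length gs)"
  shows "Poly_Mapping.keys (comp (linearize T) f gs) \<subseteq> ops T (arity_sum gs)"
proof
  fix p assume "p \<in> Poly_Mapping.keys (comp (linearize T) f gs)"
  then obtain q xs where "q \<in> Poly_Mapping.keys f" "xs \<in> Poly_Mapping.keys (list_tensor gs)"
      "p \<in> {comp T q xs}"
    unfolding linearize_comp by (fastforce dest!: subsetD[OF keys_lbind])
  then show "p \<in> ops T (arity_sum gs)"
    using operad_args_tensor[OF assms(1)] comp_closed[of xs q] assms(2) by fastforce
qed

lemma linearize_act_closed:
  assumes "\<sigma> permutes {..<n}" "Poly_Mapping.keys f \<subseteq> ops T n"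
  shows "Poly_Mapping.keys (act (linearize T) n \<sigma> f) \<subseteq> ops T n"
  unfolding linearize_act using assms
  by (intro order.trans[OF keys_lbind]) (auto intro: act_closed)

text \<open>The arguments are exchanged one at a time. By linearity in one position, each exchange
  changes the composite by a composite that has an element of the ideal as an argument, and the
  changes telescope. The prefix \<open>zs\<close> holds the arguments already exchanged.\<close>

lemma ideal_comp_cong_inner:
  assumes N: "operadic_ideal (linearize T) N"
    and "list_all2 (\<lambda>(m, y) (m', y'). m = m' \<and> y - y' \<in> N m) xs xs'"
    and "operad_args (linearize T) (zs @ xs)" "operad_args (linearize T) (zs @ xs')"
    and "Poly_Mapping.keys x \<subseteq> ops T (length (zs @ xs))"
  shows "comp (linearize T) x (zs @ xs) - comp (linearize T) x (zs @ xs') \<in> N (arity_sum (zs @ xs))"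
  using assms(2-)
proof (induction xs xs' arbitrary: zs rule: list_all2_induct)
  case Nil
  then show ?case
    by (simp add: operadic_ideal_linearizeD[OF N])
next
  case (Cons my xs my' xs')
  obtain m y y' where my: "my = (m, y)" "my' = (m, y')" and N': "y - y' \<in> N m"
    using Cons.hyps(1) by (cases my; cases my') auto
  have len: "length xs = length xs'"
    using Cons.hyps(2) by (rule list_all2_lengthD)
  have "comp (linearize T) x (zs @ (m, y - y') # xs) \<in> N (arity_sum (zs @ (m, y - y') # xs))"
  proof (rule operadic_ideal_compD[OF N])
    show "operad_args (linearize T) (zs @ (m, y - y') # xs)"
      using Cons.prems operadic_ideal_linearizeD(1)[OF N N'] by (auto simp: operad_args_def my)
  qed (use Cons.prems N' in auto)
  moreover have "comp (linearize T) x ((zs @ [(m, y')]) @ xs) - comp (linearize T) x ((zs @ [(m, y')]) @ xs')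
     \<in> N (arity_sum ((zs @ [(m, y')]) @ xs))"
    by (rule Cons.IH) (use Cons.prems len in \<open>auto simp: my operad_args_def\<close>)
  ultimately show ?case
    using operadic_ideal_linearizeD(3)[OF N] by (fastforce simp: my linearize_comp_diff_inner)
qed

text \<open>This is the well-definedness of composition on cosets: the operation is changed while
  \<open>xs\<close> is kept, and then the arguments are changed under the new operation.\<close>

lemma ideal_comp_cong:
  assumes N: "operadic_ideal (linearize T) N"
    and xs: "list_all2 (\<lambda>(m, y) (m', y'). m = m' \<and> y - y' \<in> N m) xs xs'"
      "operad_args (linearize T) xs" "operad_args (linearize T) xs'"
    and x: "Poly_Mapping.keys x \<subseteq> ops T (length xs)" "Poly_Mapping.keys x' \<subseteq> ops T (length xs)"
      "x - x' \<in> N (length xs)"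
  shows "comp (linearize T) x xs - comp (linearize T) x' xs' \<in> N (arity_sum xs)"
proof -
  have "comp (linearize T) (x - x') xs \<in> N (arity_sum xs)"
    by (rule operadic_ideal_compD[OF N]) (use x xs in \<open>auto simp: keys_diff_subset\<close>)
  moreover have "comp (linearize T) x' xs - comp (linearize T) x' xs' \<in> N (arity_sum xs)"
    using ideal_comp_cong_inner[OF N, of xs xs' "[]" x'] x xs by simp
  ultimately show ?thesis
    using operadic_ideal_linearizeD(3)[OF N] by (fastforce simp: linearize_comp_diff_outer)
qed

end

section \<open>Images of a linearized operad, their ideals and quotients\<close>

locale lin_epi = closed_operad T for T :: "'t operad" +
  fixes \<pi> :: "nat \<Rightarrow> ('t \<Rightarrow>\<^sub>0 'k::field) \<Rightarrow> 'b" and B :: "('k, 'b) lin_operad"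
  assumes epi_ops: "ops B n = \<pi> n ` {f. Poly_Mapping.keys f \<subseteq> ops T n}"
    and epi_zero: "zero B n = \<pi> n 0"
    and epi_add: "\<lbrakk>Poly_Mapping.keys f \<subseteq> ops T n; Poly_Mapping.keys g \<subseteq> ops T n\<rbrakk>
          \<Longrightarrow> add B n (\<pi> n f) (\<pi> n g) = \<pi> n (f + g)"
    and epi_smult: "Poly_Mapping.keys f \<subseteq> ops T n \<Longrightarrow> smult B n c (\<pi> n f) = \<pi> n (scale c f)"
    and epi_unit: "unit B = \<pi> 1 (pure (unit T))"
    and epi_act: "\<lbrakk>\<sigma> permutes {..<n}; Poly_Mapping.keys f \<subseteq> ops T n\<rbrakk>
          \<Longrightarrow> act B n \<sigma> (\<pi> n f) = \<pi> n (act (linearize T) n \<sigma> f)"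
    and epi_comp: "\<lbrakk>operad_args (linearize T) xs; Poly_Mapping.keys f \<subseteq> ops T (length xs)\<rbrakk>
          \<Longrightarrow> comp B (\<pi> (length xs) f) (map (\<lambda>(m, y). (m, \<pi> m y)) xs) =
              \<pi> (arity_sum xs) (comp (linearize T) f xs)"
begin

definition pullback :: "(nat \<Rightarrow> 'b set) \<Rightarrow> nat \<Rightarrow> ('t \<Rightarrow>\<^sub>0 'k) set" where
  "pullback K n = {f. Poly_Mapping.keys f \<subseteq> ops T n \<and> \<pi> n f \<in> K n}"

lemma operad_args_image:
  "operad_args (linearize T) xs \<Longrightarrow> operad_args B (map (\<lambda>(m, y). (m, \<pi> m y)) xs)"
  by (fastforce simp: operad_args_def epi_ops)

lemma ideal_pullback:
  assumes K: "operadic_ideal B K"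
  shows "operadic_ideal (linearize T) (pullback K)"
proof (rule operadic_idealI)
  fix x xs
  assume xs: "operad_args (linearize T) xs" and x: "x \<in> ops (linearize T) (length xs)"
    and or: "x \<in> pullback K (length xs) \<or> (\<exists>(m, y)\<in>set xs. y \<in> pullback K m)"
  have "comp B (\<pi> (length xs) x) (map (\<lambda>(m, y). (m, \<pi> m y)) xs) \<in>
      K (arity_sum (map (\<lambda>(m, y). (m, \<pi> m y)) xs))"
    by (rule operadic_ideal_compD[OF K operad_args_image[OF xs]])
      (use x or in \<open>fastforce simp: epi_ops pullback_def\<close>)+
  then show "comp (linearize T) x xs \<in> pullback K (arity_sum xs)"
    using x epi_comp[OF xs] linearize_comp_closed[OF xs] by (simp add: pullback_def)
next
  fix n x y assume "x \<in> pullback K n" "y \<in> pullback K n"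
  then show "add (linearize T) n x y \<in> pullback K n"
    using operadic_idealD(3)[OF K, of "\<pi> n x" n "\<pi> n y"] by (simp add: pullback_def epi_add keys_add_subset)
next
  fix n c x assume "x \<in> pullback K n"
  then show "smult (linearize T) n c x \<in> pullback K n"
    using operadic_idealD(4)[OF K, of "\<pi> n x" n c] by (simp add: pullback_def epi_smult keys_scale_subset)
next
  fix n \<sigma> x assume "\<sigma> permutes {..<n}" "x \<in> pullback K n"
  then show "act (linearize T) n \<sigma> x \<in> pullback K n"
    using operadic_idealD(5)[OF K, of \<sigma> n "\<pi> n x"] linearize_act_closed[of \<sigma> n x]
    by (simp add: pullback_def epi_act)
next
  fix n
  show "zero (linearize T) n \<in> pullback K n"
    using operadic_idealD(2)[OF K, of n] by (simp add: pullback_def epi_zero)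
qed (simp add: pullback_def)

lemma epi_eq_iff:
  assumes "Poly_Mapping.keys f \<subseteq> ops T n" "Poly_Mapping.keys g \<subseteq> ops T n"
  shows "\<pi> n f = \<pi> n g \<longleftrightarrow> \<pi> n (f - g) = \<pi> n 0"
proof
  have g': "Poly_Mapping.keys (- g) \<subseteq> ops T n"
    using assms(2) by simp
  show "\<pi> n (f - g) = \<pi> n 0" if "\<pi> n f = \<pi> n g"
    using epi_add[OF assms(1) g'] epi_add[OF assms(2) g'] that by simp
  show "\<pi> n f = \<pi> n g" if "\<pi> n (f - g) = \<pi> n 0"
    using epi_add[OF keys_diff_subset[OF assms] assms(2)] epi_add[OF _ assms(2), of 0] that by simp
qed

text \<open>A composition in \<open>B\<close> lifts through the surjection to a composition of
  combinations over \<open>T\<close>; the lift lies in \<open>I\<close>, and its image is the given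
  composite.\<close>

lemma ideal_image:
  assumes I: "operadic_ideal (linearize T) I"
  shows "operadic_ideal B (\<lambda>n. \<pi> n ` I n)"
proof (rule operadic_idealI)
  fix x xs
  assume xs: "operad_args B xs" and x: "x \<in> ops B (length xs)"
    and or: "x \<in> \<pi> (length xs) ` I (length xs) \<or> (\<exists>(m, y)\<in>set xs. y \<in> \<pi> m ` I m)"
  \<comment> \<open>The chosen representative lies in \<open>I\<close> whenever some representative
    does. An argument in the image of the ideal must lift to an element of the ideal, which an
    arbitrary preimage need not be.\<close>
  define r where "r m y = (SOME g. Poly_Mapping.keys g \<subseteq> ops T m \<and> \<pi> m g = y \<and> (y \<in> \<pi> m ` I m \<longrightarrow> g \<in> I m))"
    for m y
  have r: "Poly_Mapping.keys (r m y) \<subseteq> ops T m \<and> \<pi> m (r m y) = y \<and> (y \<in> \<pi> m ` I m \<longrightarrow> r m y \<in> I m)"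
    if "y \<in> ops B m" for m y
    unfolding r_def
  proof (rule someI_ex, cases "y \<in> \<pi> m ` I m")
    case True
    then show "\<exists>g. Poly_Mapping.keys g \<subseteq> ops T m \<and> \<pi> m g = y \<and> (y \<in> \<pi> m ` I m \<longrightarrow> g \<in> I m)"
      using operadic_ideal_linearizeD(1)[OF I] by blast
  qed (use that in \<open>auto simp: epi_ops\<close>)
  let ?ys = "map (\<lambda>(m, y). (m, r m y)) xs"
  have ys: "operad_args (linearize T) ?ys"
    using xs r by (fastforce simp: operad_args_def)
  have eq: "map (\<lambda>(m, y). (m, \<pi> m y)) ?ys = xs"
    unfolding map_map by (rule map_idI) (use xs r in \<open>auto simp: operad_args_def\<close>)
  have "comp (linearize T) (r (length xs) x) ?ys \<in> I (arity_sum ?ys)"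
  proof (rule operadic_ideal_compD[OF I ys])
    show "r (length xs) x \<in> ops (linearize T) (length ?ys)"
      using r[OF x] by simp
    show "r (length xs) x \<in> I (length ?ys) \<or> (\<exists>(m, y)\<in>set ?ys. y \<in> I m)"
      using or
    proof
      assume "\<exists>(m, y)\<in>set xs. y \<in> \<pi> m ` I m"
      then obtain m y where my: "(m, y) \<in> set xs" "y \<in> \<pi> m ` I m" by auto
      then have "r m y \<in> I m"
        using r xs by (auto simp: operad_args_def)
      moreover have "(m, r m y) \<in> set ?ys"
        using my(1) by (force simp: image_iff)
      ultimately show ?thesis
        by blast
    qed (use r[OF x] in simp)
  qed
  then show "comp B x xs \<in> \<pi> (arity_sum xs) ` I (arity_sum xs)"
    using epi_comp[OF ys, of "r (length xs) x"] r[OF x] eq by auto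
next
  fix n x y assume "x \<in> \<pi> n ` I n" "y \<in> \<pi> n ` I n"
  then show "add B n x y \<in> \<pi> n ` I n"
    using operadic_ideal_linearizeD[OF I] by (auto simp: epi_add)
next
  fix n c x assume "x \<in> \<pi> n ` I n"
  then show "smult B n c x \<in> \<pi> n ` I n"
    using operadic_ideal_linearizeD[OF I] by (auto simp: epi_smult)
next
  fix n \<sigma> x assume "\<sigma> permutes {..<n}" "x \<in> \<pi> n ` I n"
  then show "act B n \<sigma> x \<in> \<pi> n ` I n"
    using operadic_ideal_linearizeD[OF I] by (auto simp: epi_act)
next
  fix n
  show "zero B n \<in> \<pi> n ` I n"
    using operadic_ideal_linearizeD[OF I] by (auto simp: epi_zero)
  show "x \<in> ops B n" if "x \<in> \<pi> n ` I n" for x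
    using that operadic_ideal_linearizeD[OF I] by (auto simp: epi_ops)
qed

text \<open>The whole operad is one of the ideals intersected in \<open>ideal_generated\<close>;
  this bounds the generated ideal by the operations of \<open>B\<close>.\<close>

lemma operadic_ideal_ops: "operadic_ideal B (ops B)"
proof -
  have "operadic_ideal (linearize T) (ops (linearize T) :: nat \<Rightarrow> ('t \<Rightarrow>\<^sub>0 'k) set)"
    by (rule operadic_idealI)
      (simp_all add: linearize_comp_closed linearize_act_closed keys_add_subset keys_scale_subset)
  from ideal_image[OF this] show ?thesis
    by (simp add: epi_ops[abs_def])
qed

lemma
  assumes "\<And>n. G n \<subseteq> ops B n"
  shows ideal_generated_ideal: "operadic_ideal B (ideal_generated B G)"
    and ideal_generated_superset: "G n \<subseteq> ideal_generated B G n"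
proof -
  show "G n \<subseteq> ideal_generated B G n"
    by (auto simp: ideal_generated_def)
  have mem: "x \<in> ideal_generated B G n \<longleftrightarrow>
      (\<forall>I. operadic_ideal B I \<and> (\<forall>m. G m \<subseteq> I m) \<longrightarrow> x \<in> I n)" for x n
    by (auto simp: ideal_generated_def)
  have sub: "x \<in> ops B n" if "\<forall>I. operadic_ideal B I \<and> (\<forall>m. G m \<subseteq> I m) \<longrightarrow> x \<in> I n" for n x
    using that operadic_ideal_ops assms by blast
  show "operadic_ideal B (ideal_generated B G)"
  proof (rule operadic_idealI)
    fix x xs
    assume xs: "operad_args B xs" and x: "x \<in> ops B (length xs)"
      and or: "x \<in> ideal_generated B G (length xs) \<or> (\<exists>(m, y)\<in>set xs. y \<in> ideal_generated B G m)"
    show "comp B x xs \<in> ideal_generated B G (arity_sum xs)"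
      unfolding mem
    proof (intro allI impI)
      fix I assume I: "operadic_ideal B I \<and> (\<forall>m. G m \<subseteq> I m)"
      show "comp B x xs \<in> I (arity_sum xs)"
        by (rule operadic_ideal_compD[OF conjunct1[OF I] xs x]) (use or I in \<open>fastforce simp: mem\<close>)
    qed
  qed (use sub in \<open>auto simp: mem intro: operadic_idealD(2-)\<close>)
qed

text \<open>The image of \<open>I\<close> is an ideal containing the generators, hence it contains
  the ideal they generate. Since \<open>I\<close> contains the kernel of \<pi>, having an image in
  the image of \<open>I\<close> is the same as lying in \<open>I\<close>.\<close>

lemma pullback_generated_least:
  assumes I: "operadic_ideal (linearize T) I"
    and "\<And>n. G n \<subseteq> \<pi> n ` I n"
    and ker: "\<And>n f. \<lbrakk>Poly_Mapping.keys f \<subseteq> ops T n; \<pi> n f = \<pi> n 0\<rbrakk> \<Longrightarrow> f \<in> I n"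
  shows "pullback (ideal_generated B G) n \<subseteq> I n"
proof
  fix f assume "f \<in> pullback (ideal_generated B G) n"
  then have f: "Poly_Mapping.keys f \<subseteq> ops T n" and "\<pi> n f \<in> ideal_generated B G n"
    by (auto simp: pullback_def)
  moreover have "ideal_generated B G n \<subseteq> \<pi> n ` I n"
    unfolding ideal_generated_def using ideal_image[OF I] assms(2) by (intro Inter_lower CollectI exI[of _ "\<lambda>n. \<pi> n ` I n"]) simp
  ultimately have "\<pi> n f \<in> \<pi> n ` I n"
    by blast
  then obtain g where g: "g \<in> I n" "\<pi> n f = \<pi> n g"
    by auto
  have g': "Poly_Mapping.keys g \<subseteq> ops T n"
    by (rule operadic_ideal_linearizeD(1)[OF I g(1)])
  have "f - g \<in> I n"
    using keys_diff_subset[OF f g'] epi_eq_iff[OF f g'] g(2) by (intro ker) simp_all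
  then show "f \<in> I n"
    using operadic_ideal_linearizeD(3)[OF I _ g(1), of "f - g"] by simp
qed

context
  fixes K assumes K: "operadic_ideal B K"
begin

text \<open>A coset in \<open>B\<close> is the image of a whole residue class modulo the pulled back
  ideal, so computations with cosets can be carried out on combinations over
  \<open>T\<close>.\<close>

lemma coset_eq:
  assumes "Poly_Mapping.keys f \<subseteq> ops T n"
  shows "coset B K n (\<pi> n f) = \<pi> n ` {g. Poly_Mapping.keys g \<subseteq> ops T n \<and> g - f \<in> pullback K n}"
proof (intro set_eqI iffI)
  fix y assume "y \<in> coset B K n (\<pi> n f)"
  then obtain k where k: "k \<in> K n" "y = add B n (\<pi> n f) k"
    by (auto simp: coset_def)
  moreover have "k \<in> ops B n"
    using K k(1) by (auto simp: operadic_ideal_def)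
  ultimately obtain h where "Poly_Mapping.keys h \<subseteq> ops T n" "k = \<pi> n h"
    by (auto simp: epi_ops)
  then show "y \<in> \<pi> n ` {g. Poly_Mapping.keys g \<subseteq> ops T n \<and> g - f \<in> pullback K n}"
    using k assms by (intro image_eqI[of _ _ "f + h"]) (auto simp: epi_add pullback_def keys_add_subset)
next
  fix y assume "y \<in> \<pi> n ` {g. Poly_Mapping.keys g \<subseteq> ops T n \<and> g - f \<in> pullback K n}"
  then obtain g where g: "y = \<pi> n g" "Poly_Mapping.keys g \<subseteq> ops T n" "g - f \<in> pullback K n"
    by auto
  then have "y = add B n (\<pi> n f) (\<pi> n (g - f))"
    by (subst epi_add) (use assms in \<open>auto simp: pullback_def\<close>)
  then show "y \<in> coset B K n (\<pi> n f)"
    using g by (auto simp: coset_def pullback_def)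
qed

lemma coset_eq_iff:
  assumes "Poly_Mapping.keys f \<subseteq> ops T n" "Poly_Mapping.keys g \<subseteq> ops T n"
  shows "coset B K n (\<pi> n f) = coset B K n (\<pi> n g) \<longleftrightarrow> f - g \<in> pullback K n"
proof
  note N = ideal_pullback[OF K]
  assume "coset B K n (\<pi> n f) = coset B K n (\<pi> n g)"
  moreover have "\<pi> n f \<in> coset B K n (\<pi> n f)"
    using assms operadic_ideal_linearizeD(2)[OF N] by (auto simp: coset_eq intro!: imageI)
  ultimately obtain h where h: "\<pi> n f = \<pi> n h" "Poly_Mapping.keys h \<subseteq> ops T n" "h - g \<in> pullback K n"
    using assms by (auto simp: coset_eq)
  \<comment> \<open>The representative \<open>h\<close> found in the coset can differ from
    \<open>f\<close> by an element of the kernel of \<pi>. Such an element lies in the pulled back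
    ideal because \<open>K\<close> contains zero.\<close>
  have "\<pi> n (f - h) = zero B n"
    using epi_eq_iff[OF assms(1) h(2)] h(1) by (simp add: epi_zero)
  then have "f - h \<in> pullback K n"
    using K assms h by (auto simp: pullback_def operadic_ideal_def keys_diff_subset)
  then show "f - g \<in> pullback K n"
    using operadic_ideal_linearizeD(3)[OF N _ h(3)] by fastforce
next
  note N = ideal_pullback[OF K]
  assume d: "f - g \<in> pullback K n"
  have "h - f \<in> pullback K n \<longleftrightarrow> h - g \<in> pullback K n" for h
    using operadic_ideal_linearizeD(3)[OF N _ d, of "h - f"] operadic_ideal_linearize_diff[OF N _ d, of "h - g"]
    by auto
  then show "coset B K n (\<pi> n f) = coset B K n (\<pi> n g)"
    using assms by (simp add: coset_eq)
qed

lemma Union_cosets: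
  assumes "X \<noteq> {}" "\<And>x. x \<in> X \<Longrightarrow> F x = c"
  shows "(\<Union>x\<in>X. F x) = c"
  using assms by auto

lemma coset_nonempty: "Poly_Mapping.keys f \<subseteq> ops T n \<Longrightarrow> coset B K n (\<pi> n f) \<noteq> {}"
  using operadic_ideal_linearizeD(2)[OF ideal_pullback[OF K]] by (auto simp: coset_eq intro!: exI[of _ f])

lemma in_cosetE:
  assumes "Poly_Mapping.keys f \<subseteq> ops T n" "x \<in> coset B K n (\<pi> n f)"
  obtains g where "x = \<pi> n g" "Poly_Mapping.keys g \<subseteq> ops T n" "g - f \<in> pullback K n"
  using assms by (auto simp: coset_eq)

lemma cosets_representatives:
  assumes "list_all2 (\<lambda>(m, y) (m', Y). m = m' \<and> y \<in> Y) ys (map (\<lambda>(m, y). (m, coset B K m (\<pi> m y))) xs)"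
    and "\<forall>(m, q)\<in>set xs. 1 \<le> m \<and> Poly_Mapping.keys q \<subseteq> ops T m"
  shows "\<exists>zs. ys = map (\<lambda>(m, y). (m, \<pi> m y)) zs \<and> (\<forall>(m, q)\<in>set zs. 1 \<le> m \<and> Poly_Mapping.keys q \<subseteq> ops T m) \<and>
    list_all2 (\<lambda>(m, y) (m', y'). m = m' \<and> y - y' \<in> pullback K m) zs xs"
  using assms
proof (induction xs arbitrary: ys)
  case (Cons mx xs)
  obtain m x where mx: "mx = (m, x)" by fastforce
  obtain y ys' where ys: "ys = (m, y) # ys'" "y \<in> coset B K m (\<pi> m x)"
    "list_all2 (\<lambda>(m, y) (m', Y). m = m' \<and> y \<in> Y) ys' (map (\<lambda>(m, y). (m, coset B K m (\<pi> m y))) xs)"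
    using Cons.prems(1) by (auto simp: mx list_all2_Cons2)
  obtain zs where "ys' = map (\<lambda>(m, y). (m, \<pi> m y)) zs" "\<forall>(m, q)\<in>set zs. 1 \<le> m \<and> Poly_Mapping.keys q \<subseteq> ops T m"
    "list_all2 (\<lambda>(m, y) (m', y'). m = m' \<and> y - y' \<in> pullback K m) zs xs"
    using Cons.IH[OF ys(3)] Cons.prems(2) by auto
  moreover obtain g where "y = \<pi> m g" "Poly_Mapping.keys g \<subseteq> ops T m" "g - x \<in> pullback K m"
    using in_cosetE[OF _ ys(2)] Cons.prems(2) by (auto simp: mx)
  ultimately show ?case
    using Cons.prems(2) by (intro exI[of _ "(m, g) # zs"]) (auto simp: mx ys)
qed simp

text \<open>A quotient of an image of the linearized trees is again such an image, so the quotient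
  of a quotient is reached by using this twice. The operations on cosets are unions over
  representatives; each is a nonempty union of one and the same coset, by compatibility with the
  pulled back ideal.\<close>

lemma quotient_epi: "lin_epi T (\<lambda>n f. coset B K n (\<pi> n f)) (quotient_operad B K)"
proof
  note N = ideal_pullback[OF K]
  fix n and f g :: "'t \<Rightarrow>\<^sub>0 'k"
  show "ops (quotient_operad B K) n = (\<lambda>f. coset B K n (\<pi> n f)) ` {f. Poly_Mapping.keys f \<subseteq> ops T n}"
    by (simp add: quotient_operad_def epi_ops image_image)
  show "zero (quotient_operad B K) n = coset B K n (\<pi> n 0)"
    by (simp add: quotient_operad_def epi_zero)
  show "unit (quotient_operad B K) = coset B K 1 (\<pi> 1 (pure (unit T)))"
    by (simp add: quotient_operad_def epi_unit)
  show "smult (quotient_operad B K) n c (coset B K n (\<pi> n f)) = coset B K n (\<pi> n (scale c f))"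
    if f: "Poly_Mapping.keys f \<subseteq> ops T n" for c
    unfolding quotient_operad_def lin_operad.simps
  proof (rule Union_cosets[OF coset_nonempty[OF f]])
    fix x assume "x \<in> coset B K n (\<pi> n f)"
    from in_cosetE[OF f this] obtain f' where f': "x = \<pi> n f'" "Poly_Mapping.keys f' \<subseteq> ops T n"
        "f' - f \<in> pullback K n" .
    have "scale c f' - scale c f = scale c (f' - f)"
      by (rule poly_mapping_eqI) (simp add: lookup_minus algebra_simps)
    then show "coset B K n (smult B n c x) = coset B K n (\<pi> n (scale c f))"
      using f f' operadic_ideal_linearizeD(4)[OF N f'(3), of c] keys_scale[of c f] keys_scale[of c f']
      by (subst f'(1), subst epi_smult) (auto simp: coset_eq_iff)
  qed
  show "act (quotient_operad B K) n \<sigma> (coset B K n (\<pi> n f)) = coset B K n (\<pi> n (act (linearize T) n \<sigma> f))"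
    if \<sigma>: "\<sigma> permutes {..<n}" and f: "Poly_Mapping.keys f \<subseteq> ops T n" for \<sigma>
    unfolding quotient_operad_def operad.simps
  proof (rule Union_cosets[OF coset_nonempty[OF f]])
    fix x assume "x \<in> coset B K n (\<pi> n f)"
    from in_cosetE[OF f this] obtain f' where f': "x = \<pi> n f'" "Poly_Mapping.keys f' \<subseteq> ops T n"
        "f' - f \<in> pullback K n" .
    show "coset B K n (act B n \<sigma> x) = coset B K n (\<pi> n (act (linearize T) n \<sigma> f))"
      using operadic_ideal_linearizeD(5)[OF N \<sigma> f'(3)] linearize_act_closed[OF \<sigma> f] linearize_act_closed[OF \<sigma> f'(2)]
      by (simp add: f'(1) epi_act[OF \<sigma> f'(2)] coset_eq_iff linearize_act_diff)
  qed
  show "add (quotient_operad B K) n (coset B K n (\<pi> n f)) (coset B K n (\<pi> n g)) = coset B K n (\<pi> n (f + g))"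
    if f: "Poly_Mapping.keys f \<subseteq> ops T n" and g: "Poly_Mapping.keys g \<subseteq> ops T n"
    unfolding quotient_operad_def lin_operad.simps
  proof (rule Union_cosets[OF coset_nonempty[OF f]], rule Union_cosets[OF coset_nonempty[OF g]])
    fix x y assume "x \<in> coset B K n (\<pi> n f)" "y \<in> coset B K n (\<pi> n g)"
    with in_cosetE[OF f] in_cosetE[OF g] obtain f' g' where
      f': "x = \<pi> n f'" "Poly_Mapping.keys f' \<subseteq> ops T n" "f' - f \<in> pullback K n" and
      g': "y = \<pi> n g'" "Poly_Mapping.keys g' \<subseteq> ops T n" "g' - g \<in> pullback K n"
      by metis
    have "(f' + g') - (f + g) \<in> pullback K n"
      using operadic_ideal_linearizeD(3)[OF N f'(3) g'(3)] by (simp add: algebra_simps)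
    then show "coset B K n (add B n x y) = coset B K n (\<pi> n (f + g))"
      using f g f' g' by (simp add: epi_add coset_eq_iff keys_add_subset)
  qed
next
  note N = ideal_pullback[OF K]
  fix xs :: "(nat \<times> ('t \<Rightarrow>\<^sub>0 'k)) list" and f :: "'t \<Rightarrow>\<^sub>0 'k"
  assume xs: "operad_args (linearize T) xs" and f: "Poly_Mapping.keys f \<subseteq> ops T (length xs)"
  let ?Xs = "map (\<lambda>(m, y). (m, coset B K m (\<pi> m y))) xs"
  have xs': "\<forall>(m, q)\<in>set xs. 1 \<le> m \<and> Poly_Mapping.keys q \<subseteq> ops T m"
    using xs by (auto simp: operad_args_def)
  show "comp (quotient_operad B K) (coset B K (length xs) (\<pi> (length xs) f)) ?Xs =
      coset B K (arity_sum xs) (\<pi> (arity_sum xs) (comp (linearize T) f xs))"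
    unfolding quotient_operad_def operad.simps
  proof (rule Union_cosets[OF coset_nonempty[OF f]], rule Union_cosets)
    have "y \<in> coset B K m (\<pi> m y')" if "(m, y') \<in> set xs" "y = \<pi> m y'" for m y y'
      using that xs' operadic_ideal_linearizeD(2)[OF N] by (force simp: coset_eq)
    then have "map (\<lambda>(m, y). (m, \<pi> m y)) xs \<in> {ys. list_all2 (\<lambda>(m, y) (m', Y). m = m' \<and> y \<in> Y) ys ?Xs}"
      by (auto simp: list_all2_map1 list_all2_map2 intro!: list_all2_refl[THEN list_all2_mono, of "\<lambda>x y. x = y \<and> x \<in> set xs"] list.rel_refl_strong)
    then show "{ys. list_all2 (\<lambda>(m, y) (m', Y). m = m' \<and> y \<in> Y) ys ?Xs} \<noteq> {}"
      by blast
    fix x ys assume x: "x \<in> coset B K (length xs) (\<pi> (length xs) f)"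
      and "ys \<in> {ys. list_all2 (\<lambda>(m, y) (m', Y). m = m' \<and> y \<in> Y) ys ?Xs}"
    then obtain zs where ys: "ys = map (\<lambda>(m, y). (m, \<pi> m y)) zs" and
      zs: "\<forall>(m, q)\<in>set zs. 1 \<le> m \<and> Poly_Mapping.keys q \<subseteq> ops T m" and
      rel: "list_all2 (\<lambda>(m, y) (m', y'). m = m' \<and> y - y' \<in> pullback K m) zs xs"
      using cosets_representatives[OF _ xs'] by blast
    have len: "length zs = length xs"
      using rel by (rule list_all2_lengthD)
    have sum: "arity_sum zs = arity_sum xs"
      using rel by (induction rule: list_all2_induct) auto
    have zs': "operad_args (linearize T) zs"
      using zs len xs by (auto simp: operad_args_def)
    from in_cosetE[OF f x] obtain f' where f': "x = \<pi> (length xs) f'" "Poly_Mapping.keys f' \<subseteq> ops T (length xs)"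
        "f' - f \<in> pullback K (length xs)" .
    have "comp B x ys = \<pi> (arity_sum xs) (comp (linearize T) f' zs)"
      using epi_comp[OF zs', of f'] f' by (simp add: ys len sum)
    moreover have "comp (linearize T) f' zs - comp (linearize T) f xs \<in> pullback K (arity_sum zs)"
      by (rule ideal_comp_cong[OF N rel zs' xs]) (use f f' len in auto)
    ultimately show "coset B K (arity_sum ys) (comp B x ys) =
        coset B K (arity_sum xs) (\<pi> (arity_sum xs) (comp (linearize T) f xs))"
      using linearize_comp_closed[OF zs', of f'] linearize_comp_closed[OF xs f] f' len
      by (simp add: sum ys coset_eq_iff)
  qed
qed

end

end

section \<open>Isomorphisms expressed by surjections from linearized trees\<close>

locale lin_onto =
  fixes T :: "'t operad" and \<psi> :: "nat \<Rightarrow> ('t \<Rightarrow>\<^sub>0 'k::field) \<Rightarrow> 'b" and L :: "('k, 'b) lin_operad"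
  assumes onto_ops: "1 \<le> n \<Longrightarrow> ops L n = \<psi> n ` {f. Poly_Mapping.keys f \<subseteq> ops T n}"
    and onto_add: "\<lbrakk>1 \<le> n; Poly_Mapping.keys f \<subseteq> ops T n; Poly_Mapping.keys g \<subseteq> ops T n\<rbrakk>
          \<Longrightarrow> \<psi> n (f + g) = add L n (\<psi> n f) (\<psi> n g)"
    and onto_smult: "\<lbrakk>1 \<le> n; Poly_Mapping.keys f \<subseteq> ops T n\<rbrakk> \<Longrightarrow> \<psi> n (scale c f) = smult L n c (\<psi> n f)"
    and onto_unit: "\<psi> 1 (pure (unit T)) = unit L"
    and onto_act: "\<lbrakk>1 \<le> n; \<sigma> permutes {..<n}; Poly_Mapping.keys f \<subseteq> ops T n\<rbrakk>
          \<Longrightarrow> \<psi> n (act (linearize T) n \<sigma> f) = act L n \<sigma> (\<psi> n f)"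
    and onto_comp: "\<lbrakk>operad_args (linearize T) xs; Poly_Mapping.keys f \<subseteq> ops T (length xs)\<rbrakk>
          \<Longrightarrow> \<psi> (arity_sum xs) (comp (linearize T) f xs) =
              comp L (\<psi> (length xs) f) (map (\<lambda>(m, y). (m, \<psi> m y)) xs)"

lemma operad_args_length: "operad_args A xs \<Longrightarrow> 1 \<le> length xs"
  by (cases xs) (auto simp: operad_args_def)

lemma operad_args_arity_sum:
  assumes "operad_args A xs"
  shows "1 \<le> arity_sum xs"
  using assms by (cases xs) (auto simp: operad_args_def)

context lin_epi
begin

lemma operad_args_preimage:
  assumes "operad_args B xs"
  obtains ys where "operad_args (linearize T) ys" "xs = map (\<lambda>(m, y). (m, \<pi> m y)) ys" "length ys = length xs"
proof
  define r where "r m y = (SOME g. Poly_Mapping.keys g \<subseteq> ops T m \<and> \<pi> m g = y)" for m y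
  have r: "Poly_Mapping.keys (r m y) \<subseteq> ops T m \<and> \<pi> m (r m y) = y" if "y \<in> ops B m" for m y
    unfolding r_def by (rule someI_ex) (use that in \<open>auto simp: epi_ops\<close>)
  let ?ys = "map (\<lambda>(m, y). (m, r m y)) xs"
  show "operad_args (linearize T) ?ys"
    using assms r by (fastforce simp: operad_args_def)
  show "xs = map (\<lambda>(m, y). (m, \<pi> m y)) ?ys"
    unfolding map_map by (rule map_idI[symmetric]) (use assms r in \<open>auto simp: operad_args_def\<close>)
qed simp

text \<open>Composing the isomorphism with \<pi> gives a surjective morphism onto \<open>L\<close>
  with the same fibres as \<pi>. Arities start at 1 here, as \<open>lin_operad_iso\<close> says
  nothing about arity 0.\<close>

lemma iso_imp_onto:
  assumes "lin_operad_iso B L"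
  obtains \<psi> where "lin_onto T \<psi> L"
    "\<And>n f g. \<lbrakk>1 \<le> n; Poly_Mapping.keys f \<subseteq> ops T n; Poly_Mapping.keys g \<subseteq> ops T n\<rbrakk>
       \<Longrightarrow> \<psi> n f = \<psi> n g \<longleftrightarrow> \<pi> n f = \<pi> n g"
proof -
  from assms obtain \<phi> where
    iso: "(\<forall>n\<ge>1. bij_betw (\<phi> n) (ops B n) (ops L n)) \<and>
      (\<forall>n\<ge>1. \<forall>x\<in>ops B n. \<forall>y\<in>ops B n. \<phi> n (add B n x y) = add L n (\<phi> n x) (\<phi> n y)) \<and>
      (\<forall>n\<ge>1. \<forall>c. \<forall>x\<in>ops B n. \<phi> n (smult B n c x) = smult L n c (\<phi> n x)) \<and>
      (\<forall>n\<ge>1. \<forall>\<sigma> x. \<sigma> permutes {..<n} \<longrightarrow> x \<in> ops B n \<longrightarrow> \<phi> n (act B n \<sigma> x) = act L n \<sigma> (\<phi> n x)) \<and>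
      \<phi> 1 (unit B) = unit L \<and>
      (\<forall>x xs. operad_args B xs \<longrightarrow> x \<in> ops B (length xs) \<longrightarrow>
        \<phi> (arity_sum xs) (comp B x xs) = comp L (\<phi> (length xs) x) (map (\<lambda>(m, y). (m, \<phi> m y)) xs))"
    unfolding lin_operad_iso_def by (rule exE)
  have bij: "bij_betw (\<phi> n) (ops B n) (ops L n)" if "1 \<le> n" for n
    using iso that by simp
  have add: "\<phi> n (add B n x y) = add L n (\<phi> n x) (\<phi> n y)" if "1 \<le> n" "x \<in> ops B n" "y \<in> ops B n" for n x y
    using iso that by simp
  have smult: "\<phi> n (smult B n c x) = smult L n c (\<phi> n x)" if "1 \<le> n" "x \<in> ops B n" for n c x
    using iso that by simp
  have act: "\<phi> n (act B n \<sigma> x) = act L n \<sigma> (\<phi> n x)" if "1 \<le> n" "\<sigma> permutes {..<n}" "x \<in> ops B n" for n \<sigma> x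
    using iso that by simp
  have unit: "\<phi> 1 (unit B) = unit L"
    using iso by blast
  have comp: "\<phi> (arity_sum xs) (comp B x xs) = comp L (\<phi> (length xs) x) (map (\<lambda>(m, y). (m, \<phi> m y)) xs)"
    if "operad_args B xs" "x \<in> ops B (length xs)" for x xs
    using iso that by blast
  have ops: "\<pi> n f \<in> ops B n" if "Poly_Mapping.keys f \<subseteq> ops T n" for n f
    using that by (auto simp: epi_ops)
  show thesis
  proof
    show "lin_onto T (\<lambda>n f. \<phi> n (\<pi> n f)) L"
    proof
      show "ops L n = (\<lambda>f. \<phi> n (\<pi> n f)) ` {f. Poly_Mapping.keys f \<subseteq> ops T n}" if "1 \<le> n" for n
        using bij_betw_imp_surj_on[OF bij[OF that]] by (simp add: epi_ops image_image)
      show "\<phi> 1 (\<pi> 1 (pure (unit T))) = unit L"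
        using unit by (simp add: epi_unit)
      fix xs :: "(nat \<times> ('t \<Rightarrow>\<^sub>0 'k)) list" and f :: "'t \<Rightarrow>\<^sub>0 'k"
      assume "operad_args (linearize T) xs" "Poly_Mapping.keys f \<subseteq> ops T (length xs)"
      moreover have "map (\<lambda>(m, y). (m, \<phi> m y)) (map (\<lambda>(m, y). (m, \<pi> m y)) xs) =
          map (\<lambda>(m, y). (m, \<phi> m (\<pi> m y))) xs"
        by auto
      ultimately show "\<phi> (arity_sum xs) (\<pi> (arity_sum xs) (comp (linearize T) f xs)) =
          comp L (\<phi> (length xs) (\<pi> (length xs) f)) (map (\<lambda>(m, y). (m, \<phi> m (\<pi> m y))) xs)"
        using comp[of "map (\<lambda>(m, y). (m, \<pi> m y)) xs" "\<pi> (length xs) f"]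
        by (simp add: epi_comp ops operad_args_image del: map_map)
    next
      fix n :: nat and f g :: "'t \<Rightarrow>\<^sub>0 'k"
      assume n: "1 \<le> n" and f: "Poly_Mapping.keys f \<subseteq> ops T n"
      show "\<phi> n (\<pi> n (f + g)) = add L n (\<phi> n (\<pi> n f)) (\<phi> n (\<pi> n g))" if g: "Poly_Mapping.keys g \<subseteq> ops T n"
        using add[OF n ops[OF f] ops[OF g]] by (simp add: epi_add[OF f g])
      show "\<phi> n (\<pi> n (scale c f)) = smult L n c (\<phi> n (\<pi> n f))" for c
        using smult[OF n ops[OF f]] by (simp add: epi_smult[OF f])
      show "\<phi> n (\<pi> n (act (linearize T) n \<sigma> f)) = act L n \<sigma> (\<phi> n (\<pi> n f))" if "\<sigma> permutes {..<n}" for \<sigma>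
        using act[OF n that ops[OF f]] by (simp add: epi_act[OF that f])
    qed
    fix n :: nat and f g :: "'t \<Rightarrow>\<^sub>0 'k"
    assume "1 \<le> n" "Poly_Mapping.keys f \<subseteq> ops T n" "Poly_Mapping.keys g \<subseteq> ops T n"
    then show "\<phi> n (\<pi> n f) = \<phi> n (\<pi> n g) \<longleftrightarrow> \<pi> n f = \<pi> n g"
      using inj_on_eq_iff[OF bij_betw_imp_inj_on[OF bij] ops ops] by blast
  qed
qed

text \<open>The converse: two surjective morphisms from the same linearized operad with equal fibres
  have isomorphic targets.\<close>

lemma onto_imp_iso:
  assumes "lin_onto T \<psi> L"
    and eq: "\<And>n f g. \<lbrakk>1 \<le> n; Poly_Mapping.keys f \<subseteq> ops T n; Poly_Mapping.keys g \<subseteq> ops T n\<rbrakk>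
       \<Longrightarrow> \<psi> n f = \<psi> n g \<longleftrightarrow> \<pi> n f = \<pi> n g"
  shows "lin_operad_iso B L"
proof -
  interpret onto: lin_onto T \<psi> L by fact
  \<comment> \<open>The value is read off from an arbitrary representative; equality of the fibres
    makes it independent of the choice.\<close>
  define \<phi> where "\<phi> n x = \<psi> n (SOME f. Poly_Mapping.keys f \<subseteq> ops T n \<and> \<pi> n f = x)" for n x
  have \<phi>: "\<phi> n (\<pi> n f) = \<psi> n f" if n: "1 \<le> n" and f: "Poly_Mapping.keys f \<subseteq> ops T n" for n f
  proof -
    define h where "h = (SOME g. Poly_Mapping.keys g \<subseteq> ops T n \<and> \<pi> n g = \<pi> n f)"
    have "Poly_Mapping.keys h \<subseteq> ops T n \<and> \<pi> n h = \<pi> n f"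
      unfolding h_def by (rule someI_ex) (use f in auto)
    then show ?thesis
      using eq[OF n _ f, of h] by (simp add: \<phi>_def flip: h_def)
  qed
  show ?thesis
    unfolding lin_operad_iso_def
  proof (intro exI[of _ \<phi>] conjI allI impI ballI)
    fix n :: nat assume n: "1 \<le> n"
    have "inj_on (\<phi> n) (ops B n)"
      unfolding epi_ops
    proof (rule inj_onI, elim imageE CollectE)
      fix x y f g
      assume "\<phi> n x = \<phi> n y" "x = \<pi> n f" "y = \<pi> n g" "Poly_Mapping.keys f \<subseteq> ops T n" "Poly_Mapping.keys g \<subseteq> ops T n"
      then show "x = y"
        using \<phi>[OF n, of f] \<phi>[OF n, of g] eq[OF n, of f g] by simp
    qed
    moreover have "\<phi> n ` ops B n = ops L n"
      unfolding epi_ops onto.onto_ops[OF n] image_image using n by (intro image_cong refl) (simp add: \<phi>)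
    ultimately show "bij_betw (\<phi> n) (ops B n) (ops L n)"
      by (simp add: bij_betw_def)
    fix x assume "x \<in> ops B n"
    then obtain f where f: "x = \<pi> n f" "Poly_Mapping.keys f \<subseteq> ops T n"
      by (auto simp: epi_ops)
    show "\<phi> n (smult B n c x) = smult L n c (\<phi> n x)" for c
      using n f onto.onto_smult[of n f c] by (simp add: epi_smult \<phi> keys_scale_subset)
    show "\<phi> n (act B n \<sigma> x) = act L n \<sigma> (\<phi> n x)" if "\<sigma> permutes {..<n}" for \<sigma>
      using n f onto.onto_act[OF n that f(2)] linearize_act_closed[OF that f(2)] by (simp add: epi_act[OF that] \<phi>)
    fix y assume "y \<in> ops B n"
    then obtain g where g: "y = \<pi> n g" "Poly_Mapping.keys g \<subseteq> ops T n"
      by (auto simp: epi_ops)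
    show "\<phi> n (add B n x y) = add L n (\<phi> n x) (\<phi> n y)"
      using n f g onto.onto_add[of n f g] by (simp add: epi_add \<phi> keys_add_subset)
  next
    show "\<phi> 1 (unit B) = unit L"
      using \<phi>[of 1 "pure (unit T)"] unit_closed onto.onto_unit by (simp add: epi_unit)
  next
    fix x xs assume xs: "operad_args B xs" and "x \<in> ops B (length xs)"
    then obtain f where f: "x = \<pi> (length xs) f" "Poly_Mapping.keys f \<subseteq> ops T (length xs)"
      by (auto simp: epi_ops)
    from operad_args_preimage[OF xs] obtain ys where
      ys: "operad_args (linearize T) ys" "xs = map (\<lambda>(m, y). (m, \<pi> m y)) ys" "length ys = length xs" .
    note f = f[folded ys(3)]
    have sum: "arity_sum xs = arity_sum ys"
      by (simp add: ys(2))
    have "\<phi> (arity_sum ys) (comp B x xs) = \<psi> (arity_sum ys) (comp (linearize T) f ys)"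
      using epi_comp[OF ys(1) f(2)] \<phi>[OF operad_args_arity_sum[OF ys(1)] linearize_comp_closed[OF ys(1) f(2)]]
      by (simp add: f(1) flip: ys(2))
    moreover have "map (\<lambda>(m, y). (m, \<phi> m y)) xs = map (\<lambda>(m, y). (m, \<psi> m y)) ys"
      using ys(1) \<phi> by (auto simp: ys(2) operad_args_def)
    moreover have "\<phi> (length ys) x = \<psi> (length ys) f"
      unfolding f(1) by (rule \<phi>[OF operad_args_length[OF ys(1)] f(2)])
    ultimately show "\<phi> (arity_sum xs) (comp B x xs) =
        comp L (\<phi> (length xs) x) (map (\<lambda>(m, y). (m, \<phi> m y)) xs)"
      using onto.onto_comp[OF ys(1) f(2)] unfolding sum ys(3)[symmetric] by simp
  qed
qed

end

section \<open>Trees and presentations\<close>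

lemma leaves_map [simp]: "leaves (map_btree f g t) = image_mset g (leaves t)"
  by (induction t) auto

lemma leaves_graft: "leaves (graft t h) = (\<Sum>a\<in>#leaves t. leaves (h a))"
  by (induction t) auto

lemma vertices_graft: "vertices (graft t h) = vertices t \<union> (\<Union>a\<in>set_mset (leaves t). vertices (h a))"
  by (induction t) auto

lemma vertices_map [simp]: "vertices (map_btree f g t) = f ` vertices t"
  by (rule btree.set_map)

lemma map_btree_graft: "map_btree f g (graft t h) = graft (map_btree f id t) (\<lambda>a. map_btree f g (h a))"
  by (induction t) auto

lemma graft_cong:
  "(\<And>a. a \<in># leaves t \<Longrightarrow> h a = h' a) \<Longrightarrow> graft t h = graft t h'"
  by (induction t) auto

lemma map_btree_cong:
  "(\<And>a. a \<in># leaves t \<Longrightarrow> g a = g' a) \<Longrightarrow> map_btree f g t = map_btree f g' t"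
  by (induction t) auto

lemma tree_operad_simps [simp]:
  "unit (tree_operad E) = Leaf 0"
  "act (tree_operad E) n \<sigma> t = map_btree id \<sigma> t"
  by (simp_all add: tree_operad_def)

lemma in_tree_ops_iff:
  "t \<in> ops (tree_operad E) n \<longleftrightarrow> vertices t \<subseteq> E \<and> leaves t = mset [0..<n]"
  by (simp add: tree_operad_def)

lemma tree_comp:
  "comp (tree_operad E) t xs =
     graft t (\<lambda>i. map_btree id (\<lambda>r. offset (map fst xs) i + r) (snd (xs ! i)))"
  by (simp add: tree_operad_def)

text \<open>The shifted blocks tile an initial segment of the natural numbers. This is why grafting
  trees with shifted leaf labels again labels the leaves bijectively.\<close>

lemma concat_blocks:
  "concat (map (\<lambda>i. map (\<lambda>r. offset ms i + r) [0..<ms ! i]) [0..<length ms]) = [0..<sum_list ms]"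
proof (induction ms rule: rev_induct)
  case (snoc m ms)
  have "concat (map (\<lambda>i. map (\<lambda>r. offset (ms @ [m]) i + r) [0..<(ms @ [m]) ! i]) [0..<length ms]) =
      concat (map (\<lambda>i. map (\<lambda>r. offset ms i + r) [0..<ms ! i]) [0..<length ms])"
    by (intro arg_cong[of _ _ concat]) (auto simp: offset_def nth_append)
  moreover have "map (\<lambda>r. sum_list ms + r) [0..<m] = [sum_list ms..<sum_list ms + m]"
    by (rule nth_equalityI) auto
  moreover have "offset (ms @ [m]) (length ms) = sum_list ms"
    by (simp add: offset_def)
  ultimately show ?case
    using snoc upt_add_eq_append[of 0 "sum_list ms" m] by simp
qed simp

lemma image_mset_permutes:
  assumes "\<sigma> permutes {..<n}"
  shows "image_mset \<sigma> (mset [0..<n]) = mset [0..<n]"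
proof -
  have "image_mset \<sigma> (mset_set {0..<n}) = mset_set (\<sigma> ` {0..<n})"
    using permutes_inj_on[OF assms] by (rule image_mset_mset_set)
  moreover have "\<sigma> ` {0..<n} = {0..<n}"
    using permutes_image[OF assms] by (simp add: lessThan_atLeast0)
  ultimately show ?thesis
    by (simp add: mset_upt)
qed

interpretation tree: closed_operad "tree_operad E" for E
proof
  show "unit (tree_operad E) \<in> ops (tree_operad E) 1"
    by (simp add: in_tree_ops_iff)
next
  fix \<sigma> :: "nat \<Rightarrow> nat" and n t
  assume "\<sigma> permutes {..<n}" "t \<in> ops (tree_operad E) n"
  then show "act (tree_operad E) n \<sigma> t \<in> ops (tree_operad E) n"
    using image_mset_permutes[of \<sigma> n] by (simp add: in_tree_ops_iff del: mset_upt)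
next
  fix xs t
  assume xs: "operad_args (tree_operad E) xs" and t: "t \<in> ops (tree_operad E) (length xs)"
  let ?ms = "map fst xs"
  have nth: "vertices (snd (xs ! i)) \<subseteq> E \<and> leaves (snd (xs ! i)) = mset [0..<?ms ! i]" if "i < length xs" for i
    using xs nth_mem[OF that] that by (cases "xs ! i") (auto simp: operad_args_def in_tree_ops_iff)
  have "leaves (comp (tree_operad E) t xs) =
      (\<Sum>i\<in>#mset [0..<length xs]. leaves (map_btree id (\<lambda>r. offset ?ms i + r) (snd (xs ! i))))"
    using t by (simp add: tree_comp leaves_graft in_tree_ops_iff)
  also have "\<dots> = (\<Sum>i\<leftarrow>[0..<length xs]. mset (map (\<lambda>r. offset ?ms i + r) [0..<?ms ! i]))"
    unfolding sum_mset_sum_list[symmetric] mset_map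
    by (intro arg_cong[of _ _ sum_mset] image_mset_cong) (use nth in \<open>auto simp del: mset_upt\<close>)
  also have "\<dots> = mset (concat (map (\<lambda>i. map (\<lambda>r. offset ?ms i + r) [0..<?ms ! i]) [0..<length ?ms]))"
    by (simp add: mset_concat o_def)
  also have "\<dots> = mset [0..<arity_sum xs]"
    unfolding concat_blocks by (simp add: arity_sum_def)
  finally show "comp (tree_operad E) t xs \<in> ops (tree_operad E) (arity_sum xs)"
    using t subsetD[OF conjunct1[OF nth]] by (auto simp: in_tree_ops_iff tree_comp vertices_graft)
qed

lemma keys_sum_subset:
  "(\<And>i. i \<in> I \<Longrightarrow> Poly_Mapping.keys (f i) \<subseteq> S) \<Longrightarrow> Poly_Mapping.keys (\<Sum>i\<in>I. f i) \<subseteq> S"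
  by (induction I rule: infinite_finite_induct) (simp_all add: keys_add_subset)

lemma keys_single_subset: "a \<in> S \<Longrightarrow> Poly_Mapping.keys (Poly_Mapping.single a c) \<subseteq> S"
  by simp

lemma mset_upt_2: "mset [0..<2] = {#0, 1#}" and mset_upt_3: "mset [0..<3] = {#0, 1, 2#}"
  by (simp_all add: upt_rec)

section \<open>Operads presented by generators and relations\<close>

locale presentation =
  fixes E :: "'e set" and \<tau> :: "'e \<Rightarrow> 'e \<Rightarrow> 'k::field" and R :: "nat \<Rightarrow> (('e, nat) btree \<Rightarrow>\<^sub>0 'k) set"
  assumes R_closed: "\<And>n f. f \<in> R n \<Longrightarrow> Poly_Mapping.keys f \<subseteq> ops (tree_operad E) n"
begin

definition relations_ideal :: "nat \<Rightarrow> (('e, nat) btree \<Rightarrow>\<^sub>0 'k) set set" where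
  "relations_ideal = ideal_generated (free_operad E \<tau>) (\<lambda>n. free_class E \<tau> n ` R n)"

definition proj :: "nat \<Rightarrow> (('e, nat) btree \<Rightarrow>\<^sub>0 'k) \<Rightarrow> (('e, nat) btree \<Rightarrow>\<^sub>0 'k) set set" where
  "proj n f = coset (free_operad E \<tau>) relations_ideal n (free_class E \<tau> n f)"

text \<open>The kernel of the map from linearized trees to the presented operad, taken across both
  quotients at once; see \<open>proj_eq_iff\<close>.\<close>

definition tree_ideal :: "nat \<Rightarrow> (('e, nat) btree \<Rightarrow>\<^sub>0 'k) set" where
  "tree_ideal n = {f. Poly_Mapping.keys f \<subseteq> ops (tree_operad E) n \<and> free_class E \<tau> n f \<in> relations_ideal n}"

text \<open>The linearized tree operad as an image of itself. This is the starting point from which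
  \<open>quotient_epi\<close> yields the free operad and then the presented one.\<close>

sublocale lin: lin_epi "tree_operad E" "\<lambda>n f. f :: ('e, nat) btree \<Rightarrow>\<^sub>0 'k" "linearize (tree_operad E)"
  by standard auto

lemma symmetry_closed: "symmetry_relations E \<tau> n \<subseteq> ops (linearize (tree_operad E)) n"
proof
  fix f assume "f \<in> symmetry_relations E \<tau> n"
  then obtain i where i: "n = 2" "i \<in> E" "f = pure (Node i (Leaf 1) (Leaf 0)) -
      (\<Sum>j\<in>E. Poly_Mapping.single (Node j (Leaf 0) (Leaf 1)) (\<tau> i j))"
    by (auto simp: symmetry_relations_def split: if_splits)
  have "Poly_Mapping.keys f \<subseteq> ops (tree_operad E) 2"
    unfolding i(3) by (intro keys_diff_subset keys_sum_subset keys_single_subset)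
      (use i(2) in \<open>auto simp: in_tree_ops_iff mset_upt_2 simp del: mset_upt\<close>)
  then show "f \<in> ops (linearize (tree_operad E)) n"
    by (simp add: i(1))
qed

lemma symmetry_ideal: "operadic_ideal (linearize (tree_operad E)) (symmetry_ideal E \<tau>)"
  unfolding symmetry_ideal_def by (rule lin.ideal_generated_ideal) (rule symmetry_closed)

sublocale free: lin_epi "tree_operad E" "free_class E \<tau>" "free_operad E \<tau>"
  using lin.quotient_epi[OF symmetry_ideal] by (simp add: free_operad_def free_class_def[abs_def])

lemma relations_ideal: "operadic_ideal (free_operad E \<tau>) relations_ideal"
  unfolding relations_ideal_def
  by (rule free.ideal_generated_ideal) (use R_closed in \<open>auto simp: free.epi_ops\<close>)

lemma tree_ideal_pullback: "tree_ideal = free.pullback relations_ideal"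
  by (auto simp: fun_eq_iff tree_ideal_def free.pullback_def)

lemma proj_epi: "lin_epi (tree_operad E) proj (quotient_operad (free_operad E \<tau>) relations_ideal)"
  using free.quotient_epi[OF relations_ideal] by (simp add: proj_def[abs_def])

lemma proj_eq_iff:
  "\<lbrakk>Poly_Mapping.keys f \<subseteq> ops (tree_operad E) n; Poly_Mapping.keys g \<subseteq> ops (tree_operad E) n\<rbrakk>
    \<Longrightarrow> proj n f = proj n g \<longleftrightarrow> f - g \<in> tree_ideal n"
  unfolding proj_def tree_ideal_pullback by (rule free.coset_eq_iff[OF relations_ideal])

lemma tree_ideal: "operadic_ideal (linearize (tree_operad E)) tree_ideal"
  unfolding tree_ideal_pullback by (rule free.ideal_pullback[OF relations_ideal])

lemma R_subset_tree_ideal: "R n \<subseteq> tree_ideal n"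
proof -
  have "free_class E \<tau> n ` R n \<subseteq> relations_ideal n"
    unfolding relations_ideal_def
    by (rule free.ideal_generated_superset) (use R_closed in \<open>auto simp: free.epi_ops\<close>)
  then show ?thesis
    using R_closed by (auto simp: tree_ideal_def)
qed

lemma free_class_eq_iff:
  "\<lbrakk>Poly_Mapping.keys f \<subseteq> ops (tree_operad E) n; Poly_Mapping.keys g \<subseteq> ops (tree_operad E) n\<rbrakk>
    \<Longrightarrow> free_class E \<tau> n f = free_class E \<tau> n g \<longleftrightarrow> f - g \<in> symmetry_ideal E \<tau> n"
  using lin.coset_eq_iff[OF symmetry_ideal, of f n g] keys_diff_subset[of f _ g]
  by (simp add: free_class_def lin.pullback_def)

text \<open>The symmetries of the generators already vanish in the free operad, and every ideal of
  relations contains zero.\<close>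

lemma symmetry_subset_tree_ideal: "symmetry_relations E \<tau> n \<subseteq> tree_ideal n"
proof
  fix f assume f: "f \<in> symmetry_relations E \<tau> n"
  then have keys: "Poly_Mapping.keys f \<subseteq> ops (tree_operad E) n"
    using symmetry_closed by auto
  have "f \<in> symmetry_ideal E \<tau> n"
    using f by (auto simp: symmetry_ideal_def ideal_generated_def)
  then have "free_class E \<tau> n f = zero (free_operad E \<tau>) n"
    using keys free_class_eq_iff[of f n 0] by (simp add: free.epi_zero)
  then show "f \<in> tree_ideal n"
    using keys operadic_idealD(2)[OF relations_ideal] by (simp add: tree_ideal_def)
qed

text \<open>The universal property through which both inclusions for the kernel of the coloured
  morphism are shown: an ideal of linearized trees only has to be checked on the symmetries and on
  \<open>R\<close>.\<close>

lemma tree_ideal_least: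
  assumes I: "operadic_ideal (linearize (tree_operad E)) I"
    and "\<And>n. symmetry_relations E \<tau> n \<subseteq> I n" "\<And>n. R n \<subseteq> I n"
  shows "tree_ideal n \<subseteq> I n"
  unfolding tree_ideal_pullback relations_ideal_def
proof (rule free.pullback_generated_least[OF I])
  show "free_class E \<tau> n ` R n \<subseteq> free_class E \<tau> n ` I n" for n
    using assms(3) by blast
  fix n f assume "Poly_Mapping.keys f \<subseteq> ops (tree_operad E) n" "free_class E \<tau> n f = free_class E \<tau> n 0"
  then have "f \<in> symmetry_ideal E \<tau> n"
    using free_class_eq_iff[of f n 0] by simp
  then show "f \<in> I n"
    using assms(1,2) by (auto simp: symmetry_ideal_def ideal_generated_def)
qed

end

section \<open>Coloured trees\<close>

abbreviation uncolour :: "('e \<times> colour, 'l) btree \<Rightarrow> ('e, 'l) btree" where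
  "uncolour \<equiv> map_btree fst id"

primrec vsize :: "('e, 'l) btree \<Rightarrow> nat" where
  "vsize (Leaf a) = 0"
| "vsize (Node e s t) = Suc (vsize s + vsize t)"

primrec blacks :: "('e \<times> colour, 'l) btree \<Rightarrow> nat" where
  "blacks (Leaf a) = 0"
| "blacks (Node e s t) = (if snd e = Black then 1 else 0) + blacks s + blacks t"

text \<open>\<open>paint t b\<close> colours the first \<open>b\<close> vertices of \<open>t\<close> in preorder black.\<close>

primrec paint :: "('e, 'l) btree \<Rightarrow> nat \<Rightarrow> ('e \<times> colour, 'l) btree" where
  "paint (Leaf a) b = Leaf a"
| "paint (Node e s t) b =
     Node (e, if b = 0 then White else Black) (paint s (b - 1)) (paint t (b - 1 - vsize s))"

text \<open>A binary tree with n leaves has n - 1 vertices, hence between 0 and n - 1 black ones: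
  exactly the indices of the operations of \<open>two_Com\<close> in arity n.\<close>

lemma size_leaves: "size (leaves t) = Suc (vsize t)"
  by (induction t) auto

lemma uncolour_paint [simp]: "uncolour (paint t b) = t"
  by (induction t arbitrary: b) auto

text \<open>The budget is spent on the root, then on the left subtree, and the remainder goes to the
  right. Truncated subtraction keeps an exhausted budget at 0, and a budget larger than the tree
  saturates.\<close>

lemma blacks_paint: "blacks (paint t b) = min b (vsize t)"
  by (induction t arbitrary: b) auto

lemma blacks_map [simp]: "blacks (map_btree id g t) = blacks t"
  by (induction t) auto

lemma vsize_map [simp]: "vsize (map_btree f g t) = vsize t"
  by (induction t) auto

lemma paint_map: "paint (map_btree id g t) b = map_btree id g (paint t b)"
  by (induction t arbitrary: b) auto

lemma blacks_le: "blacks t \<le> vsize t"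
  by (induction t) auto

lemma leaves_paint [simp]: "leaves (paint t b) = leaves t"
  by (induction t arbitrary: b) auto

lemma vertices_two_gens_iff: "vertices t \<subseteq> two_gens E \<longleftrightarrow> vertices (uncolour t) \<subseteq> E"
  by (force simp: two_gens_def)

lemma uncolour_in_ops_iff [simp]:
  "uncolour t \<in> ops (tree_operad E) n \<longleftrightarrow> t \<in> ops (tree_operad (two_gens E)) n"
  by (simp add: in_tree_ops_iff vertices_two_gens_iff[of t] del: mset_upt)

lemma nth_concat_offset:
  "\<lbrakk>i < length xss; r < length (xss ! i)\<rbrakk> \<Longrightarrow>
     offset (map length xss) i + r < length (concat xss) \<and>
     concat xss ! (offset (map length xss) i + r) = xss ! i ! r"
proof (induction xss arbitrary: i)
  case (Cons xs xss)
  show ?case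
  proof (cases i)
    case (Suc j)
    then show ?thesis
      using Cons.IH[of j] Cons.prems by (auto simp: offset_def nth_append)
  qed (use Cons.prems in \<open>auto simp: offset_def nth_append\<close>)
qed simp

lemma list_perm_permutes:
  assumes "mset ls = mset [0..<n]"
  shows "list_perm ls permutes {..<n}"
proof -
  have ls: "length ls = n" "set ls = {..<n}" "distinct ls"
    using mset_eq_length[OF assms] mset_eq_setD[OF assms] mset_eq_imp_distinct_iff[OF assms]
    by (simp_all add: atLeast0LessThan)
  then have "bij_betw ((!) ls) {..<n} {..<n}"
    using bij_betw_nth[OF ls(3), of "{..<n}" "{..<n}"] by metis
  moreover have "list_perm ls i = ls ! i" if "i \<in> {..<n}" for i
    using that ls by (simp add: list_perm_def)
  ultimately have "bij_betw (list_perm ls) {..<n} {..<n}"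
    by (metis bij_betw_cong)
  then show ?thesis
    by (rule bij_imp_permutes) (auto simp: list_perm_def ls(1))
qed

lemma map_inv_nth:
  assumes "distinct L"
  shows "map (inv_into {..<length L} ((!) L)) L = [0..<length L]"
  by (rule nth_equalityI) (use assms in \<open>auto intro!: inv_into_f_f simp: inj_on_nth\<close>)

lemma linearize_comp_pure:
  "comp (linearize P) (pure p) (map (\<lambda>(m, a). (m, pure a)) xs) = pure (comp P p xs)"
  by (simp add: linearize_comp list_tensor_pure)

lemma linearize_act_pure: "act (linearize P) n \<sigma> (pure p) = pure (act P n \<sigma> p)"
  by (simp add: linearize_act)

section \<open>Congruence of trees modulo an operadic ideal\<close>

locale tree_congruence =
  fixes E :: "'e set" and N :: "nat \<Rightarrow> (('e, nat) btree \<Rightarrow>\<^sub>0 'k::field) set"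
  assumes ideal: "operadic_ideal (linearize (tree_operad E)) N"
begin

text \<open>The congruence modulo \<open>N\<close>, extended to trees with arbitrary leaf labels.\<close>

definition cong :: "('e, nat) btree \<Rightarrow> ('e, nat) btree \<Rightarrow> bool" where
  "cong s s' \<longleftrightarrow> vertices s \<subseteq> E \<and> vertices s' \<subseteq> E \<and> leaves s = leaves s' \<and>
     (\<forall>\<rho> n. image_mset \<rho> (leaves s) = mset [0..<n] \<longrightarrow>
        pure (map_btree id \<rho> s) - pure (map_btree id \<rho> s') \<in> N n)"

lemma cong_refl: "vertices s \<subseteq> E \<Longrightarrow> cong s s"
  by (simp add: cong_def operadic_ideal_linearizeD(2)[OF ideal])

lemma cong_sym: "cong s s' \<Longrightarrow> cong s' s"
  unfolding cong_def using operadic_ideal_linearize_uminus[OF ideal] by (metis minus_diff_eq)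

lemma cong_trans [trans]:
  assumes "cong s s'" "cong s' s''"
  shows "cong s s''"
  unfolding cong_def
proof (intro conjI allI impI)
  fix \<rho> n assume *: "image_mset \<rho> (leaves s) = mset [0..<n]"
  have "(pure (map_btree id \<rho> s) - pure (map_btree id \<rho> s')) +
      (pure (map_btree id \<rho> s') - pure (map_btree id \<rho> s'')) \<in> N n"
    by (rule operadic_ideal_linearizeD(3)[OF ideal]) (use assms * in \<open>auto simp: cong_def\<close>)
  then show "pure (map_btree id \<rho> s) - pure (map_btree id \<rho> s'') \<in> N n"
    by simp
qed (use assms in \<open>auto simp: cong_def\<close>)

lemma congD:
  assumes "cong s s'" "s \<in> ops (tree_operad E) n"
  shows "pure s - pure s' \<in> N n"
proof -
  have "image_mset id (leaves s) = mset [0..<n]"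
    using assms(2) by (simp add: in_tree_ops_iff)
  then have "pure (map_btree id id s) - pure (map_btree id id s') \<in> N n"
    using assms(1) by (simp only: cong_def)
  then show ?thesis
    by (simp add: btree.map_id)
qed

text \<open>An operadic composition takes arguments whose leaves are labelled by an initial segment,
  whereas grafted subtrees carry arbitrary labels. Each subtree is therefore standardized, the
  standardized trees are composed modulo \<open>N\<close>, and a permutation of the inputs restores
  the labels.\<close>

lemma cong_graft:
  assumes K: "K \<in> ops (tree_operad E) k" "K' \<in> ops (tree_operad E) k" "pure K - pure K' \<in> N k"
    and us: "list_all2 cong us us'" "length us = k" "us \<noteq> []"
  shows "cong (graft K ((!) us)) (graft K' ((!) us'))"
  unfolding cong_def
proof (intro conjI allI impI)
  have len': "length us' = k"
    using us list_all2_lengthD by fastforce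
  have nth: "cong (us ! i) (us' ! i)" if "i < k" for i
    using us that list_all2_nthD by auto
  have setK: "set_mset (leaves K) = {0..<k}" "set_mset (leaves K') = {0..<k}"
    using K by (simp_all add: in_tree_ops_iff)
  show "vertices (graft K ((!) us)) \<subseteq> E" "vertices (graft K' ((!) us')) \<subseteq> E"
    using K nth by (force simp: vertices_graft setK in_tree_ops_iff cong_def)+
  show "leaves (graft K ((!) us)) = leaves (graft K' ((!) us'))"
  proof -
    have "leaves K' = leaves K"
      using K by (simp add: in_tree_ops_iff)
    then show ?thesis
      unfolding leaves_graft
      by (simp, intro arg_cong[of _ _ sum_mset] image_mset_cong) (use setK nth in \<open>auto simp: cong_def\<close>)
  qed
  fix \<rho> n assume \<rho>: "image_mset \<rho> (leaves (graft K ((!) us))) = mset [0..<n]"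
  \<comment> \<open>\<open>L i\<close> lists the labels of the i-th subtree after relabelling by
    \<open>\<rho>\<close>, and \<open>\<theta> i\<close> replaces each label by its position in
    \<open>L i\<close>. This makes the subtree an operation of arity
    \<open>length (L i)\<close>.\<close>
  define L where "L i = sorted_list_of_multiset (image_mset \<rho> (leaves (us ! i)))" for i
  define \<theta> where "\<theta> i x = inv_into {..<length (L i)} ((!) (L i)) (\<rho> x)" for i x
  define xs where "xs = map (\<lambda>i. (length (L i), map_btree id (\<theta> i) (us ! i))) [0..<k]"
  define ys where "ys = map (\<lambda>i. (length (L i), map_btree id (\<theta> i) (us' ! i))) [0..<k]"
  \<comment> \<open>Read as a permutation, \<open>ls\<close> sends position r of block i to entry r
    of \<open>L i\<close>, which undoes the standardization.\<close>
  define ls where "ls = concat (map L [0..<k])"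
  have mset_L: "mset (L i) = image_mset \<rho> (leaves (us ! i))" for i
    by (simp add: L_def)
  have image_sum: "image_mset \<rho> (\<Sum>i\<in>#M. F i) = (\<Sum>i\<in>#M. image_mset \<rho> (F i))"
    for M and F :: "nat \<Rightarrow> nat multiset"
    by (induction M) auto
  have "mset ls = (\<Sum>i\<in>#mset [0..<k]. image_mset \<rho> (leaves (us ! i)))"
    by (simp add: ls_def mset_concat o_def mset_L flip: sum_mset_sum_list)
  also have "\<dots> = image_mset \<rho> (leaves (graft K ((!) us)))"
    using K by (simp add: leaves_graft in_tree_ops_iff image_sum)
  finally have ls: "mset ls = mset [0..<n]"
    by (simp add: \<rho>)
  \<comment> \<open>The grafted tree is labelled bijectively, so \<open>ls\<close> is a
    rearrangement of an initial segment and no label repeats.\<close>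
  have dist: "distinct (L i)" if "i < k" for i
  proof -
    have "distinct ls"
      using mset_eq_imp_distinct_iff[OF ls] by simp
    then show ?thesis
      using that by (auto simp: ls_def distinct_concat_iff)
  qed
  have \<theta>: "image_mset (\<theta> i) (leaves (us ! i)) = mset [0..<length (L i)]" if "i < k" for i
  proof -
    have "image_mset (\<theta> i) (leaves (us ! i)) = image_mset (inv_into {..<length (L i)} ((!) (L i))) (mset (L i))"
      by (simp add: mset_L \<theta>_def[abs_def] image_mset.compositionality o_def)
    also have "\<dots> = mset (map (inv_into {..<length (L i)} ((!) (L i))) (L i))"
      by simp
    finally show ?thesis
      by (simp add: map_inv_nth[OF dist[OF that]])
  qed
  have \<theta>_nth: "\<theta> i x < length (L i)" "L i ! \<theta> i x = \<rho> x" if "i < k" "x \<in># leaves (us ! i)" for i x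
  proof -
    have "\<rho> x \<in> set (L i)"
      using that arg_cong[OF mset_L, of set_mset i] by auto
    then have *: "\<rho> x \<in> (!) (L i) ` {..<length (L i)}"
      by (force simp: in_set_conv_nth)
    show "\<theta> i x < length (L i)" "L i ! \<theta> i x = \<rho> x"
      using inv_into_into[OF *] f_inv_into_f[OF *] by (auto simp: \<theta>_def)
  qed
  have pos: "1 \<le> length (L i)" for i
    using arg_cong[OF mset_L, of size i] by (simp add: size_leaves)
  have args: "operad_args (tree_operad E) xs" "operad_args (tree_operad E) ys"
    using nth \<theta> us pos by (auto simp: xs_def ys_def operad_args_def in_tree_ops_iff cong_def)
  have pargs: "operad_args (linearize (tree_operad E)) (map (\<lambda>(m, a). (m, pure a :: _ \<Rightarrow>\<^sub>0 'k)) zs)"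
    if "operad_args (tree_operad E) zs" for zs
    using that by (auto simp: operad_args_def)
  have "comp (linearize (tree_operad E)) (pure K) (map (\<lambda>(m, a). (m, pure a)) xs) -
      comp (linearize (tree_operad E)) (pure K') (map (\<lambda>(m, a). (m, pure a)) ys)
      \<in> N (arity_sum (map (\<lambda>(m, a). (m, pure a :: _ \<Rightarrow>\<^sub>0 'k)) xs))"
  proof (rule tree.ideal_comp_cong[OF ideal _ pargs[OF args(1)] pargs[OF args(2)]])
    show "list_all2 (\<lambda>(m, y) (m', y'). m = m' \<and> y - y' \<in> N m)
      (map (\<lambda>(m, a). (m, pure a)) xs) (map (\<lambda>(m, a). (m, pure a)) ys)"
      using nth \<theta> by (auto simp: list_all2_conv_all_nth xs_def ys_def cong_def)
  qed (use K in \<open>auto simp: xs_def\<close>)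
  then have diff: "pure (comp (tree_operad E) K xs) - pure (comp (tree_operad E) K' ys) \<in> N (arity_sum xs)"
    by (simp add: linearize_comp_pure)
  have "length ls = arity_sum xs"
    by (simp add: ls_def xs_def arity_sum_def length_concat o_def)
  moreover have "length ls = n"
    using arg_cong[OF ls, of size] by simp
  ultimately have sum: "arity_sum xs = n"
    by simp
  have fst: "map fst xs = map length (map L [0..<k])" "map fst ys = map length (map L [0..<k])"
    by (simp_all add: xs_def ys_def o_def)
  have lp: "list_perm ls (offset (map length (map L [0..<k])) i + \<theta> i x) = \<rho> x"
    if "i < k" "x \<in># leaves (us ! i)" for i x
    using nth_concat_offset[of i "map L [0..<k]" "\<theta> i x"] that \<theta>_nth[OF that]
    by (simp add: ls_def list_perm_def)
  have "map_btree id (list_perm ls) (comp (tree_operad E) K xs) = map_btree id \<rho> (graft K ((!) us))"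
    unfolding tree_comp fst map_btree_graft btree.map_id
  proof (rule graft_cong)
    fix i assume "i \<in># leaves K"
    then have i: "i < k"
      using setK by simp
    have xs_i: "snd (xs ! i) = map_btree id (\<theta> i) (us ! i)"
      by (simp add: xs_def i)
    show "map_btree id (list_perm ls) (map_btree id (\<lambda>r. offset (map length (map L [0..<k])) i + r) (snd (xs ! i))) =
        map_btree id \<rho> (us ! i)"
      unfolding xs_i btree.map_comp id_o by (rule map_btree_cong) (simp add: lp[OF i, simplified])
  qed
  moreover have "map_btree id (list_perm ls) (comp (tree_operad E) K' ys) = map_btree id \<rho> (graft K' ((!) us'))"
    unfolding tree_comp fst map_btree_graft btree.map_id
  proof (rule graft_cong)
    fix i assume "i \<in># leaves K'"
    then have i: "i < k"
      using setK by simp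
    have ys_i: "snd (ys ! i) = map_btree id (\<theta> i) (us' ! i)"
      by (simp add: ys_def i)
    have leaves_i: "leaves (us' ! i) = leaves (us ! i)"
      using nth[OF i] by (simp add: cong_def)
    show "map_btree id (list_perm ls) (map_btree id (\<lambda>r. offset (map length (map L [0..<k])) i + r) (snd (ys ! i))) =
        map_btree id \<rho> (us' ! i)"
      unfolding ys_i btree.map_comp id_o by (rule map_btree_cong) (simp add: lp[OF i, simplified] leaves_i)
  qed
  moreover have "act (linearize (tree_operad E)) n (list_perm ls)
      (pure (comp (tree_operad E) K xs) - pure (comp (tree_operad E) K' ys)) \<in> N n"
    by (rule operadic_ideal_linearizeD(5)[OF ideal list_perm_permutes[OF ls]]) (use diff sum in simp)
  ultimately show "pure (map_btree id \<rho> (graft K ((!) us))) - pure (map_btree id \<rho> (graft K' ((!) us'))) \<in> N n"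
    by (simp add: linearize_act_diff linearize_act_pure)
qed

text \<open>The case of grafting onto a corolla: the congruence passes from subtrees to the tree,
  which is what an induction over trees needs.\<close>

lemma cong_Node:
  assumes "e \<in> E" "cong s s'" "cong t t'"
  shows "cong (Node e s t) (Node e s' t')"
  using cong_graft[of "Node e (Leaf 0) (Leaf 1)" 2 "Node e (Leaf 0) (Leaf 1)" "[s, t]" "[s', t']"] assms
  by (simp add: in_tree_ops_iff mset_upt_2 operadic_ideal_linearizeD(2)[OF ideal] del: mset_upt)

end

lemma operadic_ideal_sum:
  assumes "operadic_ideal (linearize T) N" "\<And>i. i \<in> I \<Longrightarrow> f i \<in> N n"
  shows "(\<Sum>i\<in>I. f i) \<in> N n"
  using assms(2)
  by (induction I rule: infinite_finite_induct) (simp_all add: operadic_ideal_linearizeD[OF assms(1)])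

lemma in_two_gens [simp]: "(i, c) \<in> two_gens E \<longleftrightarrow> i \<in> E"
  by (simp add: two_gens_def)

lemma sum_two_gens:
  assumes "finite E"
  shows "(\<Sum>k\<in>two_gens E. f k) = (\<Sum>i\<in>E. f (i, White) + f (i, Black))"
proof -
  have UNIV: "(UNIV :: colour set) = {White, Black}"
    using colour.exhaust by auto
  show ?thesis
    unfolding two_gens_def sum.cartesian_product' UNIV by (simp add: sum.distrib)
qed

text \<open>The action is block diagonal, so a symmetry relation involves a single colour. In
  particular all its trees have the same number of black vertices.\<close>

lemma two_symmetry_relations:
  assumes "finite E"
  shows "symmetry_relations (two_gens E) (two_action \<tau>) 2 =
    {pure (Node (i, c) (Leaf 1) (Leaf 0)) -
       (\<Sum>k\<in>E. Poly_Mapping.single (Node (k, c) (Leaf 0) (Leaf 1)) (\<tau> i k)) | i c. i \<in> E}"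
proof -
  have sum: "(\<Sum>k\<in>two_gens E. Poly_Mapping.single (Node k (Leaf 0) (Leaf 1)) (two_action \<tau> (i, c) k)) =
      (\<Sum>k\<in>E. Poly_Mapping.single (Node (k, c) (Leaf 0) (Leaf 1)) (\<tau> i k))" for i c
    unfolding sum_two_gens[OF assms] by (cases c) (simp_all add: two_action_def)
  show ?thesis
    unfolding symmetry_relations_def if_P[OF refl] sum[symmetric] by (auto simp: two_gens_def)
qed

section \<open>Recolouring trees by the swap relations\<close>

locale recolouring = tree_congruence "two_gens E" N
  for E :: "'e set" and N :: "nat \<Rightarrow> (('e \<times> colour, nat) btree \<Rightarrow>\<^sub>0 'k::field) set" +
  fixes \<tau> :: "'e \<Rightarrow> 'e \<Rightarrow> 'k"
  assumes finite_E: "finite E"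
    and symmetry: "symmetry_relations (two_gens E) (two_action \<tau>) n \<subseteq> N n"
    and swap: "\<lbrakk>i \<in> E; j \<in> E\<rbrakk> \<Longrightarrow>
      pure (T_tree 1 (i, White) (j, Black)) - pure (T_tree 1 (i, Black) (j, White)) \<in> N 3"
begin

lemma swap_T_tree:
  assumes "i \<in> E" "j \<in> E"
  shows "pure (T_tree 1 (i, x) (j, y)) - pure (T_tree 1 (i, y) (j, x)) \<in> N 3"
  using swap[OF assms] operadic_ideal_linearize_uminus[OF ideal swap[OF assms]]
    operadic_ideal_linearizeD(2)[OF ideal]
  by (cases x; cases y) auto

text \<open>Three arbitrary trees are grafted onto the leaves of the swap relation; since
  \<open>cong\<close> admits any leaf labels, colours can be exchanged along every edge to a left
  child.\<close>

lemma swap_left: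
  assumes "i \<in> E" "j \<in> E" "vertices a \<subseteq> two_gens E" "vertices b \<subseteq> two_gens E" "vertices c \<subseteq> two_gens E"
  shows "cong (Node (j, y) (Node (i, x) a b) c) (Node (j, x) (Node (i, y) a b) c)"
  using cong_graft[of "T_tree 1 (i, x) (j, y)" 3 "T_tree 1 (i, y) (j, x)" "[a, b, c]" "[a, b, c]"]
    swap_T_tree[OF assms(1,2), of x y] assms
  by (simp add: in_tree_ops_iff mset_upt_3 T_tree_def cong_refl numeral_2_eq_2 del: mset_upt)

text \<open>Only left-nested trees occur in the swap relations; a right-nested tree is first rewritten as a
  combination of left-nested ones by the symmetry of its root.\<close>

lemma right_nested:
  assumes "i \<in> E" "j \<in> E"
  shows "pure (Node (j, y) (Leaf 2) (Node (i, x) (Leaf 0) (Leaf 1))) -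
    (\<Sum>k\<in>E. Poly_Mapping.single (T_tree 1 (i, x) (k, y)) (\<tau> j k)) \<in> N 3"
proof -
  define S :: "('e \<times> colour, nat) btree \<Rightarrow>\<^sub>0 'k" where
    "S = pure (Node (j, y) (Leaf 1) (Leaf 0)) - (\<Sum>k\<in>E. Poly_Mapping.single (Node (k, y) (Leaf 0) (Leaf 1)) (\<tau> j k))"
  \<comment> \<open>The inner vertex is substituted into input 0 of the symmetry relation and the
    identity into input 1. In the term with reversed inputs the inner vertex thereby ends up on the
    right and the single leaf gets label 2.\<close>
  define xs where "xs = [(2 :: nat, Node (i, x) (Leaf 0) (Leaf 1)), (1, Leaf (0 :: nat))]"
  have "S \<in> symmetry_relations (two_gens E) (two_action \<tau>) 2"
    unfolding two_symmetry_relations[OF finite_E] S_def using assms(2) by blast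
  then have S: "S \<in> N 2"
    using symmetry by blast
  have args: "operad_args (linearize (tree_operad (two_gens E))) (map (\<lambda>(m, a). (m, pure a :: _ \<Rightarrow>\<^sub>0 'k)) xs)"
    using assms(1) by (simp add: xs_def operad_args_def in_tree_ops_iff mset_upt_2 del: mset_upt)
  have "comp (linearize (tree_operad (two_gens E))) S (map (\<lambda>(m, a). (m, pure a)) xs)
      \<in> N (arity_sum (map (\<lambda>(m, a). (m, pure a :: _ \<Rightarrow>\<^sub>0 'k)) xs))"
    by (rule operadic_ideal_compD[OF ideal args])
      (use S operadic_ideal_linearizeD(1)[OF ideal S] in \<open>simp_all add: xs_def numeral_2_eq_2\<close>)
  moreover have "comp (linearize (tree_operad (two_gens E))) S (map (\<lambda>(m, a). (m, pure a)) xs) =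
      pure (Node (j, y) (Leaf 2) (Node (i, x) (Leaf 0) (Leaf 1))) -
      (\<Sum>k\<in>E. Poly_Mapping.single (T_tree 1 (i, x) (k, y)) (\<tau> j k))"
    unfolding linearize_comp list_tensor_pure S_def lbind_diff_left lbind_sum_left
    by (simp add: xs_def tree_comp offset_def T_tree_def numeral_2_eq_2)
  ultimately show ?thesis
    by (simp add: xs_def numeral_3_eq_3)
qed

lemma swap_right:
  assumes "i \<in> E" "j \<in> E" "vertices a \<subseteq> two_gens E" "vertices b \<subseteq> two_gens E" "vertices c \<subseteq> two_gens E"
  shows "cong (Node (j, y) c (Node (i, x) a b)) (Node (j, x) c (Node (i, y) a b))"
proof -
  let ?R = "\<lambda>x y. pure (Node (j, y) (Leaf 2) (Node (i, x) (Leaf 0) (Leaf 1))) :: _ \<Rightarrow>\<^sub>0 'k"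
  let ?L = "\<lambda>x y. \<Sum>k\<in>E. Poly_Mapping.single (T_tree 1 (i, x) (k, y)) (\<tau> j k)"
  \<comment> \<open>The coefficients \<open>\<tau> j k\<close> do not depend on colours, so both
    colourings are rewritten with the same coefficients, and their difference is a combination of
    left-nested swaps.\<close>
  have "?L x y - ?L y x = (\<Sum>k\<in>E. scale (\<tau> j k) (pure (T_tree 1 (i, x) (k, y)) - pure (T_tree 1 (i, y) (k, x))))"
    unfolding sum_subtractf[symmetric]
    by (intro sum.cong refl poly_mapping_eqI) (simp add: lookup_minus lookup_single algebra_simps when_def)
  also have "\<dots> \<in> N 3"
    by (intro operadic_ideal_sum[OF ideal] operadic_ideal_linearizeD(4)[OF ideal] swap_T_tree assms)
  finally have L: "?L x y - ?L y x \<in> N 3" .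
  \<comment> \<open>The path runs from right-nested to left-nested, through the swap, and back with
    the colours exchanged.\<close>
  have "(?R x y - ?L x y) + (?L x y - ?L y x) - (?R y x - ?L y x) \<in> N 3"
    by (rule operadic_ideal_linearize_diff[OF ideal operadic_ideal_linearizeD(3)[OF ideal]])
      (use right_nested[OF assms(1,2)] L in auto)
  then have "?R x y - ?R y x \<in> N 3"
    by simp
  then show ?thesis
    using cong_graft[of "Node (j, y) (Leaf 2) (Node (i, x) (Leaf 0) (Leaf 1))" 3
        "Node (j, x) (Leaf 2) (Node (i, y) (Leaf 0) (Leaf 1))" "[a, b, c]" "[a, b, c]"] assms
    by (simp add: in_tree_ops_iff mset_upt_3 cong_refl numeral_2_eq_2 add_mset_commute del: mset_upt)
qed

text \<open>By the induction hypothesis for the two subtrees, the class of a coloured tree only depends on the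
  colour of the root and the numbers of black vertices in the subtrees; swapping the root with a child
  connects any two such states with the same total.\<close>

lemma recolour:
  assumes "uncolour s = u" "uncolour s' = u" "blacks s = blacks s'" "vertices u \<subseteq> E"
  shows "cong s s'"
  using assms
proof (induction u arbitrary: s s')
  case (Leaf a)
  then show ?case
    by (cases s; cases s') (auto intro: cong_refl)
next
  case (Node e tl tr)
  \<comment> \<open>Representative of the state with root colour \<open>c\<close> and with
    \<open>b1\<close> and \<open>b2\<close> black vertices on the two sides; the subtrees are in
    canonical colouring.\<close>
  let ?S = "\<lambda>c b1 b2. Node (e, c) (paint tl b1) (paint tr b2)"
  have e: "e \<in> E" and vl: "vertices tl \<subseteq> E" and vr: "vertices tr \<subseteq> E"
    using Node.prems by auto
  have vpl: "vertices (paint tl b) \<subseteq> two_gens E" and vpr: "vertices (paint tr b) \<subseteq> two_gens E" for b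
    using vl vr by (simp_all add: vertices_two_gens_iff del: vertices_map)
  have IHl: "cong l l'" if "uncolour l = tl" "uncolour l' = tl" "blacks l = blacks l'" for l l'
    using Node.IH(1) that vl by blast
  have IHr: "cong r r'" if "uncolour r = tr" "uncolour r' = tr" "blacks r = blacks r'" for r r'
    using Node.IH(2) that vr by blast
  \<comment> \<open>A nonzero budget colours the root of the painted left subtree black, so that
    black can be exchanged with the white root. The left subtree then has \<open>b1\<close> black
    vertices but perhaps not in canonical position, which the induction hypothesis repairs.\<close>
  have left: "cong (?S White (Suc b1) b2) (?S Black b1 b2)" if b1: "b1 < vsize tl" for b1 b2
  proof (cases tl)
    case (Node f p q)
    let ?P = "paint p b1" and ?Q = "paint q (b1 - vsize p)"
    have f: "f \<in> E" and vp: "vertices ?P \<subseteq> two_gens E" and vq: "vertices ?Q \<subseteq> two_gens E"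
      using vl by (simp_all add: Node vertices_two_gens_iff del: vertices_map)
    have "cong (Node (e, White) (Node (f, Black) ?P ?Q) (paint tr b2))
        (Node (e, Black) (Node (f, White) ?P ?Q) (paint tr b2))"
      by (rule swap_left[OF f e vp vq vpr])
    also have "cong \<dots> (?S Black b1 b2)"
    proof (intro cong_Node cong_refl vpr IHl)
      show "blacks (Node (f, White) ?P ?Q) = blacks (paint tl b1)"
        using b1 by (simp add: blacks_paint Node del: paint.simps)
    qed (use e in \<open>simp_all add: Node del: paint.simps\<close>)
    finally show ?thesis
      by (simp add: Node)
  qed (use b1 in simp)
  have right: "cong (?S White b1 (Suc b2)) (?S Black b1 b2)" if b2: "b2 < vsize tr" for b1 b2
  proof (cases tr)
    case (Node f p q)
    let ?P = "paint p b2" and ?Q = "paint q (b2 - vsize p)"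
    have f: "f \<in> E" and vp: "vertices ?P \<subseteq> two_gens E" and vq: "vertices ?Q \<subseteq> two_gens E"
      using vr by (simp_all add: Node vertices_two_gens_iff del: vertices_map)
    have "cong (Node (e, White) (paint tl b1) (Node (f, Black) ?P ?Q))
        (Node (e, Black) (paint tl b1) (Node (f, White) ?P ?Q))"
      by (rule swap_right[OF f e vp vq vpl])
    also have "cong \<dots> (?S Black b1 b2)"
    proof (intro cong_Node cong_refl vpl IHr)
      show "blacks (Node (f, White) ?P ?Q) = blacks (paint tr b2)"
        using b2 by (simp add: blacks_paint Node del: paint.simps)
    qed (use e in \<open>simp_all add: Node del: paint.simps\<close>)
    finally show ?thesis
      by (simp add: Node)
  qed (use b2 in simp)
  have move: "cong (?S Black b1 (b2 + d)) (?S Black (b1 + d) b2)"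
    if "b1 + d \<le> vsize tl" "b2 + d \<le> vsize tr" for b1 b2 d
    using that
  proof (induction d arbitrary: b1)
    case 0
    then show ?case
      using e vpl vpr by (simp add: cong_refl)
  next
    case (Suc d)
    \<comment> \<open>One black vertex travels from right to left through the root: the root gives
      its black to the left subtree and recovers one from the right.\<close>
    have "cong (?S Black b1 (b2 + Suc d)) (?S White (Suc b1) (Suc (b2 + d)))"
      using cong_sym[OF left[of b1 "b2 + Suc d"]] Suc.prems by simp
    also have "cong \<dots> (?S Black (Suc b1) (b2 + d))"
      using right[of "b2 + d" "Suc b1"] Suc.prems by simp
    also have "cong \<dots> (?S Black (Suc b1 + d) b2)"
      using Suc.IH[of "Suc b1"] Suc.prems by simp
    finally show ?case
      by simp
  qed
  have black: "cong (?S Black b1 b2) (?S Black b1' b2')"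
    if "b1 + b2 = b1' + b2'" "b1 \<le> vsize tl" "b1' \<le> vsize tl" "b2 \<le> vsize tr" "b2' \<le> vsize tr" for b1 b2 b1' b2'
  proof (cases "b1 \<le> b1'")
    case True
    then obtain d where "b1' = b1 + d"
      using le_Suc_ex by blast
    moreover from this have "b2 = b2' + d"
      using that(1) by simp
    ultimately show ?thesis
      using move[of b1 d b2'] that by simp
  next
    case False
    then obtain d where "b1 = b1' + d"
      using nat_le_linear le_Suc_ex by blast
    moreover from this have "b2' = b2 + d"
      using that(1) by simp
    ultimately show ?thesis
      using cong_sym[OF move[of b1' d b2]] that by simp
  qed
  \<comment> \<open>A white root over some black vertex can take that black, so every colouring
    reduces either to the all-white state or to a state with black root. The \<open>Suc\<close> in
    the count is the root itself.\<close>
  have normal: "\<exists>b1 b2. b1 \<le> vsize tl \<and> b2 \<le> vsize tr \<and>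
      (blacks r = 0 \<and> cong r (?S White 0 0) \<or> blacks r = Suc (b1 + b2) \<and> cong r (?S Black b1 b2))"
    if r: "uncolour r = Node e tl tr" for r
  proof -
    obtain c p q where rc: "r = Node (e, c) p q" "uncolour p = tl" "uncolour q = tr"
      using r by (cases r) auto
    have bp: "blacks p \<le> vsize tl" and bq: "blacks q \<le> vsize tr"
      using blacks_le[of p] blacks_le[of q] rc by auto
    have "cong p (paint tl (blacks p))" "cong q (paint tr (blacks q))"
      using IHl[OF rc(2)] IHr[OF rc(3)] bp bq by (simp_all add: blacks_paint)
    then have 1: "cong r (?S c (blacks p) (blacks q))"
      unfolding rc(1) using e by (intro cong_Node) simp_all
    show ?thesis
    proof (cases c)
      case Black
      then show ?thesis
        using 1 bp bq rc(1) by auto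
    next
      case White
      consider "blacks p = 0" "blacks q = 0" | b where "blacks p = Suc b" | b where "blacks q = Suc b"
        by (cases "blacks p"; cases "blacks q") auto
      then show ?thesis
      proof cases
        case 1
        then show ?thesis
          using \<open>cong r (?S c (blacks p) (blacks q))\<close> White rc(1) by auto
      next
        case (2 b)
        then have "cong r (?S Black b (blacks q))"
          using cong_trans[OF 1] left[of b "blacks q"] bp White by simp
        then show ?thesis
          using 2 bp bq rc(1) White by (intro exI[of _ b] exI[of _ "blacks q"]) simp
      next
        case (3 b)
        then have "cong r (?S Black (blacks p) b)"
          using cong_trans[OF 1] right[of b "blacks p"] bq White by simp
        then show ?thesis
          using 3 bp bq rc(1) White by (intro exI[of _ "blacks p"] exI[of _ b]) simp
      qed
    qed
  qed
  obtain b1 b2 where s: "b1 \<le> vsize tl" "b2 \<le> vsize tr"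
    "blacks s = 0 \<and> cong s (?S White 0 0) \<or> blacks s = Suc (b1 + b2) \<and> cong s (?S Black b1 b2)"
    using normal[OF Node.prems(1)] by blast
  obtain b1' b2' where s': "b1' \<le> vsize tl" "b2' \<le> vsize tr"
    "blacks s' = 0 \<and> cong s' (?S White 0 0) \<or> blacks s' = Suc (b1' + b2') \<and> cong s' (?S Black b1' b2')"
    using normal[OF Node.prems(2)] by blast
  show ?case
    using s s' Node.prems(3) black[of b1 b2 b1' b2'] cong_sym cong_trans by (metis Suc_inject nat.distinct(1))
qed

end

section \<open>Hadamard products and partition posets\<close>

lemma hadamard_simps [simp]:
  "ops (hadamard P Q) n = ops P n \<times> ops Q n"
  "unit (hadamard P Q) = (unit P, unit Q)"
  "comp (hadamard P Q) (p, q) xs =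
     (comp P p (map (\<lambda>(m, x). (m, fst x)) xs), comp Q q (map (\<lambda>(m, x). (m, snd x)) xs))"
  "act (hadamard P Q) n \<sigma> (p, q) = (act P n \<sigma> p, act Q n \<sigma> q)"
  by (simp_all add: hadamard_def)

text \<open>Operad laws in \<open>S\<close> become laws in \<open>P\<close> after applying
  \<open>g\<close>. They hold in \<open>S\<close> itself once enough such maps separate its
  elements; the two projections of a Hadamard product do this.\<close>

locale strict_hom = set_operad P for P :: "'p operad" +
  fixes S :: "'s operad" and g :: "'s \<Rightarrow> 'p"
  assumes hom_ops: "x \<in> ops S n \<Longrightarrow> g x \<in> ops P n"
    and hom_unit: "g (unit S) = unit P"
    and hom_comp: "g (comp S x xs) = comp P (g x) (map (\<lambda>(m, y). (m, g y)) xs)"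
    and hom_act: "g (act S n \<sigma> x) = act P n \<sigma> (g x)"
begin

abbreviation gs :: "(nat \<times> 's) list \<Rightarrow> (nat \<times> 'p) list" where
  "gs \<equiv> map (\<lambda>(m, y). (m, g y))"

lemma hom_args: "operad_args S xs \<Longrightarrow> operad_args P (gs xs)"
  using hom_ops by (fastforce simp: operad_args_def)

lemma hom_assoc:
  assumes "operad_args S xs" "x \<in> ops S (length xs)" "length yss = length xs"
    "\<And>i. i < length xs \<Longrightarrow> operad_args S (yss ! i) \<and> length (yss ! i) = fst (xs ! i)"
  shows "g (comp S (comp S x xs) (concat yss)) =
    g (comp S x (map2 (\<lambda>(m, q) ys. (arity_sum ys, comp S q ys)) xs yss))"
proof -
  have "gs (map2 (\<lambda>(m, q) ys. (arity_sum ys, comp S q ys)) xs yss) =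
      map2 (\<lambda>(m, q) ys. (arity_sum ys, comp P q ys)) (gs xs) (map gs yss)"
    using assms(3)[symmetric] by (induction xs yss rule: list_induct2) (auto simp: hom_comp)
  moreover have "comp P (comp P (g x) (gs xs)) (concat (map gs yss)) =
      comp P (g x) (map2 (\<lambda>(m, q) ys. (arity_sum ys, comp P q ys)) (gs xs) (map gs yss))"
    by (rule comp_assoc) (use assms hom_args hom_ops in \<open>auto simp: split_def\<close>)
  ultimately show ?thesis
    by (simp add: hom_comp map_concat)
qed

lemma hom_act_inner:
  assumes "operad_args S xs" "x \<in> ops S (length xs)"
    "\<And>i. i < length xs \<Longrightarrow> \<sigma>s i permutes {..<fst (xs ! i)}"
  shows "g (comp S x (map (\<lambda>i. (fst (xs ! i), act S (fst (xs ! i)) (\<sigma>s i) (snd (xs ! i)))) [0..<length xs])) =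
    g (act S (arity_sum xs) (sum_perm (map fst xs) \<sigma>s) (comp S x xs))"
proof -
  have eq: "gs (map (\<lambda>i. (fst (xs ! i), act S (fst (xs ! i)) (\<sigma>s i) (snd (xs ! i)))) [0..<length xs]) =
      map (\<lambda>i. (fst (gs xs ! i), act P (fst (gs xs ! i)) (\<sigma>s i) (snd (gs xs ! i)))) [0..<length (gs xs)]"
    by (auto simp: hom_act split_def)
  have fst: "map fst (gs xs) = map fst xs"
    by auto
  show ?thesis
    unfolding hom_comp hom_act eq
    by (rule comp_act_inner[OF hom_args[OF assms(1)], unfolded fst arity_sum_map])
      (use assms hom_ops in \<open>auto simp: split_def\<close>)
qed

lemma hom_act_outer:
  assumes "operad_args S xs" "x \<in> ops S (length xs)" "\<sigma> permutes {..<length xs}"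
  shows "g (comp S (act S (length xs) \<sigma> x) xs) =
    g (act S (arity_sum xs) (block_perm (map fst xs) \<sigma>) (comp S x (map (\<lambda>i. xs ! \<sigma> i) [0..<length xs])))"
proof -
  have "\<sigma> i < length xs" if "i < length xs" for i
    using permutes_in_image[OF assms(3), of i] that by simp
  then have eq: "gs (map (\<lambda>i. xs ! \<sigma> i) [0..<length xs]) = map (\<lambda>i. gs xs ! \<sigma> i) [0..<length (gs xs)]"
    by auto
  have fst: "map fst (gs xs) = map fst xs"
    by auto
  show ?thesis
    unfolding hom_comp hom_act eq
    using comp_act_outer[OF hom_args[OF assms(1)], of "g x" \<sigma>, unfolded fst arity_sum_map length_map] assms hom_ops
    by simp
qed

end

lemma set_operad_hadamard:
  assumes "set_operad P" "set_operad Q"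
  shows "set_operad (hadamard P Q)"
proof -
  let ?H = "hadamard P Q"
  have comp: "comp ?H x xs = (comp P (fst x) (map (\<lambda>(m, x). (m, fst x)) xs), comp Q (snd x) (map (\<lambda>(m, x). (m, snd x)) xs))"
    and act: "act ?H n \<sigma> x = (act P n \<sigma> (fst x), act Q n \<sigma> (snd x))" for x xs n \<sigma>
    by (cases x; simp)+
  interpret P: strict_hom P ?H fst
    using assms(1) by (intro strict_hom.intro strict_hom_axioms.intro) (auto simp: comp act)
  interpret Q: strict_hom Q ?H snd
    using assms(2) by (intro strict_hom.intro strict_hom_axioms.intro) (auto simp: comp act)
  show ?thesis
  proof
    show "unit ?H \<in> ops ?H 1"
      using P.unit_closed Q.unit_closed by simp
    show "comp ?H p xs \<in> ops ?H (arity_sum xs)" if "operad_args ?H xs" "p \<in> ops ?H (length xs)" for p xs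
      using P.comp_closed[OF P.hom_args[OF that(1)], of "fst p"] Q.comp_closed[OF Q.hom_args[OF that(1)], of "snd p"] that(2)
      by (auto simp: comp)
    show "act ?H n \<sigma> p \<in> ops ?H n" if "1 \<le> n" "\<sigma> permutes {..<n}" "p \<in> ops ?H n" for n \<sigma> p
      using that P.act_closed Q.act_closed by (auto simp: act)
    show "act ?H n id p = p" if "1 \<le> n" "p \<in> ops ?H n" for n p
      using that P.act_id Q.act_id by (auto simp: act)
    show "act ?H n (\<sigma> \<circ> \<rho>) p = act ?H n \<sigma> (act ?H n \<rho> p)"
      if "1 \<le> n" "\<sigma> permutes {..<n}" "\<rho> permutes {..<n}" "p \<in> ops ?H n" for n \<sigma> \<rho> p
      using that P.act_comp Q.act_comp by (auto simp: act)
    show "comp ?H (unit ?H) [(n, p)] = p" if "1 \<le> n" "p \<in> ops ?H n" for n p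
      using that P.comp_unit_left Q.comp_unit_left by (auto simp: comp)
    show "comp ?H p (replicate n (1, unit ?H)) = p" if "1 \<le> n" "p \<in> ops ?H n" for n p
      using that P.comp_unit_right Q.comp_unit_right by (auto simp: comp map_replicate)
  qed (auto intro!: prod_eqI P.hom_assoc Q.hom_assoc P.hom_act_inner Q.hom_act_inner
      P.hom_act_outer Q.hom_act_outer simp del: hadamard_simps)
qed

section \<open>The set operad of two totally compatible commutative products\<close>

lemma two_Com_simps [simp]:
  "ops two_Com n = {..<n}" "unit two_Com = 0" "comp two_Com i xs = i + sum_list (map snd xs)"
  "act two_Com n \<sigma> i = i"
  by (simp_all add: two_Com_def)

lemma set_operad_two_Com: "set_operad two_Com"
proof
  show "comp two_Com p xs \<in> ops two_Com (arity_sum xs)"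
    if "operad_args two_Com xs" "p \<in> ops two_Com (length xs)" for p and xs :: "(nat \<times> nat) list"
  proof -
    have "\<forall>(m, q)\<in>set xs. q < m"
      using that(1) by (auto simp: operad_args_def)
    \<comment> \<open>Each index is at most its arity minus one, which leaves room for one unit per
      argument; the outer index, below the number of arguments, fits into that room.\<close>
    then have "sum_list (map snd xs) + length xs \<le> arity_sum xs"
      by (induction xs) auto
    then show ?thesis
      using that(2) by simp
  qed
  show "comp two_Com (comp two_Com p xs) (concat yss) =
      comp two_Com p (map2 (\<lambda>(m, q) ys. (arity_sum ys, comp two_Com q ys)) xs yss)"
    if "length yss = length xs" for p and xs :: "(nat \<times> nat) list" and yss
    using that[symmetric] by (induction xs yss rule: list_induct2) auto
  show "comp two_Com p (map (\<lambda>i. (fst (xs ! i), act two_Com (fst (xs ! i)) (\<sigma>s i) (snd (xs ! i)))) [0..<length xs]) =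
      act two_Com (arity_sum xs) (sum_perm (map fst xs) \<sigma>s) (comp two_Com p xs)" for p xs \<sigma>s
    by (simp add: map_nth)
  show "comp two_Com (act two_Com (length xs) \<sigma> p) xs =
      act two_Com (arity_sum xs) (block_perm (map fst xs) \<sigma>) (comp two_Com p (map (\<lambda>i. xs ! \<sigma> i) [0..<length xs]))"
    if "\<sigma> permutes {..<length xs}" for p \<sigma> and xs :: "(nat \<times> nat) list"
  proof -
    \<comment> \<open>The composition only sees the sum of the indices, which depends on the
      multiset of arguments and is hence unchanged when they are permuted.\<close>
    have "mset (map (\<lambda>i. xs ! \<sigma> i) [0..<length xs]) = image_mset ((!) xs) (image_mset \<sigma> (mset [0..<length xs]))"
      by (simp add: image_mset.compositionality o_def)
    also have "\<dots> = mset (map ((!) xs) [0..<length xs])"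
      unfolding image_mset_permutes[OF that] by simp
    finally have "mset (map (\<lambda>i. xs ! \<sigma> i) [0..<length xs]) = mset xs"
      by (simp only: map_nth)
    then have "sum_mset (image_mset snd (mset (map (\<lambda>i. xs ! \<sigma> i) [0..<length xs]))) = sum_mset (image_mset snd (mset xs))"
      by simp
    then show ?thesis
      unfolding mset_map[symmetric] sum_mset_sum_list by simp
  qed
qed (auto simp: sum_list_replicate)

section \<open>Decorated partitions and the fibre product of posets\<close>

lemma inj_on_fst_iff: "inj_on fst \<alpha> \<longleftrightarrow> (\<forall>A p p'. (A, p) \<in> \<alpha> \<longrightarrow> (A, p') \<in> \<alpha> \<longrightarrow> p = p')"
proof
  show "\<forall>A p p'. (A, p) \<in> \<alpha> \<longrightarrow> (A, p') \<in> \<alpha> \<longrightarrow> p = p'" if "inj_on fst \<alpha>"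
    using inj_onD[OF that, of "(_, _)" "(_, _)"] by auto
qed (auto intro!: inj_onI)

lemma in_merge_decorations [simp]:
  "(A, r) \<in> merge_decorations (\<alpha>, \<beta>) \<longleftrightarrow> (A, fst r) \<in> \<alpha> \<and> (A, snd r) \<in> \<beta>"
  by (cases r) (simp add: merge_decorations_def)

lemma in_underlying: "A \<in> underlying \<alpha> \<longleftrightarrow> (\<exists>p. (A, p) \<in> \<alpha>)"
  by (force simp: underlying_def)

lemma underlying_eq_iff:
  "underlying \<alpha> = underlying \<beta> \<longleftrightarrow>
     (\<forall>A p. (A, p) \<in> \<alpha> \<longrightarrow> (\<exists>q. (A, q) \<in> \<beta>)) \<and> (\<forall>A q. (A, q) \<in> \<beta> \<longrightarrow> (\<exists>p. (A, p) \<in> \<alpha>))"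
  unfolding set_eq_iff in_underlying by blast

lemma fiber_productD:
  assumes "(\<alpha>, \<beta>) \<in> fiber_product P Q n"
  shows "underlying \<alpha> = underlying \<beta>" "inj_on fst \<alpha>" "inj_on fst \<beta>"
    "underlying (merge_decorations (\<alpha>, \<beta>)) = underlying \<alpha>" "inj_on fst (merge_decorations (\<alpha>, \<beta>))"
proof -
  show 1: "underlying \<alpha> = underlying \<beta>" "inj_on fst \<alpha>" "inj_on fst \<beta>"
    using assms by (simp_all add: fiber_product_def operadic_partitions_def)
  show "underlying (merge_decorations (\<alpha>, \<beta>)) = underlying \<alpha>"
    using 1(1) unfolding underlying_eq_iff by auto
  show "inj_on fst (merge_decorations (\<alpha>, \<beta>))"
    using 1(2,3) unfolding inj_on_fst_iff by (simp add: prod_eq_iff) blast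
qed

text \<open>The inverse projects the decorations. Equality of the underlying partitions ensures that
  merging loses no block.\<close>

lemma merge_decorations_bij:
  "bij_betw merge_decorations (fiber_product P Q n) (operadic_partitions (hadamard P Q) n)"
proof (rule bij_betw_byWitness)
  let ?split = "\<lambda>\<omega>. ((\<lambda>(A, r). (A, fst r)) ` \<omega>, (\<lambda>(A, r). (A, snd r)) ` \<omega>)"
  have in_fst: "(A, p) \<in> (\<lambda>(A, r). (A, fst r)) ` \<omega> \<longleftrightarrow> (\<exists>q. (A, (p, q)) \<in> \<omega>)"
    for A p and \<omega> :: "(nat set \<times> 'a \<times> 'b) set"
    by force
  have in_snd: "(A, q) \<in> (\<lambda>(A, r). (A, snd r)) ` \<omega> \<longleftrightarrow> (\<exists>p. (A, (p, q)) \<in> \<omega>)"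
    for A q and \<omega> :: "(nat set \<times> 'a \<times> 'b) set"
    by force
  show "\<forall>x\<in>fiber_product P Q n. ?split (merge_decorations x) = x"
  proof
    fix x assume "x \<in> fiber_product P Q n"
    moreover obtain \<alpha> \<beta> where x: "x = (\<alpha>, \<beta>)"
      by fastforce
    ultimately have under: "\<And>A p. (A, p) \<in> \<alpha> \<Longrightarrow> \<exists>q. (A, q) \<in> \<beta>" "\<And>A q. (A, q) \<in> \<beta> \<Longrightarrow> \<exists>p. (A, p) \<in> \<alpha>"
      using fiber_productD(1)[of \<alpha> \<beta> P Q n] unfolding underlying_eq_iff by blast+
    have "(\<lambda>(A, r). (A, fst r)) ` merge_decorations (\<alpha>, \<beta>) = \<alpha>"
      unfolding set_eq_iff split_paired_All in_fst in_merge_decorations fst_conv snd_conv using under by blast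
    moreover have "(\<lambda>(A, r). (A, snd r)) ` merge_decorations (\<alpha>, \<beta>) = \<beta>"
      unfolding set_eq_iff split_paired_All in_snd in_merge_decorations fst_conv snd_conv using under by blast
    ultimately show "?split (merge_decorations x) = x"
      by (simp add: x)
  qed
  show "\<forall>\<omega>\<in>operadic_partitions (hadamard P Q) n. merge_decorations (?split \<omega>) = \<omega>"
  proof
    fix \<omega> assume "\<omega> \<in> operadic_partitions (hadamard P Q) n"
    then have "inj_on fst \<omega>"
      by (simp add: operadic_partitions_def)
    \<comment> \<open>Projecting and merging again could pair the first component of one decoration
      with the second of another on the same block; each block has only one decoration, so this
      cannot happen.\<close>
    then have inj: "q = q'" if "(A, (p, q)) \<in> \<omega>" "(A, (p', q')) \<in> \<omega>" for A p q p' q'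
      using that unfolding inj_on_fst_iff by blast
    show "merge_decorations (?split \<omega>) = \<omega>"
      unfolding set_eq_iff split_paired_All in_merge_decorations in_fst in_snd fst_conv snd_conv
      using inj by blast
  qed
  show "merge_decorations ` fiber_product P Q n \<subseteq> operadic_partitions (hadamard P Q) n"
  proof clarify
    fix \<alpha> \<beta> assume x: "(\<alpha>, \<beta>) \<in> fiber_product P Q n"
    then show "merge_decorations (\<alpha>, \<beta>) \<in> operadic_partitions (hadamard P Q) n"
      using fiber_productD(4,5)[OF x] by (auto simp: operadic_partitions_def fiber_product_def)
  qed
  show "?split ` operadic_partitions (hadamard P Q) n \<subseteq> fiber_product P Q n"
  proof (rule image_subsetI)
    fix \<omega> assume w: "\<omega> \<in> operadic_partitions (hadamard P Q) n"
    have under: "underlying ((\<lambda>(A, r). (A, fst r)) ` \<omega>) = underlying \<omega>" "underlying ((\<lambda>(A, r). (A, snd r)) ` \<omega>) = underlying \<omega>"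
      unfolding underlying_eq_iff in_fst in_snd by auto
    have inj: "inj_on fst ((\<lambda>(A, r). (A, fst r)) ` \<omega>)" "inj_on fst ((\<lambda>(A, r). (A, snd r)) ` \<omega>)"
      using w unfolding inj_on_fst_iff in_fst in_snd operadic_partitions_def by blast+
    have "\<forall>(A, p)\<in>(\<lambda>(A, r). (A, fst r)) ` \<omega>. p \<in> ops P (card A)" "\<forall>(A, p)\<in>(\<lambda>(A, r). (A, snd r)) ` \<omega>. p \<in> ops Q (card A)"
      using w by (auto simp: operadic_partitions_def)
    then show "?split \<omega> \<in> fiber_product P Q n"
      using w by (simp add: fiber_product_def operadic_partitions_def under inj)
  qed
qed

lemma operadic_leD:
  assumes "operadic_le P n \<alpha> \<beta>"
  shows "refines {1..n} (underlying \<alpha>) (underlying \<beta>)"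
    "\<lbrakk>(B, q) \<in> \<beta>; distinct bs; set bs \<subseteq> \<alpha>; B = (\<Union>(A, p)\<in>set bs. A)\<rbrakk> \<Longrightarrow>
       \<exists>p\<in>ops P (length bs). q = labelled_comp P p bs B"
  using assms unfolding operadic_le_def by auto

lemma operadic_leI:
  assumes "refines {1..n} (underlying \<alpha>) (underlying \<beta>)"
    "\<And>B q bs. \<lbrakk>(B, q) \<in> \<beta>; distinct bs; set bs \<subseteq> \<alpha>; B = (\<Union>(A, p)\<in>set bs. A)\<rbrakk> \<Longrightarrow>
       \<exists>p\<in>ops P (length bs). q = labelled_comp P p bs B"
  shows "operadic_le P n \<alpha> \<beta>"
  using assms unfolding operadic_le_def by blast

text \<open>A labelled composite in a Hadamard product is computed componentwise with the same
  relabelling of inputs, so the existence of a composing pair splits into two independent existence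
  statements. The remaining work matches lists of blocks decorated in one operad with lists
  decorated by pairs.\<close>

lemma poset_fiber_product: "poset_is_fiber_product (hadamard P Q) P Q"
  unfolding poset_is_fiber_product_def
proof (intro allI impI conjI ballI merge_decorations_bij)
  fix n :: nat and x y
  let ?H = "hadamard P Q"
  assume x: "x \<in> fiber_product P Q n" and y: "y \<in> fiber_product P Q n"
  obtain \<alpha> \<beta> where ab: "x = (\<alpha>, \<beta>)" by fastforce
  obtain \<alpha>' \<beta>' where ab': "y = (\<alpha>', \<beta>')" by fastforce
  let ?fst = "map (\<lambda>(A, r). (A, fst r))" and ?snd = "map (\<lambda>(A, r). (A, snd r))"
  have labels: "block_labels (?fst bs) = block_labels bs" "block_labels (?snd bs) = block_labels bs"
    for bs :: "(nat set \<times> ('a \<times> 'b)) list"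
    by (simp_all add: block_labels_def o_def split_def)
  have lc: "labelled_comp ?H (p, q) bs B = (labelled_comp P p (?fst bs) B, labelled_comp Q q (?snd bs) B)" for p q bs B
    unfolding labelled_comp_def labels by (simp add: o_def split_def)
  have refines: "refines {1..n} (underlying (merge_decorations x)) (underlying (merge_decorations y)) \<longleftrightarrow>
      refines {1..n} (underlying \<alpha>) (underlying \<alpha>')"
    "underlying \<alpha> = underlying \<beta>" "underlying \<alpha>' = underlying \<beta>'"
    using fiber_productD(1,4)[OF x[unfolded ab]] fiber_productD(1,4)[OF y[unfolded ab']] by (simp_all add: ab ab')
  have inj: "inj_on fst (merge_decorations x)"
    using fiber_productD(5)[OF x[unfolded ab]] by (simp add: ab)
  have Union: "(\<Union>(A, p)\<in>set (?fst bs). A) = (\<Union>(A, p)\<in>set bs. A)" "(\<Union>(A, p)\<in>set (?snd bs). A) = (\<Union>(A, p)\<in>set bs. A)"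
    for bs :: "(nat set \<times> ('a \<times> 'b)) list"
    by auto
  have pair: "\<exists>q. (A, q) \<in> \<beta>" if "(A, p) \<in> \<alpha>" for A p
    using refines(2) that unfolding underlying_eq_iff by blast
  have pair2: "\<exists>p. (A, p) \<in> \<alpha>" if "(A, q) \<in> \<beta>" for A q
    using refines(2) that unfolding underlying_eq_iff by blast
  have pair': "\<exists>q. (A, q) \<in> \<beta>'" if "(A, p) \<in> \<alpha>'" for A p
    using refines(3) that unfolding underlying_eq_iff by blast
  have pair2': "\<exists>p. (A, p) \<in> \<alpha>'" if "(A, q) \<in> \<beta>'" for A q
    using refines(3) that unfolding underlying_eq_iff by blast
  show "fiber_le P Q n x y \<longleftrightarrow> operadic_le ?H n (merge_decorations x) (merge_decorations y)"
  proof
    assume "fiber_le P Q n x y"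
    then have le: "operadic_le P n \<alpha> \<alpha>'" "operadic_le Q n \<beta> \<beta>'"
      by (simp_all add: fiber_le_def ab ab')
    have "\<exists>p\<in>ops ?H (length bs). r = labelled_comp ?H p bs B"
      if r: "(B, r) \<in> merge_decorations y" and bs: "distinct bs" "set bs \<subseteq> merge_decorations x"
        and B: "B = (\<Union>(A, p)\<in>set bs. A)" for B r bs
    proof -
      obtain q q' where q: "r = (q, q')" "(B, q) \<in> \<alpha>'" "(B, q') \<in> \<beta>'"
        using r by (cases r) (simp add: ab')
      \<comment> \<open>Dropping a component of the decorations might identify entries of the list.
        The entries already differ in their blocks, and the blocks survive the projection.\<close>
      have "distinct (map fst bs)"
        using bs(1) inj_on_subset[OF inj bs(2)] by (simp add: distinct_map)
      moreover have "map fst (?fst bs) = map fst bs" "map fst (?snd bs) = map fst bs"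
        by auto
      ultimately have "distinct (map fst (?fst bs))" "distinct (map fst (?snd bs))"
        by (simp_all only:)
      then have "distinct (?fst bs)" "distinct (?snd bs)"
        using distinct_map[of fst "?fst bs"] distinct_map[of fst "?snd bs"] by blast+
      moreover have "set (?fst bs) \<subseteq> \<alpha>" "set (?snd bs) \<subseteq> \<beta>"
        using bs(2) by (auto simp: ab)
      ultimately obtain p p' where "p \<in> ops P (length (?fst bs))" "q = labelled_comp P p (?fst bs) B"
          "p' \<in> ops Q (length (?snd bs))" "q' = labelled_comp Q p' (?snd bs) B"
        using operadic_leD(2)[OF le(1) q(2), of "?fst bs"] operadic_leD(2)[OF le(2) q(3), of "?snd bs"]
        unfolding Union B[symmetric] by blast
      then show ?thesis
        by (intro bexI[of _ "(p, p')"]) (simp_all add: lc q(1))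
    qed
    then show "operadic_le ?H n (merge_decorations x) (merge_decorations y)"
      using operadic_leD(1)[OF le(1)] refines(1) by (intro operadic_leI) auto
  next
    assume le: "operadic_le ?H n (merge_decorations x) (merge_decorations y)"
    have ref: "refines {1..n} (underlying \<alpha>) (underlying \<alpha>')"
      using operadic_leD(1)[OF le] refines(1) by simp
    have "\<exists>p\<in>ops P (length bs). q = labelled_comp P p bs B"
      if q: "(B, q) \<in> \<alpha>'" and bs: "distinct bs" "set bs \<subseteq> \<alpha>" and B: "B = (\<Union>(A, p)\<in>set bs. A)" for B q bs
    proof -
      obtain q' where "(B, q') \<in> \<beta>'"
        using pair'[OF q] by blast
      with q have r: "(B, (q, q')) \<in> merge_decorations y"
        by (simp add: ab')
      \<comment> \<open>To test the order for one operad, the given list of blocks is completed to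
        pairs by the decoration that the other partition puts on the same block.\<close>
      define d where "d A = (SOME q. (A, q) \<in> \<beta>)" for A
      have d: "(A, d A) \<in> \<beta>" if "(A, p) \<in> \<alpha>" for A p
        unfolding d_def using someI_ex[OF pair[OF that]] .
      define cs where "cs = map (\<lambda>(A, p). (A, (p, d A))) bs"
      have len: "length cs = length bs" and fst: "?fst cs = bs"
        by (simp_all add: cs_def o_def split_def)
      have "distinct cs"
        using bs(1) fst by (metis distinct_map)
      moreover have "set cs \<subseteq> merge_decorations x"
        using bs(2) d by (auto simp: cs_def ab)
      ultimately obtain p where "p \<in> ops ?H (length cs)" "(q, q') = labelled_comp ?H p cs B"
        using operadic_leD(2)[OF le r, of cs] Union(1)[of cs] B unfolding fst by blast
      then show ?thesis
        using lc[of "fst p" "snd p" cs B, unfolded fst] len by (intro bexI[of _ "fst p"]) auto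
    qed
    then have "operadic_le P n \<alpha> \<alpha>'"
      using ref by (intro operadic_leI) auto
    moreover have "\<exists>p\<in>ops Q (length bs). q = labelled_comp Q p bs B"
      if q: "(B, q) \<in> \<beta>'" and bs: "distinct bs" "set bs \<subseteq> \<beta>" and B: "B = (\<Union>(A, p)\<in>set bs. A)" for B q bs
    proof -
      obtain q' where "(B, q') \<in> \<alpha>'"
        using pair2'[OF q] by blast
      with q have r: "(B, (q', q)) \<in> merge_decorations y"
        by (simp add: ab')
      define d where "d A = (SOME p. (A, p) \<in> \<alpha>)" for A
      have d: "(A, d A) \<in> \<alpha>" if "(A, p) \<in> \<beta>" for A p
        unfolding d_def using someI_ex[OF pair2[OF that]] .
      define cs where "cs = map (\<lambda>(A, p). (A, (d A, p))) bs"
      have len: "length cs = length bs" and snd: "?snd cs = bs"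
        by (simp_all add: cs_def o_def split_def)
      have "distinct cs"
        using bs(1) snd by (metis distinct_map)
      moreover have "set cs \<subseteq> merge_decorations x"
        using bs(2) d by (auto simp: cs_def ab)
      ultimately obtain p where "p \<in> ops ?H (length cs)" "(q', q) = labelled_comp ?H p cs B"
        using operadic_leD(2)[OF le r, of cs] Union(2)[of cs] B unfolding snd by blast
      then show ?thesis
        using lc[of "fst p" "snd p" cs B, unfolded snd] len by (intro bexI[of _ "snd p"]) auto
    qed
    then have "operadic_le Q n \<beta> \<beta>'"
      using ref refines(2,3) by (intro operadic_leI) auto
    ultimately show "fiber_le P Q n x y"
      by (simp add: fiber_le_def ab ab')
  qed
qed

section \<open>The linearization of the Hadamard product\<close>

lemma lbind_sum_right: "lbind f (\<lambda>a. \<Sum>i\<in>I. F i a) = (\<Sum>i\<in>I. lbind f (F i))"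
  by (induction I rule: infinite_finite_induct) (simp_all add: lbind_add_right)

lemma keys_lbindE:
  assumes "b \<in> Poly_Mapping.keys (lbind f F)"
  obtains a where "a \<in> Poly_Mapping.keys f" "b \<in> Poly_Mapping.keys (F a)"
  using subsetD[OF keys_lbind assms] by blast

lemma list_tensor_extend:
  "list_tensor (map (\<lambda>(m, g). (m, lbind g (F m))) gs) =
     lbind (list_tensor gs) (\<lambda>xs. list_tensor (map (\<lambda>(m, a). (m, F m a)) xs))"
proof (induction gs)
  case (Cons mg gs)
  obtain m g where mg: "mg = (m, g)"
    by fastforce
  show ?case
    by (simp add: mg Cons.IH lbind_assoc) (subst lbind_commute, rule refl)
qed simp

lemma list_tensor_zero: "(m, 0) \<in> set gs \<Longrightarrow> list_tensor gs = 0"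
  by (induction gs) auto

lemma linearize_comp_zero: "(m, 0) \<in> set gs \<Longrightarrow> comp (linearize P) f gs = 0"
  by (simp add: linearize_comp list_tensor_zero)

text \<open>Both sides are multilinear, so compatibility with composition on trees suffices; the
  nested extensions only have to be brought into the same order.\<close>

lemma linearize_comp_extend:
  assumes key: "\<And>t zs. \<lbrakk>operad_args T zs; t \<in> ops T (length zs)\<rbrakk> \<Longrightarrow>
      F (arity_sum zs) (comp T t zs) = comp (linearize H) (F (length zs) t) (map (\<lambda>(m, a). (m, F m a)) zs)"
    and xs: "operad_args (linearize T) xs" and f: "Poly_Mapping.keys f \<subseteq> ops T (length xs)"
  shows "lbind (comp (linearize T) f xs) (F (arity_sum xs)) =
    comp (linearize H) (lbind f (F (length xs))) (map (\<lambda>(m, y). (m, lbind y (F m))) xs)"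
proof -
  have "lbind (comp (linearize T) f xs) (F (arity_sum xs)) =
      lbind f (\<lambda>t. lbind (list_tensor xs) (\<lambda>zs. F (arity_sum xs) (comp T t zs)))"
    by (simp add: linearize_comp lbind_assoc)
  also have "\<dots> = lbind f (\<lambda>t. lbind (list_tensor xs) (\<lambda>zs.
      comp (linearize H) (F (length xs) t) (map (\<lambda>(m, a). (m, F m a)) zs)))"
  proof (intro lbind_cong refl)
    fix t zs assume t: "t \<in> Poly_Mapping.keys f" and zs: "zs \<in> Poly_Mapping.keys (list_tensor xs)"
    show "F (arity_sum xs) (comp T t zs) = comp (linearize H) (F (length xs) t) (map (\<lambda>(m, a). (m, F m a)) zs)"
      using key[of zs t] operad_args_tensor[OF xs zs] t f by auto
  qed
  also have "\<dots> = comp (linearize H) (lbind f (F (length xs))) (map (\<lambda>(m, y). (m, lbind y (F m))) xs)"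
    unfolding linearize_comp list_tensor_extend lbind_assoc
    by (intro lbind_cong refl, subst lbind_commute) (rule refl)
  finally show ?thesis .
qed

text \<open>The tag \<open>b a\<close> depends on the original basis element \<open>a\<close> and is
  constant along the vector \<open>F m a\<close>, so it can be attached after the tensor product has
  been formed.\<close>

lemma list_tensor_pair:
  "list_tensor (map (\<lambda>(m, a). (m, lbind (F m a) (\<lambda>p. pure (p, b a)))) zs) =
     lbind (list_tensor (map (\<lambda>(m, a). (m, F m a)) zs))
       (\<lambda>ys. pure (map2 (\<lambda>(m, a) (m', p). (m, (p, b a))) zs ys))"
  by (induction zs) (auto simp: lbind_assoc)

section \<open>The morphism that counts black vertices\<close>

locale coloured_onto = lin_onto "tree_operad E" \<psi> "linearize P"
  for E :: "'e set" and \<psi> :: "nat \<Rightarrow> (('e, nat) btree \<Rightarrow>\<^sub>0 'k::field) \<Rightarrow> ('p \<Rightarrow>\<^sub>0 'k)" and P :: "'p operad"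
begin

abbreviation T1 :: "('e, nat) btree operad" where "T1 \<equiv> tree_operad E"
abbreviation T2 :: "('e \<times> colour, nat) btree operad" where "T2 \<equiv> tree_operad (two_gens E)"
abbreviation H :: "('p \<times> nat) operad" where "H \<equiv> hadamard P two_Com"

text \<open>The value on a single tree. It is a vector, because the given isomorphism need not take
  trees to elements of \<open>P\<close>.\<close>

definition \<psi>0 :: "nat \<Rightarrow> ('e, nat) btree \<Rightarrow> ('p \<Rightarrow>\<^sub>0 'k)" where
  "\<psi>0 n t = \<psi> n (pure t)"

lemma \<psi>_eq:
  assumes n: "1 \<le> n" and f: "Poly_Mapping.keys f \<subseteq> ops T1 n"
  shows "\<psi> n f = lbind f (\<psi>0 n)"
proof -
  have add: "\<psi> n (g + h) = \<psi> n g + \<psi> n h" if "Poly_Mapping.keys g \<subseteq> ops T1 n" "Poly_Mapping.keys h \<subseteq> ops T1 n" for g h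
    using onto_add[OF n that] by simp
  \<comment> \<open>The morphism axioms contain no clause for zero, so this is extracted from
    additivity.\<close>
  have zero: "\<psi> n 0 = 0"
    using add[of 0 0] by simp
  have "\<psi> n (\<Sum>t\<in>S. scale (c t) (pure t)) = (\<Sum>t\<in>S. scale (c t) (\<psi>0 n t))"
    if "finite S" "S \<subseteq> ops T1 n" for S and c :: "_ \<Rightarrow> 'k"
    using that
  proof (induction S rule: finite_induct)
    case (insert t S)
    have "\<psi> n (scale (c t) (pure t) + (\<Sum>t\<in>S. scale (c t) (pure t))) =
        \<psi> n (scale (c t) (pure t)) + \<psi> n (\<Sum>t\<in>S. scale (c t) (pure t))"
    proof (rule add)
      show "Poly_Mapping.keys (scale (c t) (pure t)) \<subseteq> ops T1 n"
        by (intro keys_scale_subset keys_single_subset) (use insert.prems in simp)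
      show "Poly_Mapping.keys (\<Sum>t\<in>S. scale (c t) (pure t)) \<subseteq> ops T1 n"
        by (intro keys_sum_subset keys_scale_subset keys_single_subset) (use insert.prems in auto)
    qed
    moreover have "\<psi> n (scale (c t) (pure t)) = scale (c t) (\<psi>0 n t)"
      using onto_smult[OF n, of "pure t" "c t"] insert.prems by (simp add: \<psi>0_def)
    ultimately show ?case
      using insert by simp
  qed (simp add: zero)
  from this[OF finite_keys f, of "Poly_Mapping.lookup f"] show ?thesis
    unfolding lbind_pure_right[of f, unfolded lbind_def] by (simp only: lbind_def)
qed

lemma keys_\<psi>0: "\<lbrakk>1 \<le> n; t \<in> ops T1 n\<rbrakk> \<Longrightarrow> Poly_Mapping.keys (\<psi>0 n t) \<subseteq> ops P n"
  using onto_ops[of n] by (force simp: \<psi>0_def)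

lemma \<psi>0_comp:
  assumes "operad_args T1 zs" "t \<in> ops T1 (length zs)"
  shows "\<psi>0 (arity_sum zs) (comp T1 t zs) =
    comp (linearize P) (\<psi>0 (length zs) t) (map (\<lambda>(m, a). (m, \<psi>0 m a)) zs)"
proof -
  have "operad_args (linearize T1) (map (\<lambda>(m, a). (m, pure a :: _ \<Rightarrow>\<^sub>0 'k)) zs)"
    using assms(1) by (auto simp: operad_args_def)
  moreover have "map (\<lambda>(m, y). (m, \<psi> m y)) (map (\<lambda>(m, a). (m, pure a)) zs) = map (\<lambda>(m, a). (m, \<psi>0 m a)) zs"
    by (auto simp: \<psi>0_def)
  ultimately show ?thesis
    using onto_comp[of "map (\<lambda>(m, a). (m, pure a)) zs" "pure t"] assms(2)
    by (simp add: linearize_comp_pure \<psi>0_def[of _ t] \<psi>0_def[of _ "comp T1 t zs"] del: map_map)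
qed

lemma \<psi>0_act:
  assumes "1 \<le> n" "\<sigma> permutes {..<n}" "t \<in> ops T1 n"
  shows "\<psi>0 n (map_btree id \<sigma> t) = lbind (\<psi>0 n t) (\<lambda>p. pure (act P n \<sigma> p))"
  using onto_act[OF assms(1,2), of "pure t"] assms(3) by (simp add: \<psi>0_def linearize_act)

text \<open>With K[P_n \<times> {..<n}] read as a tensor product, this is the image of the
  uncoloured tree tensored with the operation of \<open>two_Com\<close> whose index is the number of
  black vertices.\<close>

definition \<Psi>0 :: "nat \<Rightarrow> ('e \<times> colour, nat) btree \<Rightarrow> ('p \<times> nat \<Rightarrow>\<^sub>0 'k)" where
  "\<Psi>0 n t = lbind (\<psi>0 n (uncolour t)) (\<lambda>p. pure (p, blacks t))"

definition \<Psi> :: "nat \<Rightarrow> (('e \<times> colour, nat) btree \<Rightarrow>\<^sub>0 'k) \<Rightarrow> ('p \<times> nat \<Rightarrow>\<^sub>0 'k)" where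
  "\<Psi> n f = lbind f (\<Psi>0 n)"

lemma uncolour_comp:
  assumes "operad_args T2 zs" "t \<in> ops T2 (length zs)"
  shows "uncolour (comp T2 t zs) = comp T1 (uncolour t) (map (\<lambda>(m, a). (m, uncolour a)) zs)"
proof -
  have fst: "map fst (map (\<lambda>(m, a). (m, uncolour a)) zs) = map fst zs"
    by auto
  show ?thesis
    using assms unfolding tree_comp map_btree_graft fst
    by (intro graft_cong) (auto simp: in_tree_ops_iff btree.map_comp split_def)
qed

lemma blacks_graft: "blacks (graft t h) = blacks t + (\<Sum>a\<in>#leaves t. blacks (h a))"
  by (induction t) auto

lemma blacks_comp:
  assumes "t \<in> ops T2 (length zs)"
  shows "blacks (comp T2 t zs) = blacks t + (\<Sum>(m, a)\<leftarrow>zs. blacks a)"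
proof -
  have "(\<Sum>i\<in>#leaves t. blacks (snd (zs ! i))) = (\<Sum>i\<leftarrow>[0..<length zs]. blacks (snd (zs ! i)))"
    using assms by (simp add: in_tree_ops_iff del: mset_upt flip: sum_mset_sum_list)
  also have "map (\<lambda>i. blacks (snd (zs ! i))) [0..<length zs] = map (\<lambda>(m, a). blacks a) zs"
    by (rule nth_equalityI) (auto simp: split_def)
  finally show ?thesis
    by (simp add: tree_comp blacks_graft)
qed

lemma list_tensor_\<Psi>0:
  "list_tensor (map (\<lambda>(m, a). (m, \<Psi>0 m a)) zs) =
     lbind (list_tensor (map (\<lambda>(m, a). (m, \<psi>0 m (uncolour a))) zs))
       (\<lambda>ys. pure (map2 (\<lambda>(m, a) (m', p). (m, (p, blacks a))) zs ys))"
  unfolding \<Psi>0_def by (rule list_tensor_pair)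

text \<open>Black vertices add up under grafting, which is exactly the composition of indices in
  \<open>two_Com\<close>; the other component is the multiplicativity of
  \<open>\<psi>0\<close>.\<close>

lemma \<Psi>0_comp:
  assumes zs: "operad_args T2 zs" and t: "t \<in> ops T2 (length zs)"
  shows "\<Psi>0 (arity_sum zs) (comp T2 t zs) =
    comp (linearize H) (\<Psi>0 (length zs) t) (map (\<lambda>(m, a). (m, \<Psi>0 m a)) zs)"
proof -
  let ?us = "map (\<lambda>(m, a). (m, uncolour a)) zs"
  have us: "operad_args T1 ?us"
    using zs by (auto simp: operad_args_def)
  have map_us: "map (\<lambda>(m, a). (m, \<psi>0 m a)) ?us = map (\<lambda>(m, a). (m, \<psi>0 m (uncolour a))) zs"
    by auto
  let ?gs = "map (\<lambda>(m, a). (m, \<psi>0 m (uncolour a))) zs"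
  have "\<Psi>0 (arity_sum zs) (comp T2 t zs) =
      lbind (comp (linearize P) (\<psi>0 (length zs) (uncolour t)) ?gs)
        (\<lambda>p. pure (p, blacks t + (\<Sum>(m, a)\<leftarrow>zs. blacks a)))"
    using \<psi>0_comp[OF us, of "uncolour t"] t
    by (simp add: \<Psi>0_def uncolour_comp[OF zs t] blacks_comp[OF t] map_us del: map_map)
  also have "\<dots> = lbind (\<psi>0 (length zs) (uncolour t)) (\<lambda>p. lbind (list_tensor ?gs) (\<lambda>ys.
      pure (comp P p ys, blacks t + (\<Sum>(m, a)\<leftarrow>zs. blacks a))))"
    by (simp add: linearize_comp lbind_assoc)
  also have "\<dots> = lbind (\<psi>0 (length zs) (uncolour t)) (\<lambda>p. lbind (list_tensor ?gs) (\<lambda>ys.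
      pure (comp H (p, blacks t) (map2 (\<lambda>(m, a) (m', p). (m, (p, blacks a))) zs ys))))"
  proof (intro lbind_cong refl arg_cong[of _ _ pure])
    fix p ys assume "ys \<in> Poly_Mapping.keys (list_tensor ?gs)"
    then have "list_all2 (\<lambda>(m, q) (m', g). m = m' \<and> q \<in> Poly_Mapping.keys g) ys ?gs"
      by (rule keys_list_tensor)
    then have "list_all2 (\<lambda>(m, a) (m', p). m = m') zs ys"
      by (auto simp: list_all2_conv_all_nth split_def)
    then have "map (\<lambda>(m, x). (m, fst x)) (map2 (\<lambda>(m, a) (m', p). (m, (p, blacks a))) zs ys) = ys"
        "sum_list (map snd (map (\<lambda>(m, x). (m, snd x)) (map2 (\<lambda>(m, a) (m', p). (m, (p, blacks a))) zs ys))) =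
          (\<Sum>(m, a)\<leftarrow>zs. blacks a)"
      by (induction rule: list_all2_induct) auto
    then show "(comp P p ys, blacks t + (\<Sum>(m, a)\<leftarrow>zs. blacks a)) =
        comp H (p, blacks t) (map2 (\<lambda>(m, a) (m', p). (m, (p, blacks a))) zs ys)"
      by (simp only: hadamard_simps two_Com_simps)
  qed
  also have "\<dots> = comp (linearize H) (\<Psi>0 (length zs) t) (map (\<lambda>(m, a). (m, \<Psi>0 m a)) zs)"
    by (simp add: linearize_comp list_tensor_\<Psi>0 lbind_assoc \<Psi>0_def[of "length zs"])
  finally show ?thesis .
qed

lemma vsize_ops: "t \<in> ops (tree_operad E') n \<Longrightarrow> Suc (vsize t) = n"
  using size_leaves[of t] by (simp add: in_tree_ops_iff)

lemma blacks_less: "t \<in> ops T2 n \<Longrightarrow> blacks t < n"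
  using vsize_ops[of t "two_gens E" n] blacks_le[of t] by simp

lemma paint_in_ops: "t \<in> ops T1 n \<Longrightarrow> paint t b \<in> ops T2 n"
  using uncolour_in_ops_iff[of "paint t b" E n] by simp

lemma \<Psi>0_paint:
  assumes "t \<in> ops T1 n" "b < n"
  shows "\<Psi>0 n (paint t b) = lbind (\<psi>0 n t) (\<lambda>p. pure (p, b))"
  using vsize_ops[OF assms(1)] assms(2) by (simp add: \<Psi>0_def blacks_paint min_def)

lemma coloured_lin_onto: "lin_onto T2 \<Psi> (linearize H)"
proof
  fix n :: nat assume n: "1 \<le> n"
  show "ops (linearize H) n = \<Psi> n ` {f. Poly_Mapping.keys f \<subseteq> ops T2 n}"
  proof (intro set_eqI iffI)
    fix h :: "'p \<times> nat \<Rightarrow>\<^sub>0 'k" assume "h \<in> ops (linearize H) n"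
    then have h: "Poly_Mapping.keys h \<subseteq> ops P n \<times> {..<n}"
      by simp
    have "\<exists>g. Poly_Mapping.keys g \<subseteq> ops T1 n \<and> \<psi> n g = pure p" if "p \<in> ops P n" for p
    proof -
      have "pure p \<in> ops (linearize P :: ('k, _) lin_operad) n"
        using that by simp
      then show ?thesis
        unfolding onto_ops[OF n] by force
    qed
    then obtain g where g: "\<And>p. p \<in> ops P n \<Longrightarrow> Poly_Mapping.keys (g p) \<subseteq> ops T1 n \<and> \<psi> n (g p) = pure p"
      by metis
    \<comment> \<open>To hit the basis element \<open>(p, i)\<close>, \<open>p\<close> is lifted to
      a combination of trees and each tree is painted with \<open>i\<close> black vertices. There is
      room for them because \<open>i < n\<close> and a tree of arity n has n - 1 vertices.\<close>
    define f where "f = lbind h (\<lambda>(p, i). lbind (g p) (\<lambda>t. pure (paint t i)))"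
    have "Poly_Mapping.keys f \<subseteq> ops T2 n"
    proof
      fix s assume "s \<in> Poly_Mapping.keys f"
      then obtain p i where "(p, i) \<in> Poly_Mapping.keys h" "s \<in> Poly_Mapping.keys (lbind (g p) (\<lambda>t. pure (paint t i)))"
        unfolding f_def by (elim keys_lbindE) auto
      moreover from this obtain t where "t \<in> Poly_Mapping.keys (g p)" "s = paint t i"
        by (auto elim!: keys_lbindE)
      ultimately show "s \<in> ops T2 n"
        using h g paint_in_ops by blast
    qed
    moreover have "\<Psi> n f = h"
    proof -
      have "\<Psi> n f = lbind h (\<lambda>(p, i). lbind (g p) (\<lambda>t. \<Psi>0 n (paint t i)))"
        by (simp add: \<Psi>_def f_def lbind_assoc split_def)
      also have "\<dots> = lbind h pure"
      proof (intro lbind_cong refl, clarify)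
        fix p i assume "(p, i) \<in> Poly_Mapping.keys h"
        then have p: "p \<in> ops P n" and i: "i < n"
          using h by auto
        have "lbind (g p) (\<lambda>t. \<Psi>0 n (paint t i)) = lbind (g p) (\<lambda>t. lbind (\<psi>0 n t) (\<lambda>p. pure (p, i)))"
          using g[OF p] i by (intro lbind_cong refl \<Psi>0_paint) auto
        also have "\<dots> = lbind (\<psi> n (g p)) (\<lambda>p. pure (p, i))"
          using \<psi>_eq[OF n conjunct1[OF g[OF p]]] by (simp add: lbind_assoc)
        finally show "lbind (g p) (\<lambda>t. \<Psi>0 n (paint t i)) = pure (p, i)"
          using g[OF p] by simp
      qed
      finally show ?thesis
        by simp
    qed
    ultimately show "h \<in> \<Psi> n ` {f. Poly_Mapping.keys f \<subseteq> ops T2 n}"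
      by blast
  next
    fix h assume "h \<in> \<Psi> n ` {f. Poly_Mapping.keys f \<subseteq> ops T2 n}"
    then obtain f where f: "h = \<Psi> n f" "Poly_Mapping.keys f \<subseteq> ops T2 n"
      by auto
    have "Poly_Mapping.keys h \<subseteq> ops P n \<times> {..<n}"
    proof
      fix x assume "x \<in> Poly_Mapping.keys h"
      then obtain t where t: "t \<in> Poly_Mapping.keys f" "x \<in> Poly_Mapping.keys (\<Psi>0 n t)"
        unfolding f(1) \<Psi>_def by (auto elim!: keys_lbindE)
      then obtain p where "p \<in> Poly_Mapping.keys (\<psi>0 n (uncolour t))" "x = (p, blacks t)"
        unfolding \<Psi>0_def by (auto elim!: keys_lbindE)
      moreover have "t \<in> ops T2 n"
        using t(1) f(2) by blast
      ultimately show "x \<in> ops P n \<times> {..<n}"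
        using keys_\<psi>0[OF n, of "uncolour t"] blacks_less[of t n] by auto
    qed
    then show "h \<in> ops (linearize H) n"
      by simp
  qed
  fix f g :: "('e \<times> colour, nat) btree \<Rightarrow>\<^sub>0 'k"
  show "\<Psi> n (f + g) = add (linearize H) n (\<Psi> n f) (\<Psi> n g)"
    by (simp add: \<Psi>_def lbind_add_left)
  show "\<Psi> n (scale c f) = smult (linearize H) n c (\<Psi> n f)" for c
    by (simp add: \<Psi>_def lbind_scale_left)
  show "\<Psi> n (act (linearize T2) n \<sigma> f) = act (linearize H) n \<sigma> (\<Psi> n f)"
    if \<sigma>: "\<sigma> permutes {..<n}" and f: "Poly_Mapping.keys f \<subseteq> ops T2 n" for \<sigma>
    unfolding \<Psi>_def linearize_act lbind_assoc
  proof (intro lbind_cong refl)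
    fix t assume "t \<in> Poly_Mapping.keys f"
    then have "uncolour t \<in> ops T1 n"
      using f by auto
    moreover have "uncolour (map_btree id \<sigma> t) = map_btree id \<sigma> (uncolour t)"
      by (simp add: btree.map_comp)
    ultimately show "lbind (pure (act T2 n \<sigma> t)) (\<Psi>0 n) = lbind (\<Psi>0 n t) (\<lambda>p. pure (act H n \<sigma> p))"
      by (simp add: \<Psi>0_def \<psi>0_act[OF n \<sigma>] lbind_assoc)
  qed
next
  have "\<psi>0 1 (Leaf 0) = pure (unit P)"
    using onto_unit by (simp add: \<psi>0_def)
  then show "\<Psi> 1 (pure (unit T2)) = unit (linearize H)"
    by (simp add: \<Psi>_def \<Psi>0_def)
next
  fix xs :: "(nat \<times> (('e \<times> colour, nat) btree \<Rightarrow>\<^sub>0 'k)) list" and f :: "('e \<times> colour, nat) btree \<Rightarrow>\<^sub>0 'k"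
  assume "operad_args (linearize T2) xs" "Poly_Mapping.keys f \<subseteq> ops T2 (length xs)"
  then show "\<Psi> (arity_sum xs) (comp (linearize T2) f xs) =
      comp (linearize H) (\<Psi> (length xs) f) (map (\<lambda>(m, y). (m, \<Psi> m y)) xs)"
    unfolding \<Psi>_def using linearize_comp_extend[OF \<Psi>0_comp] by blast
qed

end

section \<open>Tree representatives of the quadratic relations\<close>

definition quadratic_reps ::
    "'e set \<Rightarrow> nat \<Rightarrow> (nat \<Rightarrow> nat \<Rightarrow> 'e \<Rightarrow> 'e \<Rightarrow> 'k::field) \<Rightarrow> nat \<Rightarrow> (('e, nat) btree \<Rightarrow>\<^sub>0 'k) set" where
  "quadratic_reps E t \<gamma> n = (if n = 3 then
     {(\<Sum>l\<in>{1..3}. \<Sum>i\<in>E. \<Sum>j\<in>E. Poly_Mapping.single (T_tree l i j) (\<gamma> k l i j)) | k. k \<in> {1..t}} else {})"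

definition two_reps ::
    "'e set \<Rightarrow> nat \<Rightarrow> (nat \<Rightarrow> nat \<Rightarrow> 'e \<Rightarrow> 'e \<Rightarrow> 'k::field) \<Rightarrow> nat \<Rightarrow> (('e \<times> colour, nat) btree \<Rightarrow>\<^sub>0 'k) set" where
  "two_reps E t \<gamma> n = (if n = 3 then
     {coloured_relation E \<gamma> k White White | k. k \<in> {1..t}} \<union>
     {coloured_relation E \<gamma> k Black Black | k. k \<in> {1..t}} \<union>
     {pure (T_tree l (i, White) (j, Black)) - pure (T_tree l (i, Black) (j, White))
       | l i j. l \<in> {1..3} \<and> i \<in> E \<and> j \<in> E} \<union>
     {coloured_relation E \<gamma> k White Black | k. k \<in> {1..t}} else {})"

lemma quadratic_relations_eq:
  "quadratic_relations E \<tau> t \<gamma> = (\<lambda>n. free_class E \<tau> n ` quadratic_reps E t \<gamma> n)"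
  by (auto simp: fun_eq_iff quadratic_relations_def quadratic_reps_def)

lemma two_relations_eq:
  "two_relations E \<tau> t \<gamma> = (\<lambda>n. free_class (two_gens E) (two_action \<tau>) n ` two_reps E t \<gamma> n)"
  by (simp add: fun_eq_iff two_relations_def two_reps_def)

lemma T_tree_in_ops: "\<lbrakk>i \<in> E; j \<in> E\<rbrakk> \<Longrightarrow> T_tree l i j \<in> ops (tree_operad E) 3"
  by (auto simp: in_tree_ops_iff T_tree_def mset_upt_3 add_mset_commute numeral_2_eq_2 simp del: mset_upt)

lemma quadratic_presentation: "presentation E (quadratic_reps E t \<gamma>)"
proof
  fix n f assume "f \<in> quadratic_reps E t \<gamma> n"
  then obtain k where f: "n = 3" "f = (\<Sum>l\<in>{1..3}. \<Sum>i\<in>E. \<Sum>j\<in>E. Poly_Mapping.single (T_tree l i j) (\<gamma> k l i j))"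
    by (auto simp: quadratic_reps_def split: if_splits)
  show "Poly_Mapping.keys f \<subseteq> ops (tree_operad E) n"
    unfolding f by (intro keys_sum_subset keys_single_subset T_tree_in_ops)
qed

lemma keys_coloured_relation:
  "Poly_Mapping.keys (coloured_relation E \<gamma> k x y) \<subseteq> ops (tree_operad (two_gens E)) 3"
  unfolding coloured_relation_def by (intro keys_sum_subset keys_single_subset T_tree_in_ops) simp_all

lemma two_presentation: "presentation (two_gens E) (two_reps E t \<gamma>)"
proof
  fix n f assume "f \<in> two_reps E t \<gamma> n"
  then have "n = 3 \<and> ((\<exists>k x y. f = coloured_relation E \<gamma> k x y) \<or>
      (\<exists>l i j. i \<in> E \<and> j \<in> E \<and> f = pure (T_tree l (i, White) (j, Black)) - pure (T_tree l (i, Black) (j, White))))"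
    unfolding two_reps_def by (simp split: if_splits) blast
  then consider "n = 3" "\<exists>k x y. f = coloured_relation E \<gamma> k x y"
    | "n = 3" "\<exists>l i j. i \<in> E \<and> j \<in> E \<and> f = pure (T_tree l (i, White) (j, Black)) - pure (T_tree l (i, Black) (j, White))"
    by blast
  then show "Poly_Mapping.keys f \<subseteq> ops (tree_operad (two_gens E)) n"
  proof cases
    case 1
    then show ?thesis
      using keys_coloured_relation by blast
  next
    case 2
    then obtain l i j where f: "i \<in> E" "j \<in> E" "f = pure (T_tree l (i, White) (j, Black)) - pure (T_tree l (i, Black) (j, White))"
      by blast
    show ?thesis
      unfolding f(3) 2(1) by (intro keys_diff_subset keys_single_subset T_tree_in_ops) (simp_all add: f)
  qed
qed

text \<open>An argument of arity m has m - 1 vertices to paint. The hypothesis says that the budget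
  fits into the total of these capacities; it is spent greedily from the left.\<close>

lemma paint_budget:
  assumes "\<forall>m\<in>set ms. 1 \<le> m" "b + length ms \<le> sum_list ms"
  shows "\<exists>bs. list_all2 (<) bs ms \<and> sum_list bs = b"
  using assms
proof (induction ms arbitrary: b)
  case (Cons m ms)
  let ?c = "min b (m - 1)"
  have len: "length ms \<le> sum_list ms"
    using Cons.prems(1) by (induction ms) auto
  have "b - ?c + length ms \<le> sum_list ms"
    using Cons.prems len by (auto simp: min_def)
  then obtain bs where "list_all2 (<) bs ms" "sum_list bs = b - ?c"
    using Cons.IH[of "b - ?c"] Cons.prems(1) by auto
  then show ?case
    using Cons.prems(1) by (intro exI[of _ "?c # bs"]) (auto simp: min_def)
qed simp

section \<open>The kernel of the coloured morphism\<close>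

locale two_setup = coloured_onto E \<psi> P +
    one: presentation E \<tau> "quadratic_reps E t \<gamma>" +
    two: presentation "two_gens E" "two_action \<tau>" "two_reps E t \<gamma>"
  for E :: "'e set" and \<psi> :: "nat \<Rightarrow> (('e, nat) btree \<Rightarrow>\<^sub>0 'k::field) \<Rightarrow> ('p \<Rightarrow>\<^sub>0 'k)" and P :: "'p operad"
    and \<tau> :: "'e \<Rightarrow> 'e \<Rightarrow> 'k" and t :: nat and \<gamma> :: "nat \<Rightarrow> nat \<Rightarrow> 'e \<Rightarrow> 'e \<Rightarrow> 'k" +
  assumes finite_E: "finite E"
    and kernel: "\<lbrakk>1 \<le> n; Poly_Mapping.keys f \<subseteq> ops (tree_operad E) n\<rbrakk> \<Longrightarrow> \<psi> n f = 0 \<longleftrightarrow> f \<in> one.tree_ideal n"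
begin

sublocale recolouring E two.tree_ideal \<tau>
proof
  show "operadic_ideal (linearize T2) two.tree_ideal"
    by (rule two.tree_ideal)
  show "finite E"
    by (rule finite_E)
  show "symmetry_relations (two_gens E) (two_action \<tau>) n \<subseteq> two.tree_ideal n" for n
    by (rule two.symmetry_subset_tree_ideal)
  show "pure (T_tree 1 (i, White) (j, Black)) - pure (T_tree 1 (i, Black) (j, White)) \<in> two.tree_ideal 3"
    if "i \<in> E" "j \<in> E" for i j
  proof (rule subsetD[OF two.R_subset_tree_ideal])
    have "pure (T_tree 1 (i, White) (j, Black)) - pure (T_tree 1 (i, Black) (j, White)) \<in>
        {pure (T_tree l (i, White) (j, Black)) - pure (T_tree l (i, Black) (j, White))
          | l i j. l \<in> {1..3} \<and> i \<in> E \<and> j \<in> E}"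
      using that by (intro CollectI exI[of _ 1] exI[of _ i] exI[of _ j]) simp
    then show "pure (T_tree 1 (i, White) (j, Black)) - pure (T_tree 1 (i, Black) (j, White)) \<in> two_reps E t \<gamma> 3"
      unfolding two_reps_def if_P[OF refl] by (rule UnI1[OF UnI2])
  qed
qed

lemma \<psi>_tree_ideal: "\<lbrakk>1 \<le> n; f \<in> one.tree_ideal n\<rbrakk> \<Longrightarrow> lbind f (\<psi>0 n) = 0"
  using kernel[of n f] \<psi>_eq[of n f] operadic_ideal_linearizeD(1)[OF one.tree_ideal] by simp

text \<open>All terms have the same number \<open>b\<close> of black vertices, so the image is the
  image of an uncoloured symmetry with a constant tag, and that symmetry is a relation of O.\<close>

lemma \<Psi>_symmetry:
  assumes "f \<in> symmetry_relations (two_gens E) (two_action \<tau>) n"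
  shows "\<Psi> n f = 0"
proof -
  have "n = 2"
    using assms by (auto simp: symmetry_relations_def split: if_splits)
  then obtain i c where f: "n = 2" "i \<in> E" "f = pure (Node (i, c) (Leaf 1) (Leaf 0)) -
      (\<Sum>k\<in>E. Poly_Mapping.single (Node (k, c) (Leaf 0) (Leaf 1)) (\<tau> i k))"
    using assms two_symmetry_relations[OF finite_E, of \<tau>] by auto
  define b :: nat where "b = (if c = Black then 1 else 0)"
  let ?f = "pure (Node i (Leaf 1) (Leaf 0)) - (\<Sum>k\<in>E. Poly_Mapping.single (Node k (Leaf 0) (Leaf 1)) (\<tau> i k))"
  have "?f \<in> symmetry_relations E \<tau> 2"
    using f(2) by (auto simp: symmetry_relations_def)
  then have "lbind ?f (\<psi>0 2) = 0"
    using one.symmetry_subset_tree_ideal by (intro \<psi>_tree_ideal) auto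
  moreover have "\<Psi> 2 f = lbind (lbind ?f (\<psi>0 2)) (\<lambda>p. pure (p, b))"
    unfolding f(3) \<Psi>_def
    by (simp add: lbind_diff_left lbind_sum_left lbind_scale_left \<Psi>0_def b_def)
  ultimately show ?thesis
    by (simp add: f(1))
qed

text \<open>As for the symmetries: fixing the colours of the inner and the root vertex fixes the
  number of black vertices, so the tag is constant along the relation.\<close>

lemma \<Psi>_coloured_relation:
  assumes "k \<in> {1..t}"
  shows "\<Psi> 3 (coloured_relation E \<gamma> k x y) = 0"
proof -
  define b :: nat where "b = (if x = Black then 1 else 0) + (if y = Black then 1 else 0)"
  let ?f = "\<Sum>l\<in>{1..3}. \<Sum>i\<in>E. \<Sum>j\<in>E. Poly_Mapping.single (T_tree l i j) (\<gamma> k l i j)"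
  have "?f \<in> quadratic_reps E t \<gamma> 3"
    using assms by (auto simp: quadratic_reps_def)
  then have "lbind ?f (\<psi>0 3) = 0"
    using one.R_subset_tree_ideal by (intro \<psi>_tree_ideal) auto
  moreover have "\<Psi>0 3 (T_tree l (i, x) (j, y)) = lbind (\<psi>0 3 (T_tree l i j)) (\<lambda>p. pure (p, b))" for l i j
    by (simp add: \<Psi>0_def T_tree_def b_def)
  then have "\<Psi> 3 (coloured_relation E \<gamma> k x y) = lbind (lbind ?f (\<psi>0 3)) (\<lambda>p. pure (p, b))"
    by (simp add: \<Psi>_def coloured_relation_def lbind_sum_left lbind_scale_left)
  ultimately show ?thesis
    by simp
qed

lemma \<Psi>_swap:
  "\<Psi> 3 (pure (T_tree l (i, White) (j, Black)) - pure (T_tree l (i, Black) (j, White))) = 0"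
  by (simp add: \<Psi>_def lbind_diff_left \<Psi>0_def T_tree_def)

text \<open>The kernel is an operadic ideal, so it is enough that it contains the symmetries and the
  defining relations of the doubled operad.\<close>

lemma tree_ideal_imp_\<Psi>_0:
  assumes n: "1 \<le> n" and f: "f \<in> two.tree_ideal n"
  shows "\<Psi> n f = 0"
proof -
  interpret \<Psi>: lin_onto T2 \<Psi> "linearize H"
    by (rule coloured_lin_onto)
  \<comment> \<open>Arity 0 is left unconstrained, since the morphism properties of
    \<open>\<Psi>\<close> are available from arity 1 on.\<close>
  define I where "I n = {f. Poly_Mapping.keys f \<subseteq> ops T2 n \<and> (1 \<le> n \<longrightarrow> \<Psi> n f = 0)}" for n
  have "two.tree_ideal n \<subseteq> I n"
  proof (rule two.tree_ideal_least)
    show "operadic_ideal (linearize T2) I"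
    proof (rule operadic_idealI)
      fix n \<sigma> x assume "\<sigma> permutes {..<n}" "x \<in> I n"
      then show "act (linearize T2) n \<sigma> x \<in> I n"
        using tree.linearize_act_closed[of \<sigma> n x "two_gens E"] \<Psi>.onto_act[of n \<sigma> x]
        by (auto simp: I_def linearize_act[of H])
    next
      fix x xs assume xs: "operad_args (linearize T2) xs" and x: "x \<in> ops (linearize T2) (length xs)"
        and or: "x \<in> I (length xs) \<or> (\<exists>(m, y)\<in>set xs. y \<in> I m)"
      have "comp (linearize H) (\<Psi> (length xs) x) (map (\<lambda>(m, y). (m, \<Psi> m y)) xs) = 0"
        using or
      proof
        assume "x \<in> I (length xs)"
        then show ?thesis
          using operad_args_length[OF xs] by (simp add: I_def linearize_comp)
      next
        assume "\<exists>(m, y)\<in>set xs. y \<in> I m"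
        then obtain m y where my: "(m, y) \<in> set xs" "y \<in> I m"
          by blast
        then have "\<Psi> m y = 0"
          using xs by (auto simp: I_def operad_args_def)
        then have "(m, 0) \<in> set (map (\<lambda>(m, y). (m, \<Psi> m y)) xs)"
          using my(1) by force
        then show ?thesis
          by (rule linearize_comp_zero)
      qed
      then show "comp (linearize T2) x xs \<in> I (arity_sum xs)"
        using x tree.linearize_comp_closed[OF xs] \<Psi>.onto_comp[OF xs] by (simp add: I_def)
    qed (auto simp: I_def \<Psi>_def lbind_add_left lbind_scale_left keys_add_subset
        intro: subsetD[OF keys_add_subset] subsetD[OF keys_scale_subset])
    show "symmetry_relations (two_gens E) (two_action \<tau>) n \<subseteq> I n" for n
      using two.symmetry_closed \<Psi>_symmetry by (auto simp: I_def)
    show "two_reps E t \<gamma> n \<subseteq> I n" for n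
    proof
      fix f assume f: "f \<in> two_reps E t \<gamma> n"
      have "\<Psi> n f = 0"
        using f \<Psi>_coloured_relation \<Psi>_swap by (auto simp: two_reps_def split: if_splits)
      then show "f \<in> I n"
        using two.R_closed[OF f] by (simp add: I_def)
    qed
  qed
  then show ?thesis
    using n f by (auto simp: I_def)
qed

text \<open>Painting a composite and composing painted trees colour the same tree, possibly in
  different places but with equally many black vertices, hence agree modulo the relations. The ideal
  property of \<open>I\<close> rests on this.\<close>

lemma paint_tree_ideal:
  assumes "g \<in> one.tree_ideal n" "b < n"
  shows "lbind g (\<lambda>s. pure (paint s b)) \<in> two.tree_ideal n"
proof -
  note N = two.tree_ideal
  \<comment> \<open>All admissible numbers of black vertices are required at once: painting a
    composite distributes its budget, so a factor taken from \<open>I\<close> may receive any number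
    below its arity.\<close>
  define I where "I n = {g. Poly_Mapping.keys g \<subseteq> ops T1 n \<and>
      (\<forall>b<n. lbind g (\<lambda>s. pure (paint s b)) \<in> two.tree_ideal n)}" for n
  have "one.tree_ideal n \<subseteq> I n"
  proof (rule one.tree_ideal_least)
    show "operadic_ideal (linearize T1) I"
    proof (rule operadic_idealI)
      fix n \<sigma> x assume \<sigma>: "\<sigma> permutes {..<n}" and x: "x \<in> I n"
      have "lbind (act (linearize T1) n \<sigma> x) (\<lambda>s. pure (paint s b)) =
          act (linearize T2) n \<sigma> (lbind x (\<lambda>s. pure (paint s b)))" for b
        by (simp add: linearize_act lbind_assoc paint_map)
      then show "act (linearize T1) n \<sigma> x \<in> I n"
        using x tree.linearize_act_closed[OF \<sigma>, of x E] operadic_ideal_linearizeD(5)[OF N \<sigma>] by (simp add: I_def)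
    next
      fix x xs assume xs: "operad_args (linearize T1) xs" and x: "x \<in> ops (linearize T1) (length xs)"
        and or: "x \<in> I (length xs) \<or> (\<exists>(m, y)\<in>set xs. y \<in> I m)"
      have "lbind (comp (linearize T1) x xs) (\<lambda>s. pure (paint s b)) \<in> two.tree_ideal (arity_sum xs)"
        if b: "b < arity_sum xs" for b
      proof -
        \<comment> \<open>The outer tree has \<open>length xs - 1\<close> vertices and is filled as
          far as possible; what remains then fits into the arguments, as the bound on
          \<open>b\<close> shows.\<close>
        define b0 where "b0 = min b (length xs - 1)"
        have pos: "\<forall>m\<in>set (map fst xs). 1 \<le> m"
          using xs by (auto simp: operad_args_def)
        then have "length xs \<le> arity_sum xs"
          by (induction xs) auto
        then have "b - b0 + length (map fst xs) \<le> sum_list (map fst xs)"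
          using b unfolding b0_def length_map arity_sum_def[symmetric] by arith
        then have "\<exists>bs. list_all2 (<) bs (map fst xs) \<and> sum_list bs = b - b0"
          by (rule paint_budget[OF pos])
        then obtain bs where bs: "list_all2 (<) bs (map fst xs)" "sum_list bs = b - b0"
          by (elim exE conjE) (rule that)
        have len: "length bs = length xs"
          unfolding list_all2_lengthD[OF bs(1)] by (rule length_map)
        have b0: "b0 < length xs" "b0 + sum_list bs = b"
          using operad_args_length[OF xs] bs(2) by (auto simp: b0_def)
        let ?x = "lbind x (\<lambda>s. pure (paint s b0))"
        let ?xs = "map2 (\<lambda>F (m, y). (m, lbind y F)) (map (\<lambda>b s. pure (paint s b)) bs) xs"
        have keys: "Poly_Mapping.keys (lbind y (\<lambda>s. pure (paint s c)) :: _ \<Rightarrow>\<^sub>0 'k) \<subseteq> ops T2 m"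
          if "Poly_Mapping.keys y \<subseteq> ops T1 m" for y :: "_ \<Rightarrow>\<^sub>0 'k" and c m
          using that paint_in_ops by (auto elim!: keys_lbindE)
        have fst: "map fst ?xs = map fst xs"
          using len by (auto intro!: nth_equalityI simp: split_def)
        have sum: "arity_sum ?xs = arity_sum xs"
          unfolding arity_sum_def fst by (rule refl)
        have nth: "?xs ! i = (fst (xs ! i), lbind (snd (xs ! i)) (\<lambda>s. pure (paint s (bs ! i))))" if "i < length xs" for i
          using that len by (simp add: split_def)
        have args: "operad_args (linearize T2) ?xs"
          unfolding operad_args_def
        proof
          show "?xs \<noteq> []"
            using xs len by (auto simp: operad_args_def)
          show "\<forall>(m, q)\<in>set ?xs. 1 \<le> m \<and> q \<in> ops (linearize T2) m"
          proof (clarify)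
            fix m q assume "(m, q) \<in> set ?xs"
            then obtain i where i: "i < length ?xs" "?xs ! i = (m, q)"
              unfolding in_set_conv_nth by blast
            then have i': "i < length xs"
              by simp
            have "1 \<le> fst (xs ! i)" "Poly_Mapping.keys (snd (xs ! i)) \<subseteq> ops T1 (fst (xs ! i))"
              using xs nth_mem[OF i'] by (auto simp: operad_args_def split_def)
            then show "1 \<le> m \<and> q \<in> ops (linearize T2) m"
              using i(2) keys[of "snd (xs ! i)" m "bs ! i"] unfolding nth[OF i'] by auto
          qed
        qed
        have comp_in: "comp (linearize T2) ?x ?xs \<in> two.tree_ideal (arity_sum ?xs)"
        proof (rule operadic_ideal_compD[OF N args])
          show "?x \<in> ops (linearize T2) (length ?xs)"
            using x keys len by simp
          show "?x \<in> two.tree_ideal (length ?xs) \<or> (\<exists>(m, y)\<in>set ?xs. y \<in> two.tree_ideal m)"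
            using or
          proof
            assume "x \<in> I (length xs)"
            then show ?thesis
              using b0(1) len by (simp add: I_def)
          next
            assume "\<exists>(m, y)\<in>set xs. y \<in> I m"
            then obtain m y where "(m, y) \<in> set xs" "y \<in> I m"
              by blast
            then obtain i where i: "i < length xs" "snd (xs ! i) \<in> I (fst (xs ! i))"
              unfolding in_set_conv_nth by auto
            moreover have "bs ! i < fst (xs ! i)"
              using list_all2_nthD[OF bs(1), of i] i(1) len by simp
            ultimately have "snd (?xs ! i) \<in> two.tree_ideal (fst (?xs ! i))"
              unfolding nth[OF i(1)] by (simp add: I_def)
            moreover have "?xs ! i \<in> set ?xs"
              using i(1) len by (intro nth_mem) simp
            ultimately show ?thesis
              by (intro disjI2 bexI[of _ "?xs ! i"]) (simp_all only: split_def)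
          qed
        qed
        \<comment> \<open>The composite of painted elements is already known to be a relation, so
          only the difference from the painted composite has to be treated, and by multilinearity
          only on single trees.\<close>
        have "lbind (comp (linearize T1) x xs) (\<lambda>s. pure (paint s b)) - comp (linearize T2) ?x ?xs =
            lbind x (\<lambda>s. lbind (list_tensor xs) (\<lambda>zs. pure (paint (comp T1 s zs) b) -
              pure (comp T2 (paint s b0) (map2 (\<lambda>b (m, a). (m, paint a b)) bs zs))))"
        proof -
          have map2: "map2 (\<lambda>F (m, a). (m, F a)) (map (\<lambda>b s. pure (paint s b)) bs) zs =
              map (\<lambda>(m, a). (m, pure a :: _ \<Rightarrow>\<^sub>0 'k)) (map2 (\<lambda>b (m, a). (m, paint a b)) bs zs)"
            for zs :: "(nat \<times> ('e, nat) btree) list"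
            by (simp add: zip_map1 split_def)
          have "list_tensor ?xs = lbind (list_tensor xs) (\<lambda>zs. pure (map2 (\<lambda>b (m, a). (m, paint a b)) bs zs))"
            using len by (subst list_tensor_lbind) (simp_all only: length_map map2 list_tensor_pure)
          then show ?thesis
            by (simp add: linearize_comp lbind_assoc lbind_diff_right)
        qed
        also have "\<dots> \<in> two.tree_ideal (arity_sum xs)"
        proof (intro operadic_ideal_lbind[OF N])
          fix s zs assume s: "s \<in> Poly_Mapping.keys x" and zs: "zs \<in> Poly_Mapping.keys (list_tensor xs)"
          note zs' = operad_args_tensor[OF xs zs]
          let ?zs = "map2 (\<lambda>b (m, a). (m, paint a b)) bs zs"
          have sT: "s \<in> ops T1 (length zs)"
            using s x zs' by auto
          have cT: "comp T1 s zs \<in> ops T1 (arity_sum xs)"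
            using tree.comp_closed[OF zs'(1) sT] zs'(4) by simp
          have lenz: "length bs = length zs"
            using len zs'(2) by simp
          have vs: "list_all2 (\<lambda>b (m, a). b \<le> vsize a \<and> a \<in> ops T1 m \<and> 1 \<le> m) bs zs"
            unfolding list_all2_conv_all_nth
          proof (intro conjI allI impI lenz)
            fix i assume i: "i < length bs"
            obtain m a where ma: "zs ! i = (m, a)"
              by fastforce
            have "(m, a) \<in> set zs"
              using i lenz ma by (metis nth_mem)
            then have "a \<in> ops T1 m" "1 \<le> m"
              using zs'(1) by (auto simp: operad_args_def)
            moreover have "bs ! i < m"
              using list_all2_nthD[OF bs(1) i] i lenz ma unfolding zs'(3)[symmetric] by simp
            ultimately show "case zs ! i of (m, a) \<Rightarrow> bs ! i \<le> vsize a \<and> a \<in> ops T1 m \<and> 1 \<le> m"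
              using vsize_ops[of a E m] by (simp add: ma)
          qed
          have "\<forall>(m, q)\<in>set ?zs. 1 \<le> m \<and> q \<in> ops T2 m"
            using vs by (induction rule: list_all2_induct) (auto intro: paint_in_ops)
          then have zs2: "operad_args T2 ?zs"
            using zs'(1) lenz by (auto simp: operad_args_def)
          have unc: "map (\<lambda>(m, a). (m, uncolour a)) ?zs = zs"
            using vs by (induction rule: list_all2_induct) (auto simp: uncolour_paint[unfolded id_def])
          have bl: "(\<Sum>(m, a)\<leftarrow>?zs. blacks a) = sum_list bs"
            using vs by (induction rule: list_all2_induct) (auto simp: blacks_paint)
          have pT: "paint s b0 \<in> ops T2 (length ?zs)"
            using paint_in_ops[OF sT] lenz by simp
          \<comment> \<open>Two colourings of one tree with \<open>b\<close> black vertices each: on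
            the right the count is \<open>b0\<close> plus the sum of \<open>bs\<close>.\<close>
          have "cong (paint (comp T1 s zs) b) (comp T2 (paint s b0) ?zs)"
          proof (rule recolour)
            show "uncolour (comp T2 (paint s b0) ?zs) = comp T1 s zs"
              unfolding uncolour_comp[OF zs2 pT] unc by simp
            show "blacks (paint (comp T1 s zs) b) = blacks (comp T2 (paint s b0) ?zs)"
              unfolding blacks_comp[OF pT] bl blacks_paint
              using vsize_ops[OF cT] vsize_ops[OF sT] b b0 zs'(2) by simp
            show "vertices (comp T1 s zs) \<subseteq> E"
              using cT by (simp add: in_tree_ops_iff)
          qed simp
          then show "pure (paint (comp T1 s zs) b) - pure (comp T2 (paint s b0) ?zs) \<in> two.tree_ideal (arity_sum xs)"
            by (rule congD) (rule paint_in_ops[OF cT])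
        qed
        finally show ?thesis
          using operadic_ideal_linearizeD(3)[OF N _ comp_in[unfolded sum]] by fastforce
      qed
      then show "comp (linearize T1) x xs \<in> I (arity_sum xs)"
        using x tree.linearize_comp_closed[OF xs] by (simp add: I_def)
    next
      fix n x y assume "x \<in> I n" "y \<in> I n"
      then show "add (linearize T1) n x y \<in> I n"
        using operadic_ideal_linearizeD(3)[OF N] by (simp add: I_def lbind_add_left keys_add_subset)
    next
      fix n c x assume "x \<in> I n"
      then show "smult (linearize T1) n c x \<in> I n"
        using operadic_ideal_linearizeD(4)[OF N] by (simp add: I_def lbind_scale_left keys_scale_subset)
    qed (simp_all add: I_def operadic_ideal_linearizeD(2)[OF N])
    show "symmetry_relations E \<tau> n \<subseteq> I n" for n
    proof
      fix f assume f: "f \<in> symmetry_relations E \<tau> n"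
      then obtain i where i: "n = 2" "i \<in> E" "f = pure (Node i (Leaf 1) (Leaf 0)) -
          (\<Sum>k\<in>E. Poly_Mapping.single (Node k (Leaf 0) (Leaf 1)) (\<tau> i k))"
        by (auto simp: symmetry_relations_def split: if_splits)
      \<comment> \<open>Every tree of the relation has a single vertex, so all of them receive the
        same colour, white for \<open>b = 0\<close> and black otherwise, and the result is the
        symmetry relation of that colour.\<close>
      have "lbind f (\<lambda>s. pure (paint s b)) \<in> symmetry_relations (two_gens E) (two_action \<tau>) 2" for b
        unfolding two_symmetry_relations[OF finite_E]
        by (intro CollectI exI[of _ i] exI[of _ "if b = 0 then White else Black"])
          (simp add: i lbind_diff_left lbind_sum_left)
      then show "f \<in> I n"
        using one.symmetry_closed[of n] f two.symmetry_subset_tree_ideal[of 2] by (auto simp: I_def i(1))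
    qed
    show "quadratic_reps E t \<gamma> n \<subseteq> I n" for n
    proof
      fix f assume f: "f \<in> quadratic_reps E t \<gamma> n"
      then obtain k where k: "n = 3" "k \<in> {1..t}"
          "f = (\<Sum>l\<in>{1..3}. \<Sum>i\<in>E. \<Sum>j\<in>E. Poly_Mapping.single (T_tree l i j) (\<gamma> k l i j))"
        by (auto simp: quadratic_reps_def split: if_splits)
      have "lbind f (\<lambda>s. pure (paint s b)) \<in> two.tree_ideal 3" if "b < 3" for b
      proof -
        \<comment> \<open>The trees have two vertices and preorder reaches the root first: with one
          black vertex the root is black and the inner vertex white. The values 0, 1, 2 of
          \<open>b\<close> thus give the white, the mixed and the black relations.\<close>
        define x where "x = (if b = 2 then Black else White)"
        define y where "y = (if b = 0 then White else Black)"
        have "paint (T_tree l i j) b = T_tree l (i, x) (j, y)" for l and i j :: 'e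
          using that by (auto simp: T_tree_def x_def y_def)
        then have "lbind f (\<lambda>s. pure (paint s b)) = coloured_relation E \<gamma> k x y"
          by (simp add: k(3) coloured_relation_def lbind_sum_left)
        moreover have "coloured_relation E \<gamma> k x y \<in> two_reps E t \<gamma> 3"
          unfolding two_reps_def if_P[OF refl] using k(2) that by (auto simp: x_def y_def)
        ultimately show ?thesis
          using two.R_subset_tree_ideal[of 3] by auto
      qed
      then show "f \<in> I n"
        using one.R_closed[OF f] by (simp add: I_def k(1))
    qed
  qed
  then have "g \<in> I n"
    using assms(1) by blast
  then show ?thesis
    using assms(2) by (simp add: I_def)
qed

text \<open>Different numbers of black vertices have images in complementary subspaces, so the image
  vanishes part by part. Each uncoloured part is then a relation of O, and its canonical painting is
  a relation of the doubled operad; it differs from the original part by recolouring only.\<close>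

lemma \<Psi>_0_imp_tree_ideal:
  assumes n: "1 \<le> n" and f: "Poly_Mapping.keys f \<subseteq> ops T2 n" and \<Psi>: "\<Psi> n f = 0"
  shows "f \<in> two.tree_ideal n"
proof -
  note N = two.tree_ideal
  \<comment> \<open>The component of \<open>f\<close> with exactly \<open>b\<close> black vertices,
    with colours forgotten.\<close>
  define part where "part b = lbind f (\<lambda>s. if blacks s = b then pure (uncolour s) else 0)" for b
  have "part b \<in> one.tree_ideal n" for b
  proof -
    have keys: "Poly_Mapping.keys (part b) \<subseteq> ops T1 n"
      unfolding part_def using f by (auto elim!: keys_lbindE split: if_splits)
    \<comment> \<open>The function on pairs is the projection onto the span of the basis elements
      with second entry \<open>b\<close>; applied to the vanishing image of \<open>f\<close> it
      gives zero.\<close>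
    have "lbind (part b) (\<psi>0 n) = lbind f (\<lambda>s. lbind (\<Psi>0 n s) (\<lambda>(p, i). if i = b then pure p else 0))"
      unfolding part_def lbind_assoc \<Psi>0_def by (intro lbind_cong refl) simp
    also have "\<dots> = lbind (\<Psi> n f) (\<lambda>(p, i). if i = b then pure p else 0)"
      by (simp add: \<Psi>_def lbind_assoc)
    also have "\<dots> = 0"
      by (simp add: \<Psi>)
    finally show ?thesis
      using kernel[OF n keys] \<psi>_eq[OF n keys] by simp
  qed
  then have "(\<Sum>b<n. lbind (part b) (\<lambda>s. pure (paint s b))) \<in> two.tree_ideal n"
    by (intro operadic_ideal_sum[OF N] paint_tree_ideal) auto
  also have "(\<Sum>b<n. lbind (part b) (\<lambda>s. pure (paint s b))) =
      lbind f (\<lambda>s. pure (paint (uncolour s) (blacks s)))"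
  proof -
    \<comment> \<open>A tree of arity n has fewer than n black vertices, so each tree of
      \<open>f\<close> occurs in exactly one of the summands.\<close>
    have "(\<Sum>b<n. lbind (part b) (\<lambda>s. pure (paint s b))) =
        lbind f (\<lambda>s. \<Sum>b<n. if blacks s = b then pure (paint (uncolour s) b) else 0)"
      unfolding part_def lbind_assoc lbind_sum_right by (intro sum.cong lbind_cong refl) simp
    also have "\<dots> = lbind f (\<lambda>s. pure (paint (uncolour s) (blacks s)))"
      using f blacks_less by (intro lbind_cong refl) (auto simp: sum.delta)
    finally show ?thesis .
  qed
  finally have 1: "lbind f (\<lambda>s. pure (paint (uncolour s) (blacks s))) \<in> two.tree_ideal n" .
  have "f - lbind f (\<lambda>s. pure (paint (uncolour s) (blacks s))) =
      lbind f (\<lambda>s. pure s - pure (paint (uncolour s) (blacks s)))"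
    by (simp add: lbind_diff_right)
  also have "\<dots> \<in> two.tree_ideal n"
  proof (rule operadic_ideal_lbind[OF N])
    fix s assume "s \<in> Poly_Mapping.keys f"
    then have s: "s \<in> ops T2 n"
      using f by blast
    have "cong s (paint (uncolour s) (blacks s))"
    proof (rule recolour)
      show "blacks s = blacks (paint (uncolour s) (blacks s))"
        using blacks_le[of s] by (simp add: blacks_paint)
      have "uncolour s \<in> ops T1 n"
        using s by simp
      then show "vertices (uncolour s) \<subseteq> E"
        by (simp only: in_tree_ops_iff)
    qed simp_all
    then show "pure s - pure (paint (uncolour s) (blacks s)) \<in> two.tree_ideal n"
      by (rule congD[OF _ s])
  qed
  finally show ?thesis
    using operadic_ideal_linearizeD(3)[OF N _ 1, of "f - lbind f (\<lambda>s. pure (paint (uncolour s) (blacks s)))"] by simp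
qed

text \<open>Both maps are linear with the same kernel. Equality of fibres is the form in which
  \<open>onto_imp_iso\<close> uses this.\<close>

lemma \<Psi>_eq_iff:
  assumes "1 \<le> n" "Poly_Mapping.keys f \<subseteq> ops T2 n" "Poly_Mapping.keys g \<subseteq> ops T2 n"
  shows "\<Psi> n f = \<Psi> n g \<longleftrightarrow> two.proj n f = two.proj n g"
  using tree_ideal_imp_\<Psi>_0[of n "f - g"] \<Psi>_0_imp_tree_ideal[of n "f - g"] keys_diff_subset[OF assms(2,3)] assms
  by (auto simp: two.proj_eq_iff \<Psi>_def lbind_diff_left)

lemma two_operad_iso: "lin_operad_iso (two_operad E \<tau> t \<gamma>) (linearize (hadamard P two_Com))"
proof -
  interpret proj: lin_epi T2 two.proj "quotient_operad (free_operad (two_gens E) (two_action \<tau>)) two.relations_ideal"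
    by (rule two.proj_epi)
  have "lin_operad_iso (quotient_operad (free_operad (two_gens E) (two_action \<tau>)) two.relations_ideal)
      (linearize H :: ('k, _) lin_operad)"
    by (rule proj.onto_imp_iso[OF coloured_lin_onto]) (rule \<Psi>_eq_iff)
  then show ?thesis
    unfolding two_operad_def two_relations_eq two.relations_ideal_def .
qed

end

theorem corollary2p13:
  fixes E :: "'e set"
    and \<tau> :: "'e \<Rightarrow> 'e \<Rightarrow> 'k::field"
    and t :: nat
    and \<gamma> :: "nat \<Rightarrow> nat \<Rightarrow> 'e \<Rightarrow> 'e \<Rightarrow> 'k"
    and P :: "'p operad"
  assumes "S2_module E \<tau>"
    and "is_linearization (quadratic_operad E \<tau> t \<gamma>) P"
  shows "is_linearization (two_operad E \<tau> t \<gamma>) (hadamard P two_Com) \<and>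
         poset_is_fiber_product (hadamard P two_Com) P two_Com"
proof (intro conjI poset_fiber_product)
  interpret one: presentation E \<tau> "quadratic_reps E t \<gamma>"
    by (rule quadratic_presentation)
  interpret two: presentation "two_gens E" "two_action \<tau>" "two_reps E t \<gamma>"
    by (rule two_presentation)
  have P: "set_operad P" and iso: "lin_operad_iso (quadratic_operad E \<tau> t \<gamma>) (linearize P)"
    using assms(2) by (simp_all add: is_linearization_def)
  have "quadratic_operad E \<tau> t \<gamma> = quotient_operad (free_operad E \<tau>) one.relations_ideal"
    by (simp add: quadratic_operad_def quadratic_relations_eq one.relations_ideal_def)
  \<comment> \<open>The given isomorphism enters only through this surjection from linearized trees,
    whose fibres are those of the projection to the quadratic operad.\<close>
  from lin_epi.iso_imp_onto[OF one.proj_epi iso[unfolded this]] obtain \<psi> where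
    onto: "lin_onto (tree_operad E) \<psi> (linearize P)" and
    eq: "\<And>n f g. \<lbrakk>1 \<le> n; Poly_Mapping.keys f \<subseteq> ops (tree_operad E) n; Poly_Mapping.keys g \<subseteq> ops (tree_operad E) n\<rbrakk>
       \<Longrightarrow> \<psi> n f = \<psi> n g \<longleftrightarrow> one.proj n f = one.proj n g"
    by blast
  interpret lin_onto "tree_operad E" \<psi> "linearize P"
    by (rule onto)
  have zero: "\<psi> n 0 = 0" if "1 \<le> n" for n
    using onto_add[OF that, of 0 0] by simp
  interpret two_setup E \<psi> P \<tau> t \<gamma>
  proof
    show "finite E"
      using assms(1) by (simp add: S2_module_def)
    show "\<psi> n f = 0 \<longleftrightarrow> f \<in> one.tree_ideal n" if "1 \<le> n" "Poly_Mapping.keys f \<subseteq> ops (tree_operad E) n" for n f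
      using eq[OF that, of 0] one.proj_eq_iff[OF that(2), of 0] by (simp add: zero[OF that(1)])
  qed
  show "is_linearization (two_operad E \<tau> t \<gamma>) (hadamard P two_Com)"
    unfolding is_linearization_def using set_operad_hadamard[OF P set_operad_two_Com] two_operad_iso by simp
qed

end
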